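(* Let $R$ be of type $A_2$. For $0>\Re k>-0.5$ and any $f\in\mathbb C[X^{\pm1},Y^{\pm1}]$, $$\mathrm{ct}(f\mu)=\frac{I_0^{\imath a}(f)}{(2\pi\imath a)^2}+\frac1{2\pi\imath a}\int_{-\imath\pi a}^{\imath\pi a}\bigl(f(t^{-1},q^y)+f(q^y,t^{-1})\bigr)\zeta^1_0(q^y)\,dy+\frac1{2\pi\imath a}\int_{-\imath\pi a}^{\imath\pi a}f(t^{-1}q^{-y},q^y)\,\zeta^2_0(q^y)\,dy+\varrho f(t^{-1},t^{-1}).$$ For $-0.5>\Re k>-1$, the term $\varrho f(t^{-1},t^{-1})$ here must be replaced by $$\varrho\Bigl(f(t^{-1},t^{-1})+\varpi_1(1,1)f(tq,t^{-2}q^{-1})+\varpi_2(1,1)\bigl(f(t^2q,t^{-1})+f(t^{-1},t^2q)\bigr)\Bigr).$$ Also, the term $\varpi_1(1,1)f(tq,t^{-2}q^{-1})$ in the latter sum must be omitted when $\Re k=-0.5$. The functions $f(q^x,q^y)$ here are arbitrary analytic provided the convergence of the integrals.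
   Context: $q=e^{-1/a}$, $a>0$, $t=q^k$. For $A_2$ with simple roots $\alpha_1,\alpha_2$ write $x=x_{\alpha_1}$, $y=x_{\alpha_2}$, $X=q^x$, $Y=q^y$; functions are written $f(X,Y)=f(q^x,q^y)$. The mu-function is $$\mu(X,Y)=\prod_{Z\in\{X,Y,XY\}}\prod_{i=0}^\infty\frac{(1-Zq^i)(1-Z^{-1}q^{i+1})}{(1-tZq^i)(1-tZ^{-1}q^{i+1})}.$$ $I_0^{\imath a}(f)=\int_{-\imath\pi a}^{\imath\pi a}\int_{-\imath\pi a}^{\imath\pi a}f(q^x,q^y)\mu(q^x,q^y)\,dx\,dy$. For $f$ a Laurent polynomial, $\mathrm{ct}(f\mu)$ is the constant term of $f\mu$ ($\mu$ being expanded in terms of non-negative powers of $t$, $X$, $Y$, $qX^{-1}Y^{-1}$ etc., i.e. of $X_{\tilde\alpha}$ for positive affine roots); it is a meromorphic function of $k$, equal to $I_0^{\imath a}(f)/(2\pi\imath a)^2$ for $\Re k>0$, so that for $\Re k\le0$ it is the meromorphic continuation of the latter (and it means this continuation for more general $f$). Notation: $$\varrho_0=\prod_{i=0}^\infty\frac{(1-t^{-1}q^i)(1-tq^{i+1})}{(1-q^{i+1})(1-t^2q^{i+1})},\qquad \varrho=\prod_{i=0}^\infty\frac{(1-t^{-1}q^i)(1-tq^{i+1})^2(1-t^{-2}q^i)}{(1-q^{i+1})^2(1-t^2q^{i+1})(1-t^3q^{i+1})},$$ $$\zeta^1_0(q^z)=\varrho_0\prod_{j=0}^\infty\frac{(1-q^{-z+j+1})(1-t^{-1}q^{z+j})}{(1-tq^{z+j})(1-t^2q^{-z+j+1})},\qquad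 \zeta^2_0(q^z)=\varrho_0t^{-1}\prod_{j=1}^\infty\frac{(1-q^{z+j})(1-t^{-1}q^{-z+j})}{(1-tq^{-z+j})(1-t^2q^{z+j})},$$ $$\varpi_1(1,1)=t^{-1}\frac{1-t^3q}{1-tq},\qquad \varpi_2(1,1)=1.$$
   Formalization: At Re k = -0.5 the one-dimensional integrands have poles on the path, so those integrals are taken over Re y = ε for all small ε > 0; values of k where ϱ_0 or ϱ has a pole (t^2 q^{i+1} = 1 or t^3 q^{i+1} = 1) are excluded. *)

theory Defs
  imports "HOL-Complex_Analysis.Complex_Analysis"
begin

definition q_of :: "real \<Rightarrow> complex" where
  "q_of a = complex_of_real (exp (- 1 / a))"

definition t_of :: "real \<Rightarrow> complex \<Rightarrow> complex" where
  "t_of a k = q_of a powr k"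

definition mu_factor :: "complex \<Rightarrow> complex \<Rightarrow> complex \<Rightarrow> complex" where
  "mu_factor q t Z = (\<Prod>i. ((1 - Z * q ^ i) * (1 - inverse Z * q ^ (i + 1))) /
                           ((1 - t * Z * q ^ i) * (1 - t * inverse Z * q ^ (i + 1))))"

text \<open>The product over \<open>Z \<in> {X, Y, XY}\<close> is over the three positive roots, so it is written out:
  a product over a set of complex numbers would merge coinciding values of \<open>Z\<close>.\<close>

definition mu :: "complex \<Rightarrow> complex \<Rightarrow> complex \<Rightarrow> complex \<Rightarrow> complex" where
  "mu q t X Y = mu_factor q t X * mu_factor q t Y * mu_factor q t (X * Y)"

definition period_integral :: "real \<Rightarrow> real \<Rightarrow> (complex \<Rightarrow> complex) \<Rightarrow> complex" where
  "period_integral a \<epsilon> g =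
     contour_integral (linepath (of_real \<epsilon> - \<i> * pi * a) (of_real \<epsilon> + \<i> * pi * a)) g"

definition I0 :: "real \<Rightarrow> complex \<Rightarrow> (complex \<Rightarrow> complex \<Rightarrow> complex) \<Rightarrow> complex" where
  "I0 a k f = period_integral a 0 (\<lambda>x. period_integral a 0 (\<lambda>y.
     f (q_of a powr x) (q_of a powr y) * mu (q_of a) (t_of a k) (q_of a powr x) (q_of a powr y)))"


text \<open>\<open>((m, n), j)\<close> stands for the affine root \<open>[m\<alpha>\<^sub>1 + n\<alpha>\<^sub>2, j]\<close>, with
  \<open>X\<^bsub>[\<alpha>, j]\<^esub> = X^m Y^n q^j\<close>; then \<open>\<mu>\<close> is the product of \<open>(1 - u) / (1 - t u)\<close>
  over \<open>u = X\<^bsub>[\<alpha>, j]\<^esub>\<close> with \<open>[\<alpha>, j]\<close> positive.\<close>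

definition positive_affine_roots :: "((int \<times> int) \<times> nat) set" where
  "positive_affine_roots =
     {(1, 0), (0, 1), (1, 1)} \<times> UNIV \<union> {(-1, 0), (0, -1), (-1, -1)} \<times> {1..}"

text \<open>Coefficient of \<open>u^n\<close> in the expansion of \<open>(1 - u) / (1 - t u)\<close> in powers of \<open>t\<close> and \<open>u\<close>.\<close>

definition factor_coeff :: "complex \<Rightarrow> nat \<Rightarrow> complex" where
  "factor_coeff t n = (if n = 0 then 1 else t ^ n - t ^ (n - 1))"

text \<open>Multiplying out the factors: a term of the expansion of \<open>\<mu>\<close> is given by the exponents
  \<open>\<nu> \<alpha>\<close> of the \<open>X\<^bsub>\<alpha>\<^esub>\<close>, almost all of them zero. The terms contributing to \<open>X^m Y^n\<close> are:\<close>

definition mu_terms :: "int \<Rightarrow> int \<Rightarrow> ((int \<times> int) \<times> nat \<Rightarrow> nat) set" where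
  "mu_terms m n = {\<nu>. finite {\<alpha>. \<nu> \<alpha> \<noteq> 0} \<and> {\<alpha>. \<nu> \<alpha> \<noteq> 0} \<subseteq> positive_affine_roots \<and>
     (\<Sum>\<alpha> | \<nu> \<alpha> \<noteq> 0. int (\<nu> \<alpha>) * fst (fst \<alpha>)) = m \<and>
     (\<Sum>\<alpha> | \<nu> \<alpha> \<noteq> 0. int (\<nu> \<alpha>) * snd (fst \<alpha>)) = n}"

definition mu_coeff :: "complex \<Rightarrow> complex \<Rightarrow> int \<Rightarrow> int \<Rightarrow> complex" where
  "mu_coeff q t m n =
     (\<Sum>\<^sub>\<infinity>\<nu>\<in>mu_terms m n. \<Prod>\<alpha> | \<nu> \<alpha> \<noteq> 0. factor_coeff t (\<nu> \<alpha>) * (q ^ snd \<alpha>) ^ \<nu> \<alpha>)"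

definition laurent_coeffs ::
  "(complex \<Rightarrow> complex \<Rightarrow> complex) \<Rightarrow> (int \<times> int \<Rightarrow> complex) \<Rightarrow> bool" where
  "laurent_coeffs f c \<longleftrightarrow> finite {p. c p \<noteq> 0} \<and>
     (\<forall>X Y. X \<noteq> 0 \<longrightarrow> Y \<noteq> 0 \<longrightarrow>
        f X Y = (\<Sum>p | c p \<noteq> 0. c p * X powi fst p * Y powi snd p))"

text \<open>For \<open>Re k > 0\<close>: the constant term proper if \<open>f\<close> is a Laurent polynomial, where the
  expansion of \<open>\<mu>\<close> converges absolutely; the normalized integral for more general \<open>f\<close>.\<close>

definition ct_right :: "real \<Rightarrow> (complex \<Rightarrow> complex \<Rightarrow> complex) \<Rightarrow> complex \<Rightarrow> complex" where
  "ct_right a f k =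
     (if \<exists>c. laurent_coeffs f c
      then let c = (THE c. laurent_coeffs f c) in
           \<Sum>p | c p \<noteq> 0. c p * mu_coeff (q_of a) (t_of a k) (- fst p) (- snd p)
      else I0 a k f / (2 * pi * \<i> * a)\<^sup>2)"

text \<open>The value at \<open>k\<close> of the meromorphic continuation of \<open>g\<close> from \<open>Re z > 0\<close> to a larger right
  half-plane containing \<open>k\<close>. Such half-planes are nested and connected, so the value does not
  depend on \<open>r\<close>, and it agrees with that of a continuation to the whole plane if there is one.\<close>

definition continuation :: "(complex \<Rightarrow> complex) \<Rightarrow> complex \<Rightarrow> complex" where
  "continuation g k = (THE w. \<exists>r F. r \<le> 0 \<and> r < Re k \<and> F nicely_meromorphic_on {z. r < Re z} \<and>
     (\<forall>z. 0 < Re z \<longrightarrow> F z = g z) \<and> F k = w)"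

definition ct :: "real \<Rightarrow> (complex \<Rightarrow> complex \<Rightarrow> complex) \<Rightarrow> complex \<Rightarrow> complex" where
  "ct a f k = continuation (ct_right a f) k"


definition rho0 :: "complex \<Rightarrow> complex \<Rightarrow> complex" where
  "rho0 q t = (\<Prod>i. ((1 - inverse t * q ^ i) * (1 - t * q ^ (i + 1))) /
                    ((1 - q ^ (i + 1)) * (1 - t\<^sup>2 * q ^ (i + 1))))"

definition rho :: "complex \<Rightarrow> complex \<Rightarrow> complex" where
  "rho q t =
     (\<Prod>i. ((1 - inverse t * q ^ i) * (1 - t * q ^ (i + 1))\<^sup>2 * (1 - inverse (t\<^sup>2) * q ^ i)) /
          ((1 - q ^ (i + 1))\<^sup>2 * (1 - t\<^sup>2 * q ^ (i + 1)) * (1 - t ^ 3 * q ^ (i + 1))))"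

text \<open>The argument \<open>Z\<close> of \<open>zeta1\<close> and \<open>zeta2\<close> is \<open>q^z\<close>. In \<open>zeta2\<close> the product starts at
  \<open>j = 1\<close>, whence the exponents \<open>j + 1\<close>.\<close>

definition zeta1 :: "complex \<Rightarrow> complex \<Rightarrow> complex \<Rightarrow> complex" where
  "zeta1 q t Z = rho0 q t *
     (\<Prod>j. ((1 - inverse Z * q ^ (j + 1)) * (1 - inverse t * Z * q ^ j)) /
          ((1 - t * Z * q ^ j) * (1 - t\<^sup>2 * inverse Z * q ^ (j + 1))))"

definition zeta2 :: "complex \<Rightarrow> complex \<Rightarrow> complex \<Rightarrow> complex" where
  "zeta2 q t Z = rho0 q t * inverse t *
     (\<Prod>j. ((1 - Z * q ^ (j + 1)) * (1 - inverse t * inverse Z * q ^ (j + 1))) /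
          ((1 - t * inverse Z * q ^ (j + 1)) * (1 - t\<^sup>2 * Z * q ^ (j + 1))))"

definition varpi1 :: "complex \<Rightarrow> complex \<Rightarrow> complex" where
  "varpi1 q t = inverse t * (1 - t ^ 3 * q) / (1 - t * q)"

definition varpi2 :: "complex \<Rightarrow> complex \<Rightarrow> complex" where
  "varpi2 q t = 1"

text \<open>The two one-dimensional integrals, taken over \<open>Re y = \<epsilon>\<close>. On \<open>Re k = -1/2\<close> both integrands
  have a pole on \<open>Re y = 0\<close>, and the path is to be shifted to a small \<open>\<epsilon> > 0\<close>.\<close>

definition line_integrals ::
  "real \<Rightarrow> complex \<Rightarrow> real \<Rightarrow> (complex \<Rightarrow> complex \<Rightarrow> complex) \<Rightarrow> complex" where
  "line_integrals a k \<epsilon> f = (let q = q_of a; t = t_of a k in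
     1 / (2 * pi * \<i> * a) * period_integral a \<epsilon>
       (\<lambda>y. (f (inverse t) (q powr y) + f (q powr y) (inverse t)) * zeta1 q t (q powr y)) +
     1 / (2 * pi * \<i> * a) * period_integral a \<epsilon>
       (\<lambda>y. f (inverse t * q powr (- y)) (q powr y) * zeta2 q t (q powr y)))"

text \<open>Holomorphic on \<open>(\<complex> - {0})\<^sup>2\<close>, i.e. Frechet differentiable there with complex linear
  derivative; this includes the Laurent polynomials.\<close>

definition analytic_torus :: "(complex \<Rightarrow> complex \<Rightarrow> complex) \<Rightarrow> bool" where
  "analytic_torus f \<longleftrightarrow> (\<forall>X Y. X \<noteq> 0 \<longrightarrow> Y \<noteq> 0 \<longrightarrow>
     (\<exists>A B. ((\<lambda>(x, y). f x y) has_derivative (\<lambda>(u, v). A * u + B * v)) (at (X, Y))))"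

end

theory Submission
  imports Defs
begin

text \<open>With \<open>X = q^x\<close> the integrals become means over circles, and everything depends on \<open>k\<close> only
  through \<open>t = q^k\<close>. For \<open>|t| < 1\<close> the constant term is the mean of \<open>f \<mu>\<close> over the unit torus,
  and moving both circles to the radius \<open>r = |q|^(1/3)\<close> meets no pole; the resulting mean is
  holomorphic in \<open>|t| < 1/r\<close>. For \<open>1 < |t| < 1/r\<close> one moves the circles back to radius \<open>1\<close>,
  first that of \<open>Y\<close>, then that of \<open>X\<close>: the poles \<open>Y = 1/t\<close>, \<open>X = 1/t\<close>, \<open>X = 1/(t Y)\<close> that are crossed
  give the line integrals, and a second crossing of \<open>X = 1/t\<close> gives the point term. Each term of this
  formula continues to \<open>|t\<^sup>2 q| < 1\<close>. At \<open>|t\<^sup>2 q| = 1\<close> the poles \<open>Y = t\<^sup>2 q\<close> of \<open>\<zeta>\<^sup>1\<close> and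
  \<open>Y = 1/(t\<^sup>2 q)\<close> of \<open>\<zeta>\<^sup>2\<close> pass through the unit circle; replacing it there by a slightly smaller circle
  picks up their residues one after the other, which are the remaining point terms.\<close>

subsection \<open>Means over circles\<close>

text \<open>The exponent 1/3 balances two constraints. On |X| = |Y| = r the pole 1/t stays outside
  while |t| r < 1, and the inner pole t q / Y of the factor in X Y stays inside while |t q| < r^2.
  For r^3 = |q| both say |t| < 1/r, that is Re k > -1/3. The detour is forced because at |t| = 1 the
  pole 1/t lies on the unit circle. At |t^2 q| = 1 a pole of zeta1 and one of zeta2 reach the unit
  circle simultaneously, the former from inside and the latter from outside. On a circle of radius
  |q|^\<epsilon> slightly below 1 they arrive at different times: the zeta1 pole for some Re k above
  -1/2, the zeta2 pole for some Re k below -1/2. On the line Re k = -1/2 itself only the zeta1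
  residue has been collected, hence the missing varpi1 term. The formulas agree on overlapping open
  strips and so form one meromorphic function on Re k > -1. The prefactors rho0 and rho can have
  poles in k, so a formula gives the value of the continuation at k only where it is continuous;
  this is the role of the condition on t^2 q^(i+1) and t^3 q^(i+1).\<close>

definition circle_mean :: "real \<Rightarrow> (complex \<Rightarrow> complex) \<Rightarrow> complex" where
  "circle_mean r h = integral {0..1} (\<lambda>u. h (circlepath 0 r u))"

lemma norm_circlepath_0 [simp]: "r \<ge> 0 \<Longrightarrow> norm (circlepath 0 r u) = r"
  by (simp add: circlepath norm_mult)

lemma continuous_circlepath: "continuous_on S (circlepath 0 r)"
  unfolding circlepath by (intro continuous_intros)

lemma circle_mean_cong:
  assumes "r \<ge> 0" "\<And>z. norm z = r \<Longrightarrow> f z = g z"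
  shows "circle_mean r f = circle_mean r g"
  unfolding circle_mean_def using assms by simp

lemma circle_mean_integrable:
  fixes f :: "complex \<Rightarrow> complex"
  assumes "r \<ge> 0" "continuous_on (sphere 0 r) f"
  shows "(\<lambda>u. f (circlepath 0 r u)) integrable_on {0..1}"
proof (rule integrable_continuous_real)
  show "continuous_on {0..1} (\<lambda>u. f (circlepath 0 r u))"
    by (rule continuous_on_compose2[OF assms(2) continuous_circlepath]) (use assms in auto)
qed

lemma circle_mean_add:
  assumes "r \<ge> 0" "continuous_on (sphere 0 r) f" "continuous_on (sphere 0 r) g"
  shows "circle_mean r (\<lambda>z. f z + g z) = circle_mean r f + circle_mean r g"
  unfolding circle_mean_def using assms by (intro integral_add circle_mean_integrable)

lemma circle_mean_diff:
  assumes "r \<ge> 0" "continuous_on (sphere 0 r) f" "continuous_on (sphere 0 r) g"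
  shows "circle_mean r (\<lambda>z. f z - g z) = circle_mean r f - circle_mean r g"
  unfolding circle_mean_def using assms by (intro integral_diff circle_mean_integrable)

lemma circle_mean_sum:
  assumes "r \<ge> 0" "finite A" "\<And>i. i \<in> A \<Longrightarrow> continuous_on (sphere 0 r) (f i)"
  shows "circle_mean r (\<lambda>z. \<Sum>i\<in>A. f i z) = (\<Sum>i\<in>A. circle_mean r (f i))"
  unfolding circle_mean_def using assms by (intro integral_sum circle_mean_integrable)

lemma circle_mean_mult_right: "circle_mean r (\<lambda>z. c * f z) = c * circle_mean r f"
  unfolding circle_mean_def by (rule integral_mult_right)

lemma circle_mean_mult_left: "circle_mean r (\<lambda>z. f z * c) = circle_mean r f * c"
  unfolding circle_mean_def by (rule integral_mult_left)

lemma circle_mean_const [simp]: "circle_mean r (\<lambda>z. c) = c"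
  unfolding circle_mean_def by simp

lemma circle_mean_norm_le:
  assumes "r \<ge> 0" "continuous_on (sphere 0 r) f" "\<And>z. norm z = r \<Longrightarrow> norm (f z) \<le> B"
  shows "norm (circle_mean r f) \<le> B"
proof -
  have "norm (integral {0..1} (\<lambda>u. f (circlepath 0 r u))) \<le> B * (1 - 0)"
    by (rule integral_bound)
       (use assms in \<open>auto intro!: continuous_on_compose2[OF assms(2)] continuous_circlepath\<close>)
  thus ?thesis by (simp add: circle_mean_def)
qed

text \<open>The endpoints 0 and 1 are the only parameters that are mapped to the point 1, and two
  parameters do not influence an integral. This is for an identity that breaks down where two poles
  merge.\<close>

lemma circle_mean_cong_except_1:
  assumes "\<And>z. norm z = 1 \<Longrightarrow> z \<noteq> 1 \<Longrightarrow> f z = g z"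
  shows "circle_mean 1 f = circle_mean 1 g"
  unfolding circle_mean_def
proof (rule integral_spike[of "{0, 1}"])
  fix u :: real assume u: "u \<in> {0..1} - {0, 1}"
  have "circlepath 0 1 u \<noteq> 1"
  proof
    assume "circlepath 0 1 u = 1"
    then obtain n :: int where "2 * pi * u = of_int (2 * n) * pi"
      by (auto simp: circlepath exp_eq_1)
    hence "u = of_int n" by simp
    with u show False by auto
  qed
  thus "g (circlepath 0 1 u) = f (circlepath 0 1 u)" by (intro assms[symmetric]) auto
qed auto

text \<open>The derivative of \<open>circlepath 0 r\<close> is 2 pi \<i> times the path itself, so
  dz/z is a constant multiple of the parameter measure.\<close>

lemma contour_integral_circlepath_mean:
  assumes "r > 0"
  shows "contour_integral (circlepath 0 r) (\<lambda>z. h z / z) = 2 * pi * \<i> * circle_mean r h"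
proof -
  have "contour_integral (circlepath 0 r) (\<lambda>z. h z / z) =
        integral {0..1} (\<lambda>u. (2 * pi * \<i>) * h (circlepath 0 r u))"
    unfolding contour_integral_integral
  proof (rule integral_cong)
    fix u :: real
    have "circlepath 0 r u \<noteq> 0" using assms by (simp add: circlepath)
    moreover have "vector_derivative (circlepath 0 r) (at u) = (2 * pi * \<i>) * circlepath 0 r u"
      unfolding vector_derivative_circlepath by (simp add: circlepath)
    ultimately show "h (circlepath 0 r u) / circlepath 0 r u * vector_derivative (circlepath 0 r) (at u) =
                     2 * pi * \<i> * h (circlepath 0 r u)" by simp
  qed
  thus ?thesis by (simp add: circle_mean_def)
qed

lemma continuous_on_circle_mean:
  fixes F :: "'a::topological_space \<Rightarrow> complex \<Rightarrow> complex"
  assumes "r \<ge> 0" "continuous_on (U \<times> sphere 0 r) (\<lambda>(x, z). F x z)"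
  shows "continuous_on U (\<lambda>x. circle_mean r (F x))"
proof -
  have "continuous_on U (\<lambda>x. integral (cbox 0 1) (\<lambda>u. F x (circlepath 0 r u)))"
  proof (rule integral_continuous_on_param)
    have "continuous_on (U \<times> cbox 0 1) (\<lambda>p. (\<lambda>(x, z). F x z) (fst p, circlepath 0 r (snd p)))"
      by (rule continuous_on_compose2[OF assms(2)])
         (use assms(1) in \<open>auto intro!: continuous_intros continuous_on_compose2[OF continuous_circlepath]\<close>)
    thus "continuous_on (U \<times> cbox 0 1) (\<lambda>(x, u). F x (circlepath 0 r u))"
      by (simp add: case_prod_unfold)
  qed
  thus ?thesis by (simp add: circle_mean_def)
qed

lemma circle_mean_swap:
  assumes "r \<ge> 0" "s \<ge> 0" "continuous_on (sphere 0 r \<times> sphere 0 s) (\<lambda>(x, y). F x y)"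
  shows "circle_mean r (\<lambda>x. circle_mean s (F x)) = circle_mean s (\<lambda>y. circle_mean r (\<lambda>x. F x y))"
proof -
  have "continuous_on (cbox (0, 0) (1, 1))
          (\<lambda>p. (\<lambda>(x, y). F x y) (circlepath 0 r (fst p), circlepath 0 s (snd p)))"
    by (rule continuous_on_compose2[OF assms(3)])
       (use assms(1,2) in \<open>auto intro!: continuous_intros continuous_on_compose2[OF continuous_circlepath]\<close>)
  hence "continuous_on (cbox (0::real, 0::real) (1, 1)) (\<lambda>(u, v). F (circlepath 0 r u) (circlepath 0 s v))"
    by (simp add: case_prod_unfold)
  from integral_swap_continuous[OF this] show ?thesis by (simp add: circle_mean_def)
qed

text \<open>Morera's theorem: integration along the sides of a triangle commutes with the mean, and
  for each fixed z the integral around the triangle vanishes by Cauchy's theorem.\<close>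

lemma circle_mean_holomorphic:
  assumes r: "r \<ge> 0" and U: "open U"
    and cont: "continuous_on (U \<times> sphere 0 r) (\<lambda>(t, z). F t z)"
    and holo: "\<And>z. norm z = r \<Longrightarrow> (\<lambda>t. F t z) holomorphic_on U"
  shows "(\<lambda>t. circle_mean r (F t)) holomorphic_on U"
proof -
  have "(\<lambda>t. circle_mean r (F t)) analytic_on U"
  proof (rule Morera_triangle[OF _ U], rule continuous_on_circle_mean[OF r cont], intro impI)
    fix a b c assume sub: "convex hull {a, b, c} \<subseteq> U"
    have seg: "closed_segment a b \<subseteq> U" "closed_segment b c \<subseteq> U" "closed_segment c a \<subseteq> U"
      using sub by (meson closed_segment_subset_convex_hull dual_order.trans hull_inc insertI1 insertI2)+
    have cont_lin: "continuous_on ({0..1} \<times> sphere 0 r) (\<lambda>(x, z). F (linepath a b x) z)"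
      if "closed_segment a b \<subseteq> U" for a b
    proof -
      have "continuous_on ({0..1} \<times> sphere 0 r)
              (\<lambda>p. (\<lambda>(t, z). F t z) (linepath a b (fst p), snd p))"
        by (rule continuous_on_compose2[OF cont])
           (use that in \<open>auto intro!: continuous_intros continuous_on_compose2[OF continuous_on_linepath]
              simp: linepath_in_path subset_iff\<close>)
      thus ?thesis by (simp add: case_prod_unfold)
    qed
    have cont_I: "continuous_on (sphere 0 r) (\<lambda>z. contour_integral (linepath a b) (\<lambda>t. F t z))"
      if "closed_segment a b \<subseteq> U" for a b
    proof -
      have "continuous_on (sphere 0 r \<times> {0..1}) (\<lambda>p. (\<lambda>(x, z). F (linepath a b x) z) (snd p, fst p))"
        by (rule continuous_on_compose2[OF cont_lin[OF that]]) (auto intro!: continuous_intros)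
      hence "continuous_on (sphere 0 r \<times> cbox 0 1) (\<lambda>(z, x). F (linepath a b x) z * (b - a))"
        by (auto simp: case_prod_unfold intro!: continuous_intros)
      from integral_continuous_on_param[OF this] show ?thesis
        by (simp add: contour_integral_integral)
    qed
    have swap: "contour_integral (linepath a b) (\<lambda>t. circle_mean r (F t)) =
                circle_mean r (\<lambda>z. contour_integral (linepath a b) (\<lambda>t. F t z))"
      if "closed_segment a b \<subseteq> U" for a b
    proof -
      have "continuous_on (cbox (0, 0) (1, 1))
              (\<lambda>p. (\<lambda>(x, z). F (linepath a b x) z) (fst p, circlepath 0 r (snd p)))"
        by (rule continuous_on_compose2[OF cont_lin[OF that]])
           (use r in \<open>auto intro!: continuous_intros continuous_on_compose2[OF continuous_circlepath]\<close>)
      hence "continuous_on (cbox (0::real, 0::real) (1, 1))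
               (\<lambda>(x, u). F (linepath a b x) (circlepath 0 r u) * (b - a))"
        by (auto simp: case_prod_unfold intro!: continuous_intros)
      from integral_swap_continuous[OF this] show ?thesis
        by (simp add: contour_integral_integral circle_mean_def)
    qed
    have "circle_mean r (\<lambda>z. contour_integral (linepath a b) (\<lambda>t. F t z) +
             contour_integral (linepath b c) (\<lambda>t. F t z) +
             contour_integral (linepath c a) (\<lambda>t. F t z)) = circle_mean r (\<lambda>z. 0)"
    proof (rule circle_mean_cong[OF r])
      fix z :: complex assume z: "norm z = r"
      have h: "(\<lambda>t. F t z) holomorphic_on convex hull {a, b, c}"
        by (rule holomorphic_on_subset[OF holo[OF z] sub])
      have hol: "(\<lambda>t. F t z) contour_integrable_on linepath a b"
        if "closed_segment a b \<subseteq> U" for a b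
        by (intro contour_integrable_continuous_linepath holomorphic_on_imp_continuous_on
              holomorphic_on_subset[OF holo[OF z] that])
      note ci = hol[OF seg(1)] hol[OF seg(2)] hol[OF seg(3)]
      have "((\<lambda>t. F t z) has_contour_integral 0) (linepath a b +++ linepath b c +++ linepath c a)"
        by (rule Cauchy_theorem_triangle[OF h])
      hence "contour_integral (linepath a b +++ linepath b c +++ linepath c a) (\<lambda>t. F t z) = 0"
        by (rule contour_integral_unique)
      thus "contour_integral (linepath a b) (\<lambda>t. F t z) +
            contour_integral (linepath b c) (\<lambda>t. F t z) +
            contour_integral (linepath c a) (\<lambda>t. F t z) = 0"
        using ci by (simp add: add.assoc)
    qed
    thus "contour_integral (linepath a b) (\<lambda>t. circle_mean r (F t)) +
          contour_integral (linepath b c) (\<lambda>t. circle_mean r (F t)) +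
          contour_integral (linepath c a) (\<lambda>t. circle_mean r (F t)) = 0"
      using r seg by (simp add: swap circle_mean_add cont_I continuous_on_add)
  qed
  thus ?thesis by (rule analytic_imp_holomorphic)
qed

section \<open>Independence of the radius and crossing of a simple pole\<close>

lemma circle_mean_annulus:
  assumes h: "h holomorphic_on {z. r0 < norm z \<and> norm z < R0}"
    and r: "0 < r" "r0 < r" "r < R0" and R: "0 < R" "r0 < R" "R < R0"
  shows "circle_mean r h = circle_mean R h"
proof -
  \<comment> \<open>The integrand h z / z has a pole at 0, which must be taken out because
    \<open>r0\<close> may be negative.\<close>
  let ?A = "{z. r0 < norm z \<and> norm z < R0} - {0 :: complex}"
  have "open {z::complex. r0 < norm z \<and> norm z < R0}"
    by (intro open_Collect_conj open_Collect_less continuous_intros)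
  hence A: "open ?A" by (intro open_Diff) auto
  have "contour_integral (circlepath 0 r) (\<lambda>z. h z / z) = contour_integral (circlepath 0 R) (\<lambda>z. h z / z)"
  proof (rule Cauchy_theorem_homotopic_loops[OF _ A])
    show "homotopic_loops ?A (circlepath 0 r) (circlepath 0 R)"
    proof (rule homotopic_loops_linear)
      fix t x :: real
      let ?e = "exp (2 * complex_of_real pi * \<i> * complex_of_real t)"
      \<comment> \<open>Corresponding points of the two circles have the same phase, so the segment
        between them is radial and its moduli lie between r and R.\<close>
      show "closed_segment (circlepath 0 r t) (circlepath 0 R t) \<subseteq> ?A"
      proof
        fix z assume "z \<in> closed_segment (circlepath 0 r t) (circlepath 0 R t)"
        then obtain u where u: "0 \<le> u" "u \<le> 1" and
          z: "z = (1 - u) *\<^sub>R circlepath 0 r t + u *\<^sub>R circlepath 0 R t"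
          by (auto simp: closed_segment_def)
        define w where "w = (1 - u) * r + u * R"
        have "z = of_real w * ?e"
          unfolding z w_def circlepath by (simp add: scaleR_conv_of_real algebra_simps)
        hence nz: "norm z = \<bar>w\<bar>" by (simp add: norm_mult)
        have "w \<in> closed_segment r R" using u by (auto simp: closed_segment_def w_def)
        hence "min r R \<le> w" "w \<le> max r R" by (auto simp: closed_segment_eq_real_ivl split: if_splits)
        thus "z \<in> ?A" using nz r R by auto
      qed
    qed auto
  qed (use h in \<open>auto intro!: holomorphic_intros elim: holomorphic_on_subset\<close>)
  thus ?thesis using r R by (simp add: contour_integral_circlepath_mean)
qed

text \<open>Divided by z, the integrand has residue 1 at 0 and -1 at p; this circle encloses only
  its centre 0.\<close>

lemma circle_mean_inverse_inside:
  assumes "0 < r" "r < norm p"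
  shows "circle_mean r (\<lambda>z. 1 / (1 - z / p)) = 1"
proof -
  have ne: "1 - z / p \<noteq> 0" if "norm z < norm p" for z
    using that by (auto simp: field_simps)
  have "((\<lambda>u. (1 / (1 - u / p)) / (u - 0)) has_contour_integral 2 * of_real pi * \<i> * (1 / (1 - 0 / p)))
          (circlepath 0 r)"
    by (rule Cauchy_integral_circlepath_simple)
       (use assms ne in \<open>auto intro!: holomorphic_intros\<close>)
  hence "contour_integral (circlepath 0 r) (\<lambda>u. (1 / (1 - u / p)) / u) = 2 * of_real pi * \<i>"
    using contour_integral_unique by force
  thus ?thesis using contour_integral_circlepath_mean[of r "\<lambda>z. 1 / (1 - z / p)"] assms by simp
qed

text \<open>Now both poles are enclosed and their residues cancel.\<close>

lemma circle_mean_inverse_outside: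
  assumes "0 < norm p" "norm p < r"
  shows "circle_mean r (\<lambda>z. 1 / (1 - z / p)) = 0"
proof -
  have r: "r > 0" using assms by linarith
  have p: "p \<noteq> 0" using assms by auto
  have 1: "((\<lambda>u. 1 / (u - p)) has_contour_integral 2 * of_real pi * \<i> * 1) (circlepath 0 r)"
    by (rule Cauchy_integral_circlepath_simple) (use assms in auto)
  have 2: "((\<lambda>u. 1 / (u - 0)) has_contour_integral 2 * of_real pi * \<i> * 1) (circlepath 0 r)"
    by (rule Cauchy_integral_circlepath_simple) (use assms r in auto)
  have "((\<lambda>u. 1 / (u - 0) - 1 / (u - p)) has_contour_integral
           2 * of_real pi * \<i> * 1 - 2 * of_real pi * \<i> * 1) (circlepath 0 r)"
    by (rule has_contour_integral_diff[OF 2 1])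
  hence "((\<lambda>u. 1 / (u - 0) - 1 / (u - p)) has_contour_integral 0) (circlepath 0 r)"
    by simp
  hence "((\<lambda>u. (1 / (1 - u / p)) / u) has_contour_integral 0) (circlepath 0 r)"
  proof (rule has_contour_integral_eq)
    fix u assume "u \<in> path_image (circlepath 0 r)"
    hence u: "norm u = r" using r by auto
    hence "u \<noteq> 0" "u \<noteq> p" using r assms by auto
    moreover from this have "1 - u / p \<noteq> 0" using p by auto
    ultimately show "1 / (u - 0) - 1 / (u - p) = 1 / (1 - u / p) / u"
      using p by (simp add: divide_simps) (simp add: algebra_simps)
  qed
  hence "contour_integral (circlepath 0 r) (\<lambda>u. (1 / (1 - u / p)) / u) = 0"
    by (rule contour_integral_unique)
  thus ?thesis using contour_integral_circlepath_mean[of r "\<lambda>z. 1 / (1 - z / p)"] r by simp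
qed

text \<open>Replacing G by G - G p removes the pole, so that part has the same mean on both circles.
  What is left is G p times the mean of 1 / (1 - z / p), which drops from 1 to 0 when the circle
  passes p. In this normalization the residue term is simply the value G p.\<close>

lemma circle_mean_pole:
  assumes G: "G holomorphic_on {z. r0 < norm z \<and> norm z < R0}"
    and r: "0 < r" "r0 < r" "r < norm p" and R: "norm p < R" "R < R0"
  shows "circle_mean r (\<lambda>z. G z / (1 - z / p)) = circle_mean R (\<lambda>z. G z / (1 - z / p)) + G p"
proof -
  let ?A = "{z. r0 < norm z \<and> norm z < R0}"
  have p: "p \<noteq> 0" using r by auto
  have A: "open ?A"
    by (intro open_Collect_conj open_Collect_less continuous_intros)
  \<comment> \<open>The difference quotient with its removable singularity at p filled in; (G z - G
    p) / (1 - z / p) is -p times it.\<close>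
  define D where "D = (\<lambda>z. if z = p then deriv G p else (G z - G p) / (z - p))"
  have "D holomorphic_on ?A" unfolding D_def by (rule pole_lemma_open[OF G A])
  hence eq: "circle_mean r D = circle_mean R D"
    by (rule circle_mean_annulus) (use r R in auto)
  have *: "circle_mean s (\<lambda>z. G z / (1 - z / p)) =
             circle_mean s D * (- p) + G p * circle_mean s (\<lambda>z. 1 / (1 - z / p))"
    if s: "r0 < s" "s < R0" "0 < s" "s \<noteq> norm p" for s
  proof -
    have ne: "1 - z / p \<noteq> 0" "z \<noteq> p" if "norm z = s" for z
      using that s by (auto simp: field_simps)
    have c: "continuous_on (sphere 0 s) D"
      by (intro holomorphic_on_imp_continuous_on holomorphic_on_subset[OF \<open>D holomorphic_on ?A\<close>])
         (use s in auto)
    have "circle_mean s (\<lambda>z. G z / (1 - z / p)) =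
          circle_mean s (\<lambda>z. D z * (- p) + G p * (1 / (1 - z / p)))"
    proof (rule circle_mean_cong)
      fix z :: complex assume z: "norm z = s"
      have "(1 - z / p) * (- p) = z - p" using p by (simp add: field_simps)
      hence "1 / (1 - z / p) = - p / (z - p)"
        using ne[OF z] p by (simp add: field_simps)
      thus "G z / (1 - z / p) = D z * (- p) + G p * (1 / (1 - z / p))"
        using ne[OF z] p by (simp add: D_def divide_simps) (simp add: algebra_simps)
    qed (use s in auto)
    also have "\<dots> = circle_mean s (\<lambda>z. D z * (- p)) + circle_mean s (\<lambda>z. G p * (1 / (1 - z / p)))"
      by (rule circle_mean_add) (use s c ne p in \<open>auto intro!: continuous_intros\<close>)
    finally show ?thesis by (simp only: circle_mean_mult_left circle_mean_mult_right)
  qed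
  have "circle_mean r (\<lambda>z. 1 / (1 - z / p)) = 1"
    by (rule circle_mean_inverse_inside) (use r in auto)
  moreover have "circle_mean R (\<lambda>z. 1 / (1 - z / p)) = 0"
    by (rule circle_mean_inverse_outside) (use r R in auto)
  ultimately show ?thesis using eq r R by (subst (1 2) *) auto
qed

text \<open>Since 1 / (1 - p / z) = 1 - 1 / (1 - z / p), the jump has the opposite sign. This
  version fits poles that come from a factor in 1 / z.\<close>

lemma circle_mean_pole':
  assumes G: "G holomorphic_on {z. r0 < norm z \<and> norm z < R0}"
    and r: "0 < r" "r0 < r" "r < norm p" and R: "norm p < R" "R < R0"
  shows "circle_mean R (\<lambda>z. G z / (1 - p / z)) = circle_mean r (\<lambda>z. G z / (1 - p / z)) + G p"
proof -
  have cG: "continuous_on (sphere 0 s) G" if "r0 < s" "s < R0" for s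
    by (intro holomorphic_on_imp_continuous_on holomorphic_on_subset[OF G]) (use that in auto)
  have *: "circle_mean s (\<lambda>z. G z / (1 - p / z)) = circle_mean s G - circle_mean s (\<lambda>z. G z / (1 - z / p))"
    if s: "r0 < s" "s < R0" "0 < s" "s \<noteq> norm p" for s
  proof -
    have p: "p \<noteq> 0" using r by auto
    have ne: "z \<noteq> p" "z \<noteq> 0" "1 - z / p \<noteq> 0" if "norm z = s" for z
      using that s p by auto
    have "circle_mean s (\<lambda>z. G z / (1 - p / z)) = circle_mean s (\<lambda>z. G z - G z / (1 - z / p))"
    proof (rule circle_mean_cong)
      fix z :: complex assume z: "norm z = s"
      have "1 - p / z \<noteq> 0" using ne[OF z] by auto
      thus "G z / (1 - p / z) = G z - G z / (1 - z / p)"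
        using ne[OF z] p by (simp add: divide_simps) (simp add: algebra_simps)?
    qed (use s in auto)
    also have "\<dots> = circle_mean s G - circle_mean s (\<lambda>z. G z / (1 - z / p))"
      by (rule circle_mean_diff) (use s cG ne p in \<open>auto intro!: continuous_intros\<close>)
    finally show ?thesis .
  qed
  have "circle_mean r G = circle_mean R G"
    by (rule circle_mean_annulus[OF G]) (use r R in auto)
  moreover note circle_mean_pole[OF G r R]
  ultimately show ?thesis using r R by (subst (1 2) *) auto
qed

text \<open>As y runs upwards on Re y = \<epsilon>, the point q^y = exp (- y / a) runs once
  clockwise around the circle of radius exp (- \<epsilon> / a). The sign in dy = - a dz / z is
  cancelled by the orientation.\<close>

lemma period_integral_circle_mean:
  assumes a: "a > 0"
  shows "period_integral a \<epsilon> (\<lambda>y. h (q_of a powr y)) =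
           2 * pi * \<i> * a * circle_mean (exp (- \<epsilon> / a)) h"
proof -
  define r where "r = exp (- \<epsilon> / a)"
  \<comment> \<open>The image of the segment starts at -r, half a turn away from the start of
    \<open>circlepath\<close>, and runs in the opposite direction.\<close>
  define g where "g = reversepath (shiftpath (1/2) (circlepath 0 r))"
  have r: "r > 0" by (simp add: r_def)
  have g: "g = (\<lambda>u. - of_real r * exp (- (2 * of_real pi * \<i> * of_real u)))"
  proof
    fix u :: real
    \<comment> \<open>\<open>shiftpath\<close> is defined by cases, with parameters 3/2 - u and 1/2
      - u; they differ by one full turn, so both give the same point.\<close>
    have e1: "exp (2 * complex_of_real pi * \<i> * (3 / 2 - u)) = - exp (- (2 * of_real pi * \<i> * of_real u))"
    proof -
      have "2 * complex_of_real pi * \<i> * (3 / 2 - u) =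
            - (2 * of_real pi * \<i> * of_real u) + of_real pi * \<i> + 2 * of_real pi * \<i>"
        by (simp add: field_simps)
      thus ?thesis by (simp only: exp_add exp_pi_i exp_two_pi_i) simp
    qed
    have e2: "exp (2 * complex_of_real pi * \<i> * (1 / 2 - u)) = - exp (- (2 * of_real pi * \<i> * of_real u))"
    proof -
      have "2 * complex_of_real pi * \<i> * (1 / 2 - u) =
            - (2 * of_real pi * \<i> * of_real u) + of_real pi * \<i>"
        by (simp add: field_simps)
      thus ?thesis by (simp only: exp_add exp_pi_i) simp
    qed
    show "g u = - of_real r * exp (- (2 * of_real pi * \<i> * of_real u))"
      unfolding g_def reversepath_def shiftpath_def circlepath using e1 e2
      by (simp add: field_simps)
  qed
  have vd: "vector_derivative g (at u) = - (2 * pi * \<i>) * g u" for u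
    unfolding g
    by (intro vector_derivative_at) (auto intro!: derivative_eq_intros has_vector_derivative_real_field)
  have "contour_integral g (\<lambda>z. h z / z) = integral {0..1} (\<lambda>u. - (2 * pi * \<i>) * h (g u))"
    unfolding contour_integral_integral vd
    by (intro integral_cong) (use r in \<open>simp add: g\<close>)
  moreover have "contour_integral g (\<lambda>z. h z / z) = - contour_integral (circlepath 0 r) (\<lambda>z. h z / z)"
    unfolding g_def
    by (subst contour_integral_reversepath) (auto simp: contour_integral_shiftpath valid_path_shiftpath)
  ultimately have *: "integral {0..1} (\<lambda>u. h (g u)) = circle_mean r h"
    using contour_integral_circlepath_mean[OF r, of h] by (simp add: integral_mult_right)
  have gq: "q_of a powr (linepath (of_real \<epsilon> - \<i> * pi * a) (of_real \<epsilon> + \<i> * pi * a) u) = g u" for u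
  proof -
    have "q_of a powr (linepath (of_real \<epsilon> - \<i> * pi * a) (of_real \<epsilon> + \<i> * pi * a) u) =
          exp (of_real (- 1 / a) * (of_real \<epsilon> - \<i> * pi * a + 2 * \<i> * pi * a * u))"
      unfolding q_of_def powr_def linepath_def
      by (simp add: Ln_of_real scaleR_conv_of_real algebra_simps)
    also have "of_real (- 1 / a) * (of_real \<epsilon> - \<i> * pi * a + 2 * \<i> * pi * a * u) =
                 of_real (- \<epsilon> / a) + \<i> * pi - 2 * of_real pi * \<i> * of_real u"
      using a by (simp add: field_simps)
    finally show ?thesis unfolding g r_def
      by (simp add: exp_diff exp_add exp_minus field_simps exp_of_real[symmetric])
  qed
  have "period_integral a \<epsilon> (\<lambda>y. h (q_of a powr y)) = integral {0..1} (\<lambda>u. h (g u) * (2 * pi * \<i> * a))"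
    unfolding period_integral_def contour_integral_integral gq
    by (intro integral_cong) simp
  thus ?thesis using * by (simp add: r_def)
qed

subsection \<open>The q-Pochhammer symbol\<close>

definition qpoch :: "complex \<Rightarrow> complex \<Rightarrow> complex" where
  "qpoch q z = (\<Prod>i. 1 - z * q ^ i)"

context
  fixes q :: complex
  assumes q1: "norm q < 1"
begin

lemma qpoch_convergent: "convergent_prod (\<lambda>i. 1 - z * q ^ i)"
proof -
  have "summable (\<lambda>i. norm (z * q ^ i))"
    using q1 by (simp add: norm_mult norm_power summable_mult summable_geometric)
  hence "summable (\<lambda>i. norm ((1 - z * q ^ i) - 1))" by simp
  hence "abs_convergent_prod (\<lambda>i. 1 - z * q ^ i)"
    by (simp add: abs_convergent_prod_conv_summable)
  thus ?thesis by (rule abs_convergent_prod_imp_convergent_prod)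
qed

text \<open>This isolates the only factor that can vanish when |z q| < 1. The pole factors that are
  split off later all come from here.\<close>

lemma qpoch_rec: "qpoch q z = (1 - z) * qpoch q (z * q)"
proof -
  have "(\<lambda>i. 1 - z * q ^ Suc i) has_prod qpoch q (z * q)"
    using convergent_prod_has_prod[OF qpoch_convergent[of "z * q"]]
    by (simp add: qpoch_def mult_ac)
  hence "(\<lambda>i. 1 - z * q ^ i) has_prod (qpoch q (z * q) * (1 - z * q ^ 0))"
    by (rule has_prod_Suc_imp)
  thus ?thesis
    unfolding qpoch_def by (simp add: has_prod_iff mult.commute)
qed

lemma qpoch_nonzero: "(\<And>i. z * q ^ i \<noteq> 1) \<Longrightarrow> qpoch q z \<noteq> 0"
  unfolding qpoch_def by (rule prodinf_nonzero[OF qpoch_convergent]) auto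

lemma qpoch_nonzero_inside:
  assumes "norm z < 1"
  shows "qpoch q z \<noteq> 0"
proof (rule qpoch_nonzero)
  fix i
  have "norm (z * q ^ i) \<le> norm z * 1"
    unfolding norm_mult norm_power using q1 by (intro mult_left_mono power_le_one) auto
  thus "z * q ^ i \<noteq> 1" using assms by auto
qed

lemma qpoch_nonzero_outside:
  assumes "z \<noteq> 1" "norm (z * q) < 1"
  shows "qpoch q z \<noteq> 0"
  using qpoch_rec[of z] qpoch_nonzero_inside[OF assms(2)] assms(1) by simp

text \<open>On a disc of radius R the terms z q^n are dominated by the geometric series R |q|^n, so
  the partial products converge uniformly there.\<close>

lemma qpoch_holomorphic_UNIV: "qpoch q holomorphic_on UNIV"
proof -
  let ?P = "\<lambda>n z. \<Prod>i<n. 1 - z * q ^ i"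
  have unif: "uniform_limit (cball 0 R) ?P (qpoch q) sequentially" for R
  proof -
    have "uniformly_convergent_on (cball 0 R) (\<lambda>N z. \<Prod>i<N. 1 + - (z * q ^ i))"
    proof (rule Infinite_Products.uniformly_convergent_on_prod)
      show "uniformly_convergent_on (cball 0 R) (\<lambda>N z. \<Sum>n<N. norm (- (z * q ^ n)))"
      proof (rule Weierstrass_m_test'_ev)
        show "\<forall>\<^sub>F n in sequentially. \<forall>z\<in>cball 0 R. norm (norm (- (z * q ^ n))) \<le> R * norm q ^ n"
          by (intro always_eventually allI ballI)
             (auto simp: norm_mult norm_power intro!: mult_right_mono)
        show "summable (\<lambda>n. R * norm q ^ n)"
          using q1 by (intro summable_mult summable_geometric) auto
      qed
    qed (auto intro!: continuous_intros)
    hence "uniformly_convergent_on (cball 0 R) ?P" by simp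
    then obtain L where L: "uniform_limit (cball 0 R) ?P L sequentially"
      by (auto simp: uniformly_convergent_on_def)
    have "L z = qpoch q z" if "z \<in> cball 0 R" for z
    proof -
      have "(\<lambda>n. \<Prod>i<n. 1 - z * q ^ i) \<longlonglongrightarrow> L z"
        using tendsto_uniform_limitI[OF L that] .
      moreover have "(\<lambda>n. \<Prod>i<n. 1 - z * q ^ i) \<longlonglongrightarrow> qpoch q z"
        unfolding qpoch_def using has_prod_imp_tendsto'[OF convergent_prod_has_prod[OF qpoch_convergent]] .
      ultimately show ?thesis by (rule LIMSEQ_unique)
    qed
    thus ?thesis using L uniform_limit_cong'[of "cball 0 R" ?P ?P L "qpoch q"] by blast
  qed
  have "qpoch q holomorphic_on ball 0 R" for R
    by (rule holomorphic_uniform_limit[OF _ unif, THEN conjunct2])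
       (auto intro!: always_eventually continuous_intros holomorphic_intros)
  hence "qpoch q analytic_on {z}" for z
  proof -
    have "qpoch q analytic_on ball 0 (norm z + 1)"
      using \<open>\<And>R. qpoch q holomorphic_on ball 0 R\<close> by (subst analytic_on_open) auto
    thus ?thesis by (rule analytic_on_subset) auto
  qed
  thus ?thesis
    by (intro analytic_imp_holomorphic) (simp add: analytic_on_analytic_at[of _ UNIV])
qed

lemma qpoch_holomorphic [holomorphic_intros]:
  "f holomorphic_on S \<Longrightarrow> (\<lambda>x. qpoch q (f x)) holomorphic_on S"
  using holomorphic_on_compose_gen[OF _ qpoch_holomorphic_UNIV, of f S] by (simp add: o_def)

lemma qpoch_continuous [continuous_intros]:
  "continuous_on S f \<Longrightarrow> continuous_on S (\<lambda>x. qpoch q (f x))"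
  using continuous_on_compose2[OF holomorphic_on_imp_continuous_on[OF qpoch_holomorphic_UNIV]]
  by blast

end

section \<open>The infinite products of the statement as quotients of q-Pochhammer symbols\<close>

definition mu_qpoch :: "complex \<Rightarrow> complex \<Rightarrow> complex \<Rightarrow> complex" where
  "mu_qpoch q t Z = (qpoch q Z * qpoch q (q / Z)) / (qpoch q (t * Z) * qpoch q (t * q / Z))"

lemma mu_qpoch_continuous:
  assumes "norm q < 1" "continuous_on S t" "continuous_on S Z"
    and "\<And>x. x \<in> S \<Longrightarrow> Z x \<noteq> 0 \<and> qpoch q (t x * Z x) \<noteq> 0 \<and> qpoch q (t x * q / Z x) \<noteq> 0"
  shows "continuous_on S (\<lambda>x. mu_qpoch q (t x) (Z x))"
  unfolding mu_qpoch_def using assms by (intro continuous_intros) auto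

lemma mu_qpoch_holomorphic:
  assumes "norm q < 1" "t holomorphic_on S" "Z holomorphic_on S"
    and "\<And>x. x \<in> S \<Longrightarrow> Z x \<noteq> 0 \<and> qpoch q (t x * Z x) \<noteq> 0 \<and> qpoch q (t x * q / Z x) \<noteq> 0"
  shows "(\<lambda>x. mu_qpoch q (t x) (Z x)) holomorphic_on S"
  unfolding mu_qpoch_def using assms by (intro holomorphic_intros) auto

lemma mu_factor_eq:
  assumes "norm q < 1"
  shows "mu_factor q t Z = mu_qpoch q t Z"
proof -
  have "mu_factor q t Z = (\<Prod>i. ((1 - Z * q ^ i) * (1 - (q / Z) * q ^ i)) /
                           ((1 - (t * Z) * q ^ i) * (1 - (t * q / Z) * q ^ i)))"
    unfolding mu_factor_def by (intro prodinf_cong) (simp add: divide_inverse mult_ac)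
  also have "\<dots> = mu_qpoch q t Z"
    unfolding mu_qpoch_def qpoch_def
    by (simp only: prodinf_mult prodinf_divide convergent_prod_mult qpoch_convergent[OF assms])
  finally show ?thesis .
qed

definition rho0_qpoch :: "complex \<Rightarrow> complex \<Rightarrow> complex" where
  "rho0_qpoch q t = qpoch q (1 / t) * qpoch q (t * q) / (qpoch q q * qpoch q (t\<^sup>2 * q))"

definition rho_qpoch :: "complex \<Rightarrow> complex \<Rightarrow> complex" where
  "rho_qpoch q t = qpoch q (1 / t) * (qpoch q (t * q))\<^sup>2 * qpoch q (1 / t\<^sup>2) /
                ((qpoch q q)\<^sup>2 * qpoch q (t\<^sup>2 * q) * qpoch q (t ^ 3 * q))"

text \<open>The prefactor rho0 is left out, here and in \<open>zeta2_qpoch\<close>: it does not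
  depend on Z and comes out of the mean, and its poles in t have to be treated apart from those of
  the integrand.\<close>

definition zeta1_qpoch :: "complex \<Rightarrow> complex \<Rightarrow> complex \<Rightarrow> complex" where
  "zeta1_qpoch q t Z = (qpoch q (q / Z) * qpoch q (Z / t)) / (qpoch q (t * Z) * qpoch q (t\<^sup>2 * q / Z))"

definition zeta2_qpoch :: "complex \<Rightarrow> complex \<Rightarrow> complex \<Rightarrow> complex" where
  "zeta2_qpoch q t Z = (qpoch q (Z * q) * qpoch q (q / (t * Z))) / (qpoch q (t * q / Z) * qpoch q (t\<^sup>2 * Z * q))"

lemma rho0_eq:
  assumes "norm q < 1"
  shows "rho0 q t = rho0_qpoch q t"
proof -
  have "rho0 q t = (\<Prod>i. ((1 - (1 / t) * q ^ i) * (1 - (t * q) * q ^ i)) /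
                           ((1 - q * q ^ i) * (1 - (t\<^sup>2 * q) * q ^ i)))"
    unfolding rho0_def by (intro prodinf_cong) (simp add: divide_inverse mult_ac)
  also have "\<dots> = rho0_qpoch q t"
    unfolding rho0_qpoch_def qpoch_def
    by (simp only: prodinf_mult prodinf_divide convergent_prod_mult qpoch_convergent[OF assms])
  finally show ?thesis .
qed

lemma rho_eq:
  assumes "norm q < 1"
  shows "rho q t = rho_qpoch q t"
proof -
  have "rho q t = (\<Prod>i. ((1 - (1 / t) * q ^ i) * (1 - (t * q) * q ^ i)\<^sup>2 * (1 - (1 / t\<^sup>2) * q ^ i)) /
                           ((1 - q * q ^ i)\<^sup>2 * (1 - (t\<^sup>2 * q) * q ^ i) * (1 - (t ^ 3 * q) * q ^ i)))"
    unfolding rho_def by (intro prodinf_cong) (simp add: divide_inverse mult_ac)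
  also have "\<dots> = rho_qpoch q t"
    unfolding rho_qpoch_def qpoch_def
    by (simp only: prodinf_mult prodinf_divide prodinf_power[symmetric] convergent_prod_power
          convergent_prod_mult qpoch_convergent[OF assms])
  finally show ?thesis .
qed

lemma zeta1_eq:
  assumes "norm q < 1"
  shows "zeta1 q t Z = rho0_qpoch q t * zeta1_qpoch q t Z"
proof -
  have "(\<Prod>j. ((1 - inverse Z * q ^ (j + 1)) * (1 - inverse t * Z * q ^ j)) /
          ((1 - t * Z * q ^ j) * (1 - t\<^sup>2 * inverse Z * q ^ (j + 1)))) =
        (\<Prod>j. ((1 - (q / Z) * q ^ j) * (1 - (Z / t) * q ^ j)) /
          ((1 - (t * Z) * q ^ j) * (1 - (t\<^sup>2 * q / Z) * q ^ j)))"
    by (intro prodinf_cong) (simp add: divide_inverse mult_ac)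
  also have "\<dots> = zeta1_qpoch q t Z"
    unfolding zeta1_qpoch_def qpoch_def
    by (simp only: prodinf_mult prodinf_divide convergent_prod_mult qpoch_convergent[OF assms])
  finally show ?thesis by (simp add: zeta1_def rho0_eq[OF assms])
qed

lemma zeta2_eq:
  assumes "norm q < 1"
  shows "zeta2 q t Z = rho0_qpoch q t / t * zeta2_qpoch q t Z"
proof -
  have "(\<Prod>j. ((1 - Z * q ^ (j + 1)) * (1 - inverse t * inverse Z * q ^ (j + 1))) /
          ((1 - t * inverse Z * q ^ (j + 1)) * (1 - t\<^sup>2 * Z * q ^ (j + 1)))) =
        (\<Prod>j. ((1 - (Z * q) * q ^ j) * (1 - (q / (t * Z)) * q ^ j)) /
          ((1 - (t * q / Z) * q ^ j) * (1 - (t\<^sup>2 * Z * q) * q ^ j)))"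
    by (intro prodinf_cong) (simp add: divide_inverse mult_ac)
  also have "\<dots> = zeta2_qpoch q t Z"
    unfolding zeta2_qpoch_def qpoch_def
    by (simp only: prodinf_mult prodinf_divide convergent_prod_mult qpoch_convergent[OF assms])
  finally show ?thesis by (simp add: zeta2_def rho0_eq[OF assms] field_simps)
qed

subsection \<open>The constant term as a mean over the torus\<close>

definition torus_mean :: "real \<Rightarrow> real \<Rightarrow> (complex \<Rightarrow> complex \<Rightarrow> complex) \<Rightarrow> complex" where
  "torus_mean r s h = circle_mean r (\<lambda>X. circle_mean s (h X))"

lemma torus_mean_cong:
  assumes "r \<ge> 0" "s \<ge> 0" "\<And>X Y. norm X = r \<Longrightarrow> norm Y = s \<Longrightarrow> f X Y = g X Y"
  shows "torus_mean r s f = torus_mean r s g"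
  unfolding torus_mean_def using assms by (intro circle_mean_cong) auto

lemma continuous_on_torus_slice:
  assumes "continuous_on (A \<times> B) (\<lambda>(X, Y). h X Y)" "X \<in> A"
  shows "continuous_on B (h X)"
proof -
  have "continuous_on B (\<lambda>Y. (\<lambda>(X, Y). h X Y) (X, Y))"
    by (rule continuous_on_compose2[OF assms(1)]) (use assms(2) in \<open>auto intro!: continuous_intros\<close>)
  thus ?thesis by simp
qed

lemma torus_mean_diff:
  assumes rs: "r \<ge> 0" "s \<ge> 0"
    and f: "continuous_on (sphere 0 r \<times> sphere 0 s) (\<lambda>(X, Y). f X Y)"
    and g: "continuous_on (sphere 0 r \<times> sphere 0 s) (\<lambda>(X, Y). g X Y)"
  shows "torus_mean r s (\<lambda>X Y. f X Y - g X Y) = torus_mean r s f - torus_mean r s g"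
proof -
  have "torus_mean r s (\<lambda>X Y. f X Y - g X Y) =
        circle_mean r (\<lambda>X. circle_mean s (f X) - circle_mean s (g X))"
    unfolding torus_mean_def
    by (intro circle_mean_cong circle_mean_diff rs continuous_on_torus_slice[OF f]
          continuous_on_torus_slice[OF g]) auto
  also have "\<dots> = torus_mean r s f - torus_mean r s g"
    unfolding torus_mean_def
    by (intro circle_mean_diff rs continuous_on_circle_mean f g)
  finally show ?thesis .
qed

lemma torus_mean_sum:
  assumes rs: "r \<ge> 0" "s \<ge> 0" and A: "finite A"
    and f: "\<And>i. i \<in> A \<Longrightarrow> continuous_on (sphere 0 r \<times> sphere 0 s) (\<lambda>(X, Y). f i X Y)"
  shows "torus_mean r s (\<lambda>X Y. \<Sum>i\<in>A. f i X Y) = (\<Sum>i\<in>A. torus_mean r s (f i))"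
proof -
  have "torus_mean r s (\<lambda>X Y. \<Sum>i\<in>A. f i X Y) = circle_mean r (\<lambda>X. \<Sum>i\<in>A. circle_mean s (f i X))"
    unfolding torus_mean_def
    by (intro circle_mean_cong circle_mean_sum rs A continuous_on_torus_slice[OF f]) auto
  also have "\<dots> = (\<Sum>i\<in>A. torus_mean r s (f i))"
    unfolding torus_mean_def
    by (intro circle_mean_sum rs A continuous_on_circle_mean f)
  finally show ?thesis .
qed

lemma torus_mean_cmult: "torus_mean r s (\<lambda>X Y. c * f X Y) = c * torus_mean r s f"
  unfolding torus_mean_def by (simp only: circle_mean_mult_right)

lemma torus_mean_norm_le:
  assumes rs: "r \<ge> 0" "s \<ge> 0"
    and f: "continuous_on (sphere 0 r \<times> sphere 0 s) (\<lambda>(X, Y). f X Y)"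
    and B: "\<And>X Y. norm X = r \<Longrightarrow> norm Y = s \<Longrightarrow> norm (f X Y) \<le> B"
  shows "norm (torus_mean r s f) \<le> B"
  unfolding torus_mean_def
  by (intro circle_mean_norm_le rs continuous_on_circle_mean f continuous_on_torus_slice[OF f] B) auto

text \<open>Passing from radius 1 to radius 2 leaves the mean unchanged by holomorphy but multiplies
  it by 2^m by homogeneity.\<close>

lemma circle_mean_power_int: "circle_mean 1 (\<lambda>z. z powi m) = (if m = 0 then 1 else 0)"
proof (cases "m = 0")
  case False
  have "circle_mean 1 (\<lambda>z. z powi m) = circle_mean 2 (\<lambda>z. z powi m)"
    by (rule circle_mean_annulus[of _ 0 3]) (auto intro!: holomorphic_intros)
  also have "\<dots> = 2 powi m * circle_mean 1 (\<lambda>z. z powi m)"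
    unfolding circle_mean_def
    by (subst integral_mult_right[symmetric]) (simp add: circlepath power_int_mult_distrib)
  finally have eq: "circle_mean 1 (\<lambda>z. z powi m) = 2 powi m * circle_mean 1 (\<lambda>z. z powi m)" .
  have "(2::real) powi m \<noteq> 1"
  proof
    assume "(2::real) powi m = 1"
    hence "(2::real) powr (of_int m) = 1" by (simp add: powr_real_of_int')
    thus False using False by simp
  qed
  hence "(2::complex) powi m \<noteq> 1"
    by (metis norm_one norm_numeral norm_power_int)
  thus ?thesis using eq False by auto
qed auto

lemma torus_mean_monomial:
  "torus_mean 1 1 (\<lambda>X Y. X powi m * Y powi n) = (if m = 0 \<and> n = 0 then 1 else 0)"
  unfolding torus_mean_def
  by (simp add: circle_mean_mult_right circle_mean_mult_left circle_mean_power_int)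

subsection \<open>Multiplying out an infinite product\<close>

text \<open>Multiplying out a product of series with constant term 1 means choosing one term from
  each factor, and the term 1 from almost all of them; these functions record the choices.\<close>

definition finite_exponents :: "'i set \<Rightarrow> ('i \<Rightarrow> nat) set" where
  "finite_exponents I = {\<nu>. finite {i. \<nu> i \<noteq> 0} \<and> {i. \<nu> i \<noteq> 0} \<subseteq> I}"

text \<open>A finite partial sum involves finitely many indices and bounded exponents, so it is part
  of an expanded finite product, which is at most the product of the 1 + b i and hence at most exp
  C.\<close>

lemma finite_exponents_abs_summable:
  fixes g :: "'i \<Rightarrow> nat \<Rightarrow> 'c :: real_normed_field"
  assumes g0: "\<And>i. g i 0 = 1"
    and g: "\<And>i K. i \<in> I \<Longrightarrow> (\<Sum>k\<in>{1..K}. norm (g i k)) \<le> b i"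
    and b: "\<And>F. finite F \<Longrightarrow> F \<subseteq> I \<Longrightarrow> sum b F \<le> C"
  shows "(\<lambda>\<nu>. norm (\<Prod>i | \<nu> i \<noteq> 0. g i (\<nu> i))) summable_on finite_exponents I"
proof (rule nonneg_bdd_above_summable_on)
  show "bdd_above (sum (\<lambda>\<nu>. norm (\<Prod>i | \<nu> i \<noteq> 0. g i (\<nu> i))) `
          {F. F \<subseteq> finite_exponents I \<and> finite F})"
  proof (rule bdd_aboveI2)
    fix F assume "F \<in> {F. F \<subseteq> finite_exponents I \<and> finite F}"
    hence F: "F \<subseteq> finite_exponents I" "finite F" by auto
    define A where "A = (\<Union>\<nu>\<in>F. {i. \<nu> i \<noteq> 0})"
    define K where "K = Max (insert 0 (\<Union>\<nu>\<in>F. \<nu> ` A))"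
    have A: "finite A" "A \<subseteq> I" using F unfolding A_def finite_exponents_def by auto
    have K: "\<nu> i \<le> K" if "\<nu> \<in> F" "i \<in> A" for \<nu> i
      unfolding K_def using that F A by (intro Max_ge) auto
    \<comment> \<open>All \<nu> in F vanish off A, so they are determined by their
      restrictions.\<close>
    have inj: "inj_on (\<lambda>\<nu>. restrict \<nu> A) F"
    proof
      fix \<nu> \<nu>' assume \<nu>: "\<nu> \<in> F" "\<nu>' \<in> F" "restrict \<nu> A = restrict \<nu>' A"
      show "\<nu> = \<nu>'"
      proof
        fix i
        have "\<nu> i = 0 \<and> \<nu>' i = 0" if "i \<notin> A" using that \<nu>(1,2) by (auto simp: A_def)
        thus "\<nu> i = \<nu>' i" using \<nu>(3) by (cases "i \<in> A") (metis restrict_apply, simp)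
      qed
    qed
    have "(\<Sum>\<nu>\<in>F. norm (\<Prod>i | \<nu> i \<noteq> 0. g i (\<nu> i))) = (\<Sum>\<nu>\<in>F. \<Prod>i\<in>A. norm (g i (restrict \<nu> A i)))"
    proof (rule sum.cong)
      fix \<nu> assume "\<nu> \<in> F"
      have "(\<Prod>i | \<nu> i \<noteq> 0. g i (\<nu> i)) = (\<Prod>i\<in>A. g i (\<nu> i))"
        using A \<open>\<nu> \<in> F\<close> by (intro prod.mono_neutral_left) (auto simp: A_def g0)
      also have "\<dots> = (\<Prod>i\<in>A. g i (restrict \<nu> A i))" by (intro prod.cong) auto
      finally show "norm (\<Prod>i | \<nu> i \<noteq> 0. g i (\<nu> i)) = (\<Prod>i\<in>A. norm (g i (restrict \<nu> A i)))"
        by (simp only: prod_norm)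
    qed auto
    also have "\<dots> = (\<Sum>p\<in>(\<lambda>\<nu>. restrict \<nu> A) ` F. \<Prod>i\<in>A. norm (g i (p i)))"
      by (simp add: sum.reindex[OF inj])
    also have "\<dots> \<le> (\<Sum>p\<in>PiE A (\<lambda>_. {..K}). \<Prod>i\<in>A. norm (g i (p i)))"
      using A K by (intro sum_mono2 finite_PiE) (auto intro!: prod_nonneg)
    also have "\<dots> = (\<Prod>i\<in>A. \<Sum>k\<le>K. norm (g i k))"
      by (rule prod_sum_PiE[symmetric]) (use A in auto)
    also have "\<dots> \<le> (\<Prod>i\<in>A. 1 + b i)"
    proof (rule prod_mono, intro conjI)
      fix i assume i: "i \<in> A"
      have "{..K} = insert 0 {1..K}" by auto
      hence "(\<Sum>k\<le>K. norm (g i k)) = 1 + (\<Sum>k\<in>{1..K}. norm (g i k))" by (simp add: g0)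
      thus "(\<Sum>k\<le>K. norm (g i k)) \<le> 1 + b i" using g[of i K] i A by auto
    qed (auto intro!: sum_nonneg)
    also have "\<dots> \<le> exp (sum b A)"
    proof (rule prod_le_exp_sum)
      fix i assume "i \<in> A"
      \<comment> \<open>The empty sum, K = 0, of the hypothesis shows that b i is
        nonnegative.\<close>
      hence "(\<Sum>k\<in>{1..0}. norm (g i k)) \<le> b i" using A by (intro g) auto
      thus "0 \<le> b i" by simp
    qed
    also have "\<dots> \<le> exp C" using b[OF A] by simp
    finally show "(\<Sum>\<nu>\<in>F. norm (\<Prod>i | \<nu> i \<noteq> 0. g i (\<nu> i))) \<le> exp C" .
  qed
qed auto

text \<open>A finite F carries the absolute sum up to e / 2. As soon as A n contains F, the error is
  bounded by the absolute sum over N - F.\<close>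

lemma infsum_exhaust:
  fixes T :: "'a \<Rightarrow> 'b :: banach"
  assumes T: "(\<lambda>x. norm (T x)) summable_on N"
    and A: "\<And>n. A n \<subseteq> N" "\<And>F. finite F \<Longrightarrow> F \<subseteq> N \<Longrightarrow> \<forall>\<^sub>F n in sequentially. F \<subseteq> A n"
  shows "(\<lambda>n. infsum T (A n)) \<longlonglongrightarrow> infsum T N"
proof (rule tendstoI)
  fix e :: real assume e: "e > 0"
  have sT: "T summable_on N" using T by (rule abs_summable_summable)
  obtain F where F: "finite F" "F \<subseteq> N" "dist (sum (\<lambda>x. norm (T x)) F) (infsum (\<lambda>x. norm (T x)) N) \<le> e / 2"
    using infsum_finite_approximation[OF T, of "e / 2"] e by auto
  show "\<forall>\<^sub>F n in sequentially. dist (infsum T (A n)) (infsum T N) < e"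
    using A(2)[OF F(1,2)]
  proof eventually_elim
    case (elim n)
    have sub: "T summable_on B" "(\<lambda>x. norm (T x)) summable_on B" if "B \<subseteq> N" for B
      using that sT T by (auto intro: summable_on_subset_banach)
    have "infsum T N = infsum T (A n) + infsum T (N - A n)"
      using infsum_Un_disjoint[OF sub(1)[OF A(1)[of n]] sub(1)[of "N - A n"]] A(1)[of n]
      by (simp add: Un_absorb1)
    hence "dist (infsum T (A n)) (infsum T N) = norm (infsum T (N - A n))"
      by (simp add: dist_norm norm_minus_commute)
    also have "\<dots> \<le> infsum (\<lambda>x. norm (T x)) (N - A n)"
      by (rule norm_infsum_bound) (use sub in auto)
    also have "\<dots> \<le> infsum (\<lambda>x. norm (T x)) (N - F)"
      by (rule infsum_mono2) (use sub elim in auto)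
    also have "\<dots> = infsum (\<lambda>x. norm (T x)) N - sum (\<lambda>x. norm (T x)) F"
      using infsum_Un_disjoint[OF sub(2)[OF F(2)] sub(2)[of "N - F"]] F
      by (simp add: Un_absorb1)
    also have "\<dots> < e" using F(3) e unfolding dist_real_def by linarith
    finally show ?case .
  qed
qed

text \<open>The distributive law for finitely many absolutely convergent series. Its index functions
  are \<open>undefined\<close> off A whereas exponent functions are 0 there; restriction to A and
  extension by 0 translate between them.\<close>

lemma infsum_finite_exponents_finite:
  fixes g :: "'i \<Rightarrow> nat \<Rightarrow> 'c :: {banach, real_normed_field}"
  assumes A: "finite A" and g0: "\<And>i. g i 0 = 1" and g: "\<And>i. i \<in> A \<Longrightarrow> g i abs_summable_on UNIV"
  shows "(\<Sum>\<^sub>\<infinity>\<nu>\<in>finite_exponents A. \<Prod>i | \<nu> i \<noteq> 0. g i (\<nu> i)) = (\<Prod>i\<in>A. \<Sum>\<^sub>\<infinity>k. g i k)"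
proof -
  have "(\<Prod>i\<in>A. \<Sum>\<^sub>\<infinity>k. g i k) = (\<Sum>\<^sub>\<infinity>p\<in>PiE A (\<lambda>_. UNIV). \<Prod>i\<in>A. g i (p i))"
    by (rule infsum_prod_PiE_abs[symmetric]) (use A g in auto)
  also have "\<dots> = (\<Sum>\<^sub>\<infinity>\<nu>\<in>finite_exponents A. \<Prod>i | \<nu> i \<noteq> 0. g i (\<nu> i))"
  proof (rule infsum_reindex_bij_witness[of _ "\<lambda>\<nu>. restrict \<nu> A" "\<lambda>p i. if i \<in> A then p i else 0"])
    fix p assume p: "p \<in> PiE A (\<lambda>_. UNIV :: nat set)"
    show "restrict (\<lambda>i. if i \<in> A then p i else 0) A = p"
      using p by (auto simp: fun_eq_iff PiE_def extensional_def restrict_def)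
    have "{i. (if i \<in> A then p i else 0) \<noteq> 0} \<subseteq> A" by auto
    thus "(\<lambda>i. if i \<in> A then p i else 0) \<in> finite_exponents A"
      using A finite_subset unfolding finite_exponents_def by blast
    show "(\<Prod>i | (if i \<in> A then p i else 0) \<noteq> 0. g i (if i \<in> A then p i else 0)) = (\<Prod>i\<in>A. g i (p i))"
      using A by (intro prod.mono_neutral_cong_left) (auto simp: g0 intro!: gr0I)
  next
    fix \<nu> assume "\<nu> \<in> finite_exponents A"
    thus "(\<lambda>i. if i \<in> A then restrict \<nu> A i else 0) = \<nu>"
      by (auto simp: fun_eq_iff finite_exponents_def)
  qed auto
  finally show ?thesis ..
qed

text \<open>The infinite product enters only as a limit along one chosen exhaustion of I by finite
  sets. Absolute summability makes the expanded sum independent of that choice.\<close>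

lemma infsum_finite_exponents:
  fixes g :: "'i \<Rightarrow> nat \<Rightarrow> 'c :: {banach, real_normed_field}"
  assumes g0: "\<And>i. g i 0 = 1"
    and g: "\<And>i K. i \<in> I \<Longrightarrow> (\<Sum>k\<in>{1..K}. norm (g i k)) \<le> b i"
    and b: "\<And>F. finite F \<Longrightarrow> F \<subseteq> I \<Longrightarrow> sum b F \<le> C"
    and A: "\<And>n. finite (A n)" "\<And>n. A n \<subseteq> I"
      "\<And>F. finite F \<Longrightarrow> F \<subseteq> I \<Longrightarrow> \<forall>\<^sub>F n in sequentially. F \<subseteq> A n"
    and lim: "(\<lambda>n. \<Prod>i\<in>A n. \<Sum>\<^sub>\<infinity>k. g i k) \<longlonglongrightarrow> L"
  shows "(\<Sum>\<^sub>\<infinity>\<nu>\<in>finite_exponents I. \<Prod>i | \<nu> i \<noteq> 0. g i (\<nu> i)) = L"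
proof -
  let ?T = "\<lambda>\<nu>. \<Prod>i | \<nu> i \<noteq> 0. g i (\<nu> i)"
  have "(\<lambda>n. infsum ?T (finite_exponents (A n))) \<longlonglongrightarrow> infsum ?T (finite_exponents I)"
  proof (rule infsum_exhaust)
    show "(\<lambda>\<nu>. norm (?T \<nu>)) summable_on finite_exponents I"
      by (rule finite_exponents_abs_summable[OF g0 g b])
    show "finite_exponents (A n) \<subseteq> finite_exponents I" for n
      using A(2)[of n] by (auto simp: finite_exponents_def)
    fix F assume F: "finite F" "F \<subseteq> finite_exponents I"
    have "\<forall>\<^sub>F n in sequentially. (\<Union>\<nu>\<in>F. {i. \<nu> i \<noteq> 0}) \<subseteq> A n"
      by (rule A(3)) (use F in \<open>auto simp: finite_exponents_def\<close>)
    thus "\<forall>\<^sub>F n in sequentially. F \<subseteq> finite_exponents (A n)"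
      by eventually_elim (use F in \<open>auto simp: finite_exponents_def\<close>)
  qed
  moreover have "g i abs_summable_on UNIV" if i: "i \<in> I" for i
  proof (rule nonneg_bdd_above_summable_on)
    show "bdd_above (sum (\<lambda>k. norm (g i k)) ` {F. F \<subseteq> UNIV \<and> finite F})"
    proof (rule bdd_aboveI2)
      fix F :: "nat set" assume "F \<in> {F. F \<subseteq> UNIV \<and> finite F}"
      then obtain K where "F \<subseteq> {..K}" using finite_nat_set_iff_bounded_le by auto
      hence "(\<Sum>k\<in>F. norm (g i k)) \<le> (\<Sum>k\<le>K. norm (g i k))" by (intro sum_mono2) auto
      also have "{..K} = insert 0 {1..K}" by auto
      hence "(\<Sum>k\<le>K. norm (g i k)) = 1 + (\<Sum>k\<in>{1..K}. norm (g i k))" by (simp add: g0)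
      finally show "(\<Sum>k\<in>F. norm (g i k)) \<le> 1 + b i" using g[OF i, of K] by linarith
    qed
  qed auto
  hence "infsum ?T (finite_exponents (A n)) = (\<Prod>i\<in>A n. \<Sum>\<^sub>\<infinity>k. g i k)" for n
    by (intro infsum_finite_exponents_finite) (use A g0 in auto)
  ultimately show ?thesis using lim LIMSEQ_unique by simp
qed

subsection \<open>Fourier coefficients of \<open>\<mu>\<close>\<close>

definition mu_term_coeff :: "complex \<Rightarrow> complex \<Rightarrow> ((int \<times> int) \<times> nat \<Rightarrow> nat) \<Rightarrow> complex" where
  "mu_term_coeff q t \<nu> = (\<Prod>\<alpha> | \<nu> \<alpha> \<noteq> 0. factor_coeff t (\<nu> \<alpha>) * (q ^ snd \<alpha>) ^ \<nu> \<alpha>)"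

definition mu_degree1 :: "((int \<times> int) \<times> nat \<Rightarrow> nat) \<Rightarrow> int" where
  "mu_degree1 \<nu> = (\<Sum>\<alpha> | \<nu> \<alpha> \<noteq> 0. int (\<nu> \<alpha>) * fst (fst \<alpha>))"

definition mu_degree2 :: "((int \<times> int) \<times> nat \<Rightarrow> nat) \<Rightarrow> int" where
  "mu_degree2 \<nu> = (\<Sum>\<alpha> | \<nu> \<alpha> \<noteq> 0. int (\<nu> \<alpha>) * snd (fst \<alpha>))"

lemma mu_terms_eq:
  "mu_terms m n = {\<nu> \<in> finite_exponents positive_affine_roots. mu_degree1 \<nu> = m \<and> mu_degree2 \<nu> = n}"
  by (auto simp: mu_terms_def finite_exponents_def mu_degree1_def mu_degree2_def)

lemma norm_factor_coeff:
  "k \<ge> 1 \<Longrightarrow> norm (factor_coeff t k) = norm (t - 1) * norm t ^ (k - 1)"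
proof -
  assume "k \<ge> 1"
  hence "factor_coeff t k = (t - 1) * t ^ (k - 1)"
    by (cases k) (auto simp: factor_coeff_def algebra_simps)
  thus ?thesis by (simp add: norm_mult norm_power)
qed

text \<open>Of |u|^k only one power of B is kept, and the geometric decay in k comes from t. The
  bound is thus linear in B, and for B = |q|^j it can be summed over the affine roots.\<close>

lemma sum_norm_factor_coeff_le:
  assumes t: "norm t < 1" and u: "norm u \<le> B" "B \<le> 1"
  shows "(\<Sum>k\<in>{1..K}. norm (factor_coeff t k * u ^ k)) \<le> norm (t - 1) / (1 - norm t) * B"
proof -
  have B: "B \<ge> 0" using u norm_ge_zero[of u] by linarith
  have "(\<Sum>k\<in>{1..K}. norm (factor_coeff t k * u ^ k)) \<le> (\<Sum>k\<in>{1..K}. norm (t - 1) * B * norm t ^ (k - 1))"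
  proof (rule sum_mono)
    fix k assume k: "k \<in> {1..K}"
    have "norm u ^ k \<le> B ^ k" using u by (intro power_mono) auto
    also have "B ^ k \<le> B ^ 1" using B u k by (intro power_decreasing) auto
    finally have "norm u ^ k \<le> B" by simp
    hence "norm (t - 1) * norm t ^ (k - 1) * norm u ^ k \<le> norm (t - 1) * norm t ^ (k - 1) * B"
      by (intro mult_left_mono) auto
    thus "norm (factor_coeff t k * u ^ k) \<le> norm (t - 1) * B * norm t ^ (k - 1)"
      using k by (simp add: norm_mult norm_power norm_factor_coeff mult_ac)
  qed
  also have "\<dots> = norm (t - 1) * B * (\<Sum>k<K. norm t ^ k)"
    by (simp add: sum_distrib_left sum.atLeast1_atMost_eq)
  also have "\<dots> \<le> norm (t - 1) * B * (\<Sum>k. norm t ^ k)"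
    using t B by (intro mult_left_mono sum_le_suminf summable_geometric) auto
  also have "(\<Sum>k. norm t ^ k) = 1 / (1 - norm t)" using t by (intro suminf_geometric) auto
  finally show ?thesis by simp
qed

lemma infsum_factor_coeff:
  assumes t: "norm t < 1" and u: "norm u \<le> 1"
  shows "(\<Sum>\<^sub>\<infinity>k. factor_coeff t k * u ^ k) = (1 - u) / (1 - t * u)"
proof -
  have tu: "norm (t * u) < 1"
    using t u mult_mono[of "norm t" "norm t" "norm u" 1] by (simp add: norm_mult)
  have 1: "(\<lambda>k. (t - 1) * u * (t * u) ^ k) sums ((t - 1) * u * (1 / (1 - t * u)))"
    using geometric_sums[OF tu] by (rule sums_mult)
  hence "(\<lambda>k. factor_coeff t (Suc k) * u ^ Suc k) sums ((t - 1) * u * (1 / (1 - t * u)))"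
    by (rule sums_cong[THEN iffD1, rotated]) (simp add: factor_coeff_def algebra_simps power_mult_distrib)
  hence "(\<lambda>k. factor_coeff t k * u ^ k) sums ((t - 1) * u * (1 / (1 - t * u)) + factor_coeff t 0 * u ^ 0)"
    by (rule sums_Suc)
  also have "(t - 1) * u * (1 / (1 - t * u)) + factor_coeff t 0 * u ^ 0 = (1 - u) / (1 - t * u)"
    using tu by (auto simp: factor_coeff_def divide_simps algebra_simps)
  finally have sums: "(\<lambda>k. factor_coeff t k * u ^ k) sums ((1 - u) / (1 - t * u))" .
  have "summable (\<lambda>k. norm (factor_coeff t k * u ^ k))"
  proof (rule summable_Suc_iff[THEN iffD1], rule summable_comparison_test')
    show "summable (\<lambda>k. norm (t - 1) * norm u * norm (t * u) ^ k)"
      using tu by (intro summable_mult summable_geometric) auto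
    show "norm (norm (factor_coeff t (Suc k) * u ^ Suc k)) \<le> norm (t - 1) * norm u * norm (t * u) ^ k"
      for k by (simp add: norm_mult norm_power norm_factor_coeff power_mult_distrib mult_ac)
  qed
  hence "((\<lambda>k. factor_coeff t k * u ^ k) has_sum ((1 - u) / (1 - t * u))) UNIV"
    using sums by (intro norm_summable_imp_has_sum) auto
  thus ?thesis by (rule infsumI)
qed

text \<open>There are six directions, the roots of A_2, and each contributes at most a geometric
  series.\<close>

lemma sum_positive_affine_roots_le:
  assumes "0 \<le> Q" "Q < (1::real)" "finite F" "F \<subseteq> positive_affine_roots"
  shows "(\<Sum>\<alpha>\<in>F. Q ^ snd \<alpha>) \<le> 6 * (1 / (1 - Q))"
proof -
  let ?D = "{(1, 0), (0, 1), (1, 1), (-1, 0), (0, -1), (-1, -1)} :: (int \<times> int) set"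
  obtain K where K: "snd ` F \<subseteq> {..<K}"
    using assms(3) finite_nat_set_iff_bounded by (metis finite_imageI lessThan_iff subsetI)
  have "F \<subseteq> ?D \<times> {..<K}"
    using assms(4) K by (fastforce simp: positive_affine_roots_def)
  hence "(\<Sum>\<alpha>\<in>F. Q ^ snd \<alpha>) \<le> (\<Sum>\<alpha>\<in>?D \<times> {..<K}. Q ^ snd \<alpha>)"
    using assms by (intro sum_mono2) auto
  also have "\<dots> = 6 * (\<Sum>j<K. Q ^ j)"
  proof -
    have "(\<Sum>\<alpha>\<in>?D \<times> {..<K}. Q ^ snd \<alpha>) = (\<Sum>d\<in>?D. \<Sum>j<K. Q ^ j)"
      by (simp only: sum.cartesian_product case_prod_unfold)
    also have "\<dots> = of_nat (card ?D) * (\<Sum>j<K. Q ^ j)" by (rule sum_constant)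
    also have "card ?D = 6" by simp
    finally show ?thesis by simp
  qed
  also have "(\<Sum>j<K. Q ^ j) \<le> (\<Sum>j. Q ^ j)"
    using assms by (intro sum_le_suminf summable_geometric) auto
  also have "(\<Sum>j. Q ^ j) = 1 / (1 - Q)" using assms by (intro suminf_geometric) auto
  finally show ?thesis by simp
qed

section \<open>Expansion of mu over the positive affine roots\<close>

definition affine_root_value :: "complex \<Rightarrow> complex \<Rightarrow> complex \<Rightarrow> (int \<times> int) \<times> nat \<Rightarrow> complex" where
  "affine_root_value q X Y \<alpha> = X powi fst (fst \<alpha>) * Y powi snd (fst \<alpha>) * q ^ snd \<alpha>"

text \<open>The shift between \<open>{..<n}\<close> and \<open>{1..n}\<close> matches the exponents
  i and i + 1 in \<open>mu_factor\<close>, so that the product over this set is exactly the product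
  of the three n-th partial products.\<close>

definition positive_affine_roots_upto :: "nat \<Rightarrow> ((int \<times> int) \<times> nat) set" where
  "positive_affine_roots_upto n =
     {(1, 0), (0, 1), (1, 1)} \<times> {..<n} \<union> {(-1, 0), (0, -1), (-1, -1)} \<times> {1..n}"

lemma mu_tendsto:
  assumes q: "norm q < 1" and XY: "X \<noteq> 0" "Y \<noteq> 0"
  shows "(\<lambda>n. \<Prod>\<alpha>\<in>positive_affine_roots_upto n.
            (1 - affine_root_value q X Y \<alpha>) / (1 - t * affine_root_value q X Y \<alpha>)) \<longlonglongrightarrow> mu q t X Y"
proof -
  define c where "c = (\<lambda>u. (1 - u) / (1 - t * u))"
  define P where "P = (\<lambda>Z n. \<Prod>i<n. ((1 - Z * q ^ i) * (1 - inverse Z * q ^ (i + 1))) /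
                           ((1 - t * Z * q ^ i) * (1 - t * inverse Z * q ^ (i + 1))))"
  have lim: "P Z \<longlonglongrightarrow> mu_factor q t Z" for Z
  proof -
    have eq: "(\<lambda>i. ((1 - Z * q ^ i) * (1 - inverse Z * q ^ (i + 1))) /
                ((1 - t * Z * q ^ i) * (1 - t * inverse Z * q ^ (i + 1)))) =
              (\<lambda>i. ((1 - Z * q ^ i) * (1 - (q / Z) * q ^ i)) /
                           ((1 - (t * Z) * q ^ i) * (1 - (t * q / Z) * q ^ i)))"
      by (simp add: divide_inverse mult_ac)
    have "convergent_prod (\<lambda>i. ((1 - Z * q ^ i) * (1 - inverse Z * q ^ (i + 1))) /
                ((1 - t * Z * q ^ i) * (1 - t * inverse Z * q ^ (i + 1))))"
      unfolding eq by (intro convergent_prod_divide convergent_prod_mult qpoch_convergent q)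
    thus ?thesis unfolding P_def mu_factor_def
      by (intro has_prod_imp_tendsto' convergent_prod_has_prod)
  qed
  have P: "P Z n = (\<Prod>i<n. c (Z * q ^ i)) * (\<Prod>i\<in>{1..n}. c (inverse Z * q ^ i))" for Z n
    unfolding P_def c_def
    by (simp add: prod.atLeast1_atMost_eq prod.distrib[symmetric] prod_dividef[symmetric] mult.assoc)
  have "(\<Prod>\<alpha>\<in>positive_affine_roots_upto n. c (affine_root_value q X Y \<alpha>)) = P X n * P Y n * P (X * Y) n" for n
  proof -
    have "(\<Prod>\<alpha>\<in>positive_affine_roots_upto n. c (affine_root_value q X Y \<alpha>)) =
            (\<Prod>\<alpha>\<in>{(1, 0), (0, 1), (1, 1)} \<times> {..<n}. c (affine_root_value q X Y \<alpha>)) *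
            (\<Prod>\<alpha>\<in>{(-1, 0), (0, -1), (-1, -1)} \<times> {1..n}. c (affine_root_value q X Y \<alpha>))"
      unfolding positive_affine_roots_upto_def by (rule prod.union_disjoint) auto
    also have "(\<Prod>\<alpha>\<in>{(1, 0), (0, 1), (1, 1)} \<times> {..<n}. c (affine_root_value q X Y \<alpha>)) =
            (\<Prod>i<n. c (X * q ^ i)) * (\<Prod>i<n. c (Y * q ^ i)) * (\<Prod>i<n. c (X * Y * q ^ i))"
      unfolding prod.cartesian_product' by (simp add: affine_root_value_def mult.assoc)
    also have "(\<Prod>\<alpha>\<in>{(-1, 0), (0, -1), (-1, -1)} \<times> {1..n}. c (affine_root_value q X Y \<alpha>)) =
            (\<Prod>i\<in>{1..n}. c (inverse X * q ^ i)) * (\<Prod>i\<in>{1..n}. c (inverse Y * q ^ i)) *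
            (\<Prod>i\<in>{1..n}. c (inverse (X * Y) * q ^ i))"
      unfolding prod.cartesian_product'
      by (simp add: affine_root_value_def mult.assoc power_int_minus mult.commute[of "inverse Y" "inverse X"])
    finally show ?thesis by (simp add: P mult_ac)
  qed
  moreover have "(\<lambda>n. P X n * P Y n * P (X * Y) n) \<longlonglongrightarrow> mu q t X Y"
    unfolding mu_def by (intro tendsto_mult lim)
  ultimately show ?thesis unfolding c_def by simp
qed

lemma prod_affine_root_value:
  assumes "X \<noteq> 0" "Y \<noteq> 0"
  shows "(\<Prod>\<alpha> | \<nu> \<alpha> \<noteq> 0. factor_coeff t (\<nu> \<alpha>) * affine_root_value q X Y \<alpha> ^ \<nu> \<alpha>) =
         mu_term_coeff q t \<nu> * (X powi mu_degree1 \<nu> * Y powi mu_degree2 \<nu>)"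
proof -
  have *: "(\<Prod>\<alpha>\<in>S. Z powi (int (\<nu> \<alpha>) * d \<alpha>)) = Z powi (\<Sum>\<alpha>\<in>S. int (\<nu> \<alpha>) * d \<alpha>)"
    if "Z \<noteq> 0" for Z :: complex and d and S :: "((int \<times> int) \<times> nat) set"
    by (induction S rule: infinite_finite_induct) (use that in \<open>auto simp: power_int_add\<close>)
  have pw: "(Z powi d) ^ n = Z powi (int n * d)" for Z :: complex and d n
    by (simp only: mult.commute[of "int n"] power_int_mult power_int_of_nat)
  have "factor_coeff t (\<nu> \<alpha>) * affine_root_value q X Y \<alpha> ^ \<nu> \<alpha> =
        (factor_coeff t (\<nu> \<alpha>) * (q ^ snd \<alpha>) ^ \<nu> \<alpha>) *
        (X powi (int (\<nu> \<alpha>) * fst (fst \<alpha>)) * Y powi (int (\<nu> \<alpha>) * snd (fst \<alpha>)))" for \<alpha>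
    by (simp only: affine_root_value_def power_mult_distrib pw mult_ac)
  thus ?thesis
    unfolding mu_term_coeff_def mu_degree1_def mu_degree2_def
    by (simp only: prod.distrib *[OF assms(1)] *[OF assms(2)])
qed

lemma mu_term_coeff_abs_summable:
  assumes q: "norm q < 1" and t: "norm t < 1"
  shows "(\<lambda>\<nu>. norm (mu_term_coeff q t \<nu>)) summable_on finite_exponents positive_affine_roots"
proof -
  have "(\<lambda>\<nu>. norm (\<Prod>\<alpha> | \<nu> \<alpha> \<noteq> 0. factor_coeff t (\<nu> \<alpha>) * (q ^ snd \<alpha>) ^ \<nu> \<alpha>)) summable_on
          finite_exponents positive_affine_roots"
  proof (rule finite_exponents_abs_summable)
    show "(\<Sum>k\<in>{1..K}. norm (factor_coeff t k * (q ^ snd \<alpha>) ^ k)) \<le>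
            norm (t - 1) / (1 - norm t) * norm q ^ snd \<alpha>" for \<alpha> :: "(int \<times> int) \<times> nat" and K
      using q t by (intro sum_norm_factor_coeff_le) (auto simp: norm_power power_le_one)
    show "(\<Sum>\<alpha>\<in>F. norm (t - 1) / (1 - norm t) * norm q ^ snd \<alpha>) \<le>
            norm (t - 1) / (1 - norm t) * (6 * (1 / (1 - norm q)))"
      if "finite F" "F \<subseteq> positive_affine_roots" for F
      unfolding sum_distrib_left[symmetric] using t q that
      by (intro mult_left_mono sum_positive_affine_roots_le) auto
  qed (auto simp: factor_coeff_def)
  thus ?thesis by (simp add: mu_term_coeff_def)
qed

text \<open>On the unit torus the value of a root [\<alpha>, j] has modulus |q|^j, so the majorants
  do not depend on X and Y.\<close>

lemma mu_expansion:
  assumes q: "norm q < 1" and t: "norm t < 1" and XY: "norm X = 1" "norm Y = 1"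
  shows "(\<Sum>\<^sub>\<infinity>\<nu>\<in>finite_exponents positive_affine_roots.
            mu_term_coeff q t \<nu> * (X powi mu_degree1 \<nu> * Y powi mu_degree2 \<nu>)) = mu q t X Y"
proof -
  have XY0: "X \<noteq> 0" "Y \<noteq> 0" using XY by auto
  have norm_v: "norm (affine_root_value q X Y \<alpha>) = norm q ^ snd \<alpha>" for \<alpha>
    using XY by (simp add: affine_root_value_def norm_mult norm_power norm_power_int)
  have le1: "norm q ^ n \<le> 1" for n using q by (simp add: power_le_one)
  have "(\<Sum>\<^sub>\<infinity>\<nu>\<in>finite_exponents positive_affine_roots.
          \<Prod>\<alpha> | \<nu> \<alpha> \<noteq> 0. factor_coeff t (\<nu> \<alpha>) * affine_root_value q X Y \<alpha> ^ \<nu> \<alpha>) = mu q t X Y"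
  proof (rule infsum_finite_exponents)
    show "(\<Sum>k\<in>{1..K}. norm (factor_coeff t k * affine_root_value q X Y \<alpha> ^ k)) \<le>
            norm (t - 1) / (1 - norm t) * norm q ^ snd \<alpha>" for \<alpha> :: "(int \<times> int) \<times> nat" and K
      using t norm_v le1 by (intro sum_norm_factor_coeff_le) auto
    show "(\<Sum>\<alpha>\<in>F. norm (t - 1) / (1 - norm t) * norm q ^ snd \<alpha>) \<le>
            norm (t - 1) / (1 - norm t) * (6 * (1 / (1 - norm q)))"
      if "finite F" "F \<subseteq> positive_affine_roots" for F
      unfolding sum_distrib_left[symmetric] using t q that
      by (intro mult_left_mono sum_positive_affine_roots_le) auto
    show "finite (positive_affine_roots_upto n)" for n
      by (simp add: positive_affine_roots_upto_def)
    show "positive_affine_roots_upto n \<subseteq> positive_affine_roots" for n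
      by (auto simp: positive_affine_roots_upto_def positive_affine_roots_def)
    show "\<forall>\<^sub>F n in sequentially. F \<subseteq> positive_affine_roots_upto n"
      if F: "finite F" "F \<subseteq> positive_affine_roots" for F
    proof -
      obtain K where K: "snd ` F \<subseteq> {..<K}"
        using F(1) finite_nat_set_iff_bounded by (metis finite_imageI lessThan_iff subsetI)
      have "F \<subseteq> positive_affine_roots_upto n" if "n \<ge> K" for n
      proof
        fix \<alpha> assume \<alpha>: "\<alpha> \<in> F"
        hence "snd \<alpha> < n" using K that by fastforce
        moreover have "\<alpha> \<in> positive_affine_roots" using \<alpha> F(2) by blast
        ultimately show "\<alpha> \<in> positive_affine_roots_upto n"
          unfolding positive_affine_roots_upto_def positive_affine_roots_def by fastforce
      qed
      thus ?thesis by (auto simp: eventually_sequentially)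
    qed
    show "(\<lambda>n. \<Prod>\<alpha>\<in>positive_affine_roots_upto n.
            \<Sum>\<^sub>\<infinity>k. factor_coeff t k * affine_root_value q X Y \<alpha> ^ k) \<longlonglongrightarrow> mu q t X Y"
      using mu_tendsto[OF q XY0, of t] by (subst infsum_factor_coeff[OF t]) (simp_all add: norm_v le1)
  qed (auto simp: factor_coeff_def)
  thus ?thesis by (simp only: prod_affine_root_value[OF XY0])
qed

section \<open>Regularity of mu and its Fourier coefficients\<close>

definition regular :: "complex \<Rightarrow> complex \<Rightarrow> complex \<Rightarrow> bool" where
  "regular q t Z \<longleftrightarrow> Z \<noteq> 0 \<and> qpoch q (t * Z) \<noteq> 0 \<and> qpoch q (t * q / Z) \<noteq> 0"

text \<open>The possible poles in Z form two families, q^(-i) / t and t q^(i+1). The hypotheses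
  place |Z| in the annulus between the families.\<close>

lemma regular_inside:
  assumes "norm q < 1" "norm t * norm Z < 1" "norm t * norm q < norm Z"
  shows "regular q t Z"
proof -
  have "0 \<le> norm t * norm q" by simp
  hence Z: "norm Z > 0" using assms(3) by linarith
  have "qpoch q (t * Z) \<noteq> 0" "qpoch q (t * q / Z) \<noteq> 0"
    using assms Z by (intro qpoch_nonzero_inside; simp add: norm_mult norm_divide)+
  thus ?thesis unfolding regular_def using Z by auto
qed

text \<open>Here |Z| lies beyond the first outer pole 1 / t but before the second one, 1 / (t
  q).\<close>

lemma regular_outside:
  assumes "norm q < 1" "1 < norm t * norm Z" "norm t * norm Z * norm q < 1" "norm t * norm q < norm Z"
  shows "regular q t Z"
proof -
  have "0 \<le> norm t * norm q" by simp
  hence Z: "norm Z > 0" using assms(4) by linarith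
  have "t * Z \<noteq> 1" using assms(2) by (metis norm_mult norm_one less_irrefl)
  hence "qpoch q (t * Z) \<noteq> 0"
    by (rule qpoch_nonzero_outside[OF assms(1)]) (use assms in \<open>simp add: norm_mult\<close>)
  moreover have "qpoch q (t * q / Z) \<noteq> 0"
    using assms Z by (intro qpoch_nonzero_inside) (auto simp: norm_mult norm_divide)
  ultimately show ?thesis unfolding regular_def using Z by auto
qed

lemma continuous_on_mu:
  assumes "norm q < 1" "continuous_on S t" "continuous_on S X" "continuous_on S Y"
    and "\<And>x. x \<in> S \<Longrightarrow> regular q (t x) (X x) \<and> regular q (t x) (Y x) \<and> regular q (t x) (X x * Y x)"
  shows "continuous_on S (\<lambda>x. mu q (t x) (X x) (Y x))"
  unfolding mu_def mu_factor_eq[OF assms(1)]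
  by (intro continuous_intros mu_qpoch_continuous) (use assms in \<open>auto simp: regular_def\<close>)

lemma holomorphic_on_mu:
  assumes "norm q < 1" "t holomorphic_on S" "X holomorphic_on S" "Y holomorphic_on S"
    and "\<And>x. x \<in> S \<Longrightarrow> regular q (t x) (X x) \<and> regular q (t x) (Y x) \<and> regular q (t x) (X x * Y x)"
  shows "(\<lambda>x. mu q (t x) (X x) (Y x)) holomorphic_on S"
  unfolding mu_def mu_factor_eq[OF assms(1)]
  by (intro holomorphic_intros mu_qpoch_holomorphic) (use assms in \<open>auto simp: regular_def\<close>)

lemma continuous_on_mu_unit_torus:
  assumes q: "norm q < 1" and t: "norm t < 1"
  shows "continuous_on (sphere 0 1 \<times> sphere 0 1) (\<lambda>(X, Y). mu q t X Y)"
proof -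
  have "norm t * norm q < 1" using q t mult_le_one[of "norm t" "norm q"]
    by (metis dual_order.strict_trans2 less_eq_real_def mult_left_le norm_ge_zero)
  thus ?thesis
    unfolding case_prod_unfold
    by (intro continuous_on_mu q continuous_intros conjI regular_inside)
       (use q t in \<open>auto simp: norm_mult\<close>)
qed

text \<open>The monomials have modulus 1 on the torus, so the summable coefficients themselves serve
  as majorants and the expansion converges uniformly. The mean may be taken term by term, and
  orthogonality keeps the terms of degree (- a, - b).\<close>

lemma torus_mean_mu:
  assumes q: "norm q < 1" and t: "norm t < 1"
  shows "torus_mean 1 1 (\<lambda>X Y. (X powi a * Y powi b) * mu q t X Y) = mu_coeff q t (- a) (- b)"
proof -
  let ?N = "finite_exponents positive_affine_roots"
  let ?W = "mu_term_coeff q t"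
  let ?e = "\<lambda>\<nu> X Y. X powi mu_degree1 \<nu> * Y powi mu_degree2 \<nu>"
  let ?h = "\<lambda>X Y. (X powi a * Y powi b) * mu q t X Y"
  let ?p = "\<lambda>F X Y. (X powi a * Y powi b) * (\<Sum>\<nu>\<in>F. ?W \<nu> * ?e \<nu> X Y)"
  let ?W' = "\<lambda>\<nu>. if \<nu> \<in> mu_terms (- a) (- b) then ?W \<nu> else 0"
  have norm_e: "norm (?e \<nu> X Y) = 1" if "norm X = 1" "norm Y = 1" for \<nu> and X Y :: complex
    using that by (simp add: norm_mult norm_power_int)
  have cont_pow: "continuous_on (sphere 0 1 \<times> sphere 0 1) (\<lambda>(X, Y). X powi i * Y powi j :: complex)" for i j
    unfolding case_prod_unfold by (intro continuous_intros) auto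
  have cont_h: "continuous_on (sphere 0 1 \<times> sphere 0 1) (\<lambda>(X, Y). ?h X Y)"
    using continuous_on_mult[OF cont_pow continuous_on_mu_unit_torus[OF q t]]
    by (simp add: case_prod_unfold)
  have p_eq: "?p F X Y = (\<Sum>\<nu>\<in>F. ?W \<nu> * (X powi (a + mu_degree1 \<nu>) * Y powi (b + mu_degree2 \<nu>)))"
    if "norm X = 1" "norm Y = 1" for F X Y
  proof -
    have "X \<noteq> 0" "Y \<noteq> 0" using that by auto
    thus ?thesis by (simp add: sum_distrib_left power_int_add mult_ac)
  qed
  have cont_t: "continuous_on (sphere 0 1 \<times> sphere 0 1)
      (\<lambda>(X, Y). ?W \<nu> * (X powi (a + mu_degree1 \<nu>) * Y powi (b + mu_degree2 \<nu>)))" for \<nu>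
    using continuous_on_mult_left[OF cont_pow] by (simp add: case_prod_unfold)
  have cont_p: "continuous_on (sphere 0 1 \<times> sphere 0 1) (\<lambda>(X, Y). ?p F X Y)" for F
  proof -
    have "continuous_on (sphere 0 1 \<times> sphere 0 1)
            (\<lambda>x. \<Sum>\<nu>\<in>F. (\<lambda>(X, Y). ?W \<nu> * (X powi (a + mu_degree1 \<nu>) * Y powi (b + mu_degree2 \<nu>))) x)"
      by (intro continuous_on_sum cont_t)
    thus ?thesis
      by (rule continuous_on_cong[THEN iffD1, rotated 2]) (auto simp: p_eq)
  qed
  have p: "torus_mean 1 1 (?p F) = sum ?W' F" if F: "finite F" "F \<subseteq> ?N" for F
  proof -
    have "torus_mean 1 1 (?p F) = torus_mean 1 1
            (\<lambda>X Y. \<Sum>\<nu>\<in>F. ?W \<nu> * (X powi (a + mu_degree1 \<nu>) * Y powi (b + mu_degree2 \<nu>)))"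
      by (intro torus_mean_cong p_eq) auto
    also have "\<dots> = (\<Sum>\<nu>\<in>F. ?W \<nu> * (if a + mu_degree1 \<nu> = 0 \<and> b + mu_degree2 \<nu> = 0 then 1 else 0))"
      by (subst torus_mean_sum) (use F cont_t in \<open>auto simp: torus_mean_cmult torus_mean_monomial\<close>)
    also have "\<dots> = sum ?W' F"
      using F(2) by (intro sum.cong) (auto simp: mu_terms_eq add_eq_0_iff)
    finally show ?thesis .
  qed
  have unif: "uniform_limit (sphere 0 1 \<times> sphere 0 1) (\<lambda>F y. \<Sum>\<nu>\<in>F. ?W \<nu> * ?e \<nu> (fst y) (snd y))
                (\<lambda>y. \<Sum>\<^sub>\<infinity>\<nu>\<in>?N. ?W \<nu> * ?e \<nu> (fst y) (snd y)) (finite_subsets_at_top ?N)"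
    by (rule Weierstrass_m_test_general[OF _ mu_term_coeff_abs_summable[OF q t]])
       (auto simp: norm_mult norm_power_int)
  have "((\<lambda>F. torus_mean 1 1 (?p F)) \<longlongrightarrow> torus_mean 1 1 ?h) (finite_subsets_at_top ?N)"
  proof (rule tendstoI)
    fix \<epsilon> :: real assume \<epsilon>: "\<epsilon> > 0"
    show "\<forall>\<^sub>F F in finite_subsets_at_top ?N. dist (torus_mean 1 1 (?p F)) (torus_mean 1 1 ?h) < \<epsilon>"
      using uniform_limitD[OF unif half_gt_zero[OF \<epsilon>]]
    proof eventually_elim
      case (elim F)
      have "norm (torus_mean 1 1 (\<lambda>X Y. ?p F X Y - ?h X Y)) \<le> \<epsilon> / 2"
      proof (rule torus_mean_norm_le)
        show "continuous_on (sphere 0 1 \<times> sphere 0 1) (\<lambda>(X, Y). ?p F X Y - ?h X Y)"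
          using continuous_on_diff[OF cont_p cont_h] by (simp add: case_prod_unfold)
        fix X Y :: complex assume XY: "norm X = 1" "norm Y = 1"
        have "dist (\<Sum>\<nu>\<in>F. ?W \<nu> * ?e \<nu> X Y) (mu q t X Y) < \<epsilon> / 2"
          using bspec[OF elim, of "(X, Y)"] XY mu_expansion[OF q t XY] by simp
        moreover have "norm (?p F X Y - ?h X Y) = dist (\<Sum>\<nu>\<in>F. ?W \<nu> * ?e \<nu> X Y) (mu q t X Y)"
          using XY unfolding right_diff_distrib[symmetric] norm_mult
          by (simp add: norm_power_int dist_norm)
        ultimately show "norm (?p F X Y - ?h X Y) \<le> \<epsilon> / 2" by simp
      qed auto
      thus ?case
        using \<epsilon> by (subst (asm) torus_mean_diff) (use cont_p cont_h in \<open>auto simp: dist_norm\<close>)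
    qed
  qed
  hence "((\<lambda>F. sum ?W' F) \<longlongrightarrow> torus_mean 1 1 ?h) (finite_subsets_at_top ?N)"
    by (rule tendsto_cong[THEN iffD1, rotated])
       (use p in \<open>auto intro!: eventually_finite_subsets_at_top_weakI\<close>)
  hence "(?W' has_sum torus_mean 1 1 ?h) ?N" by (simp add: has_sum_def)
  hence "infsum ?W' ?N = torus_mean 1 1 ?h" by (rule infsumI)
  moreover have "infsum ?W' ?N = infsum ?W (mu_terms (- a) (- b))"
    by (rule infsum_cong_neutral) (auto simp: mu_terms_eq)
  moreover have "mu_coeff q t (- a) (- b) = infsum ?W (mu_terms (- a) (- b))"
    unfolding mu_coeff_def mu_term_coeff_def ..
  ultimately show ?thesis by simp
qed

section \<open>Laurent coefficients and the constant term for Re k > 0\<close>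

lemma torus_mean_laurent:
  assumes c: "laurent_coeffs f c"
  shows "torus_mean 1 1 (\<lambda>X Y. (X powi (- m) * Y powi (- n)) * f X Y) = c (m, n)"
proof -
  have fin: "finite {p. c p \<noteq> 0}" using c by (simp add: laurent_coeffs_def)
  have "torus_mean 1 1 (\<lambda>X Y. (X powi (- m) * Y powi (- n)) * f X Y) =
        torus_mean 1 1 (\<lambda>X Y. \<Sum>p | c p \<noteq> 0. c p * (X powi (- m + fst p) * Y powi (- n + snd p)))"
  proof (rule torus_mean_cong)
    fix X Y :: complex assume "norm X = 1" "norm Y = 1"
    hence XY: "X \<noteq> 0" "Y \<noteq> 0" by auto
    hence f: "f X Y = (\<Sum>p | c p \<noteq> 0. c p * X powi fst p * Y powi snd p)"
      using c by (simp add: laurent_coeffs_def)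
    show "(X powi (- m) * Y powi (- n)) * f X Y =
          (\<Sum>p | c p \<noteq> 0. c p * (X powi (- m + fst p) * Y powi (- n + snd p)))"
      unfolding f sum_distrib_left
      by (simp only: power_int_add[OF disjI1[OF XY(1)]] power_int_add[OF disjI1[OF XY(2)]] mult_ac)
  qed auto
  also have "\<dots> = (\<Sum>p | c p \<noteq> 0. c p * (if - m + fst p = 0 \<and> - n + snd p = 0 then 1 else 0))"
  proof (subst torus_mean_sum)
    show "continuous_on (sphere 0 1 \<times> sphere 0 1)
            (\<lambda>(X, Y). c p * (X powi (- m + fst p) * Y powi (- n + snd p)))" for p
      unfolding case_prod_unfold by (intro continuous_intros) auto
  qed (use fin in \<open>simp_all add: torus_mean_cmult torus_mean_monomial\<close>)
  also have "\<dots> = (\<Sum>p | c p \<noteq> 0. if p = (m, n) then c p else 0)"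
  proof (rule sum.cong[OF refl])
    fix p show "c p * (if - m + fst p = 0 \<and> - n + snd p = 0 then 1 else 0) = (if p = (m, n) then c p else 0)"
      by (cases p) simp
  qed
  also have "\<dots> = c (m, n)" using fin by (auto simp: sum.delta)
  finally show ?thesis .
qed

text \<open>The coefficients are Fourier coefficients on the unit torus. This gives meaning to the
  definite description in \<open>ct_right\<close>.\<close>

lemma laurent_coeffs_unique:
  assumes "laurent_coeffs f c" "laurent_coeffs f c'"
  shows "c = c'"
proof
  fix p show "c p = c' p"
    using torus_mean_laurent[OF assms(1), of "fst p" "snd p"]
      torus_mean_laurent[OF assms(2), of "fst p" "snd p"] by simp
qed

lemma norm_q_of: "norm (q_of a) = exp (- 1 / a)"
  by (simp add: q_of_def)

lemma t_of_eq_exp: "t_of a k = exp (- k / a)"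
  by (simp add: t_of_def q_of_def powr_def Ln_of_real)

lemma norm_t_of: "norm (t_of a k) = exp (- Re k / a)"
  by (simp add: t_of_eq_exp norm_exp_eq_Re)

lemma norm_t_of_less_1:
  assumes "a > 0" "Re k > 0"
  shows "norm (t_of a k) < 1"
  using assms by (simp add: norm_t_of)

lemma I0_eq_torus_mean:
  assumes a: "a > 0"
  shows "I0 a k f / (2 * pi * \<i> * a)\<^sup>2 =
         torus_mean 1 1 (\<lambda>X Y. f X Y * mu (q_of a) (t_of a k) X Y)"
proof -
  let ?h = "\<lambda>X Y. f X Y * mu (q_of a) (t_of a k) X Y"
  have "I0 a k f = period_integral a 0 (\<lambda>x. (2 * pi * \<i> * a) * circle_mean 1 (?h (q_of a powr x)))"
    unfolding I0_def by (subst period_integral_circle_mean[OF a]) simp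
  also have "\<dots> = (2 * pi * \<i> * a) * circle_mean 1 (\<lambda>X. (2 * pi * \<i> * a) * circle_mean 1 (?h X))"
    using period_integral_circle_mean[OF a, of 0 "\<lambda>X. (2 * pi * \<i> * a) * circle_mean 1 (?h X)"] by simp
  also have "\<dots> = (2 * pi * \<i> * a)\<^sup>2 * torus_mean 1 1 ?h"
    by (simp only: circle_mean_mult_right torus_mean_def power2_eq_square mult.assoc)
  finally show ?thesis using a by simp
qed

text \<open>Both branches of \<open>ct_right\<close> reduce to the same mean, so from here on
  Laurent polynomials and general analytic functions are treated alike.\<close>

lemma ct_right_eq_torus_mean:
  assumes a: "a > 0" and k: "Re k > 0"
  shows "ct_right a f k = torus_mean 1 1 (\<lambda>X Y. f X Y * mu (q_of a) (t_of a k) X Y)"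
proof (cases "\<exists>c. laurent_coeffs f c")
  case True
  then obtain c where c: "laurent_coeffs f c" by blast
  have the: "(THE c. laurent_coeffs f c) = c"
    using c laurent_coeffs_unique by blast
  have fin: "finite {p. c p \<noteq> 0}" using c by (simp add: laurent_coeffs_def)
  let ?q = "q_of a" and ?t = "t_of a k"
  have q: "norm ?q < 1" using a by (simp add: norm_q_of)
  have t: "norm ?t < 1" by (rule norm_t_of_less_1[OF a k])
  have "ct_right a f k = (\<Sum>p | c p \<noteq> 0. c p * mu_coeff ?q ?t (- fst p) (- snd p))"
    using True by (simp add: ct_right_def the)
  also have "\<dots> = (\<Sum>p | c p \<noteq> 0. torus_mean 1 1 (\<lambda>X Y. c p * ((X powi fst p * Y powi snd p) * mu ?q ?t X Y)))"
    by (simp only: torus_mean_cmult torus_mean_mu[OF q t])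
  also have "\<dots> = torus_mean 1 1 (\<lambda>X Y. \<Sum>p | c p \<noteq> 0. c p * ((X powi fst p * Y powi snd p) * mu ?q ?t X Y))"
  proof (rule torus_mean_sum[symmetric])
    show "continuous_on (sphere 0 1 \<times> sphere 0 1)
            (\<lambda>(X, Y). c p * ((X powi fst p * Y powi snd p) * mu ?q ?t X Y))" for p
      using continuous_on_mu_unit_torus[OF q t] unfolding case_prod_unfold
      by (intro continuous_intros) auto
  qed (use fin in auto)
  also have "\<dots> = torus_mean 1 1 (\<lambda>X Y. f X Y * mu ?q ?t X Y)"
  proof (rule torus_mean_cong)
    fix X Y :: complex assume "norm X = 1" "norm Y = 1"
    hence "X \<noteq> 0" "Y \<noteq> 0" by auto
    hence "f X Y = (\<Sum>p | c p \<noteq> 0. c p * X powi fst p * Y powi snd p)"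
      using c by (simp add: laurent_coeffs_def)
    thus "(\<Sum>p | c p \<noteq> 0. c p * ((X powi fst p * Y powi snd p) * mu ?q ?t X Y)) = f X Y * mu ?q ?t X Y"
      by (simp add: sum_distrib_right mult.assoc)
  qed auto
  finally show ?thesis .
next
  case False
  thus ?thesis using I0_eq_torus_mean[OF a] by (simp add: ct_right_def)
qed

subsection \<open>Splitting off the pole factors\<close>

text \<open>In this and the following three definitions the factor vanishing at one pole is left out
  of the denominator: the pole 1 / t here and in \<open>zeta1_res\<close>, t^2 q in
  \<open>zeta1_res'\<close>, and 1 / (t^2 q) in \<open>zeta2_res\<close>.\<close>

definition mu_qpoch_res :: "complex \<Rightarrow> complex \<Rightarrow> complex \<Rightarrow> complex" where
  "mu_qpoch_res q t Z = (qpoch q Z * qpoch q (q / Z)) / (qpoch q (t * Z * q) * qpoch q (t * q / Z))"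

definition zeta1_res :: "complex \<Rightarrow> complex \<Rightarrow> complex \<Rightarrow> complex" where
  "zeta1_res q t Z = (qpoch q (q / Z) * qpoch q (Z / t)) / (qpoch q (t * Z * q) * qpoch q (t\<^sup>2 * q / Z))"

definition zeta1_res' :: "complex \<Rightarrow> complex \<Rightarrow> complex \<Rightarrow> complex" where
  "zeta1_res' q t Z = (qpoch q (q / Z) * qpoch q (Z / t)) / (qpoch q (t * Z) * qpoch q (t\<^sup>2 * q\<^sup>2 / Z))"

definition zeta2_res :: "complex \<Rightarrow> complex \<Rightarrow> complex \<Rightarrow> complex" where
  "zeta2_res q t Z = (qpoch q (Z * q) * qpoch q (q / (t * Z))) / (qpoch q (t * q / Z) * qpoch q (t\<^sup>2 * Z * q\<^sup>2))"

context
  fixes q :: complex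
  assumes q0: "q \<noteq> 0" and q1: "norm q < 1"
begin

lemma mu_qpoch_pole: "mu_qpoch q t Z = mu_qpoch_res q t Z / (1 - t * Z)"
  unfolding mu_qpoch_def mu_qpoch_res_def qpoch_rec[OF q1, of "t * Z"] by (simp add: mult_ac)

lemma zeta1_pole: "zeta1_qpoch q t Z = zeta1_res q t Z / (1 - t * Z)"
  unfolding zeta1_qpoch_def zeta1_res_def qpoch_rec[OF q1, of "t * Z"] by (simp add: mult_ac)

lemma zeta1_pole': "zeta1_qpoch q t Z = zeta1_res' q t Z / (1 - t\<^sup>2 * q / Z)"
  unfolding zeta1_qpoch_def zeta1_res'_def qpoch_rec[OF q1, of "t\<^sup>2 * q / Z"]
  by (simp add: mult_ac power2_eq_square)

lemma zeta2_pole: "zeta2_qpoch q t Z = zeta2_res q t Z / (1 - t\<^sup>2 * q * Z)"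
  unfolding zeta2_qpoch_def zeta2_res_def qpoch_rec[OF q1, of "t\<^sup>2 * Z * q"]
  by (simp add: mult_ac power2_eq_square)

lemma mu_qpoch_res_pole: "t \<noteq> 0 \<Longrightarrow> mu_qpoch_res q t (1 / t) = rho0_qpoch q t"
  by (simp add: mu_qpoch_res_def rho0_qpoch_def power2_eq_square mult_ac)

lemma zeta1_res_pole: "t \<noteq> 0 \<Longrightarrow> rho0_qpoch q t * zeta1_res q t (1 / t) = rho_qpoch q t"
  by (simp add: zeta1_res_def rho0_qpoch_def rho_qpoch_def power2_eq_square power3_eq_cube mult_ac)

text \<open>At t^2 q the same four q-Pochhammer values occur as at 1 / t, with the factors
  interchanged. This is why varpi2 equals 1.\<close>

lemma zeta1_res'_pole: "t \<noteq> 0 \<Longrightarrow> rho0_qpoch q t * zeta1_res' q t (t\<^sup>2 * q) = rho_qpoch q t"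
  using q0 by (simp add: zeta1_res'_def rho0_qpoch_def rho_qpoch_def power2_eq_square power3_eq_cube mult_ac)

text \<open>Here the values at t q^2 and t^3 q^2 appear where \<open>rho_qpoch\<close> has those at
  t q and t^3 q. One recursion step for each gives the quotient (1 - t^3 q) / (1 - t q) in varpi1,
  and its factor 1 / t is the one in front of zeta2.\<close>

lemma zeta2_res_pole:
  assumes "t \<noteq> 0" "t * q \<noteq> 1" "t ^ 3 * q \<noteq> 1"
  shows "rho0_qpoch q t / t * zeta2_res q t (1 / (t\<^sup>2 * q)) = rho_qpoch q t * varpi1 q t"
proof -
  have e: "1 / (t\<^sup>2 * q) * q = 1 / t\<^sup>2" "q / (t * (1 / (t\<^sup>2 * q))) = t * q * q"
    "t * q / (1 / (t\<^sup>2 * q)) = t ^ 3 * q * q" "t\<^sup>2 * (1 / (t\<^sup>2 * q)) * q\<^sup>2 = q"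
    using assms(1) q0 by (simp_all add: field_simps power2_eq_square power3_eq_cube)
  have "zeta2_res q t (1 / (t\<^sup>2 * q)) = (qpoch q (1 / t\<^sup>2) * qpoch q (t * q * q)) / (qpoch q (t ^ 3 * q * q) * qpoch q q)"
    unfolding zeta2_res_def e ..
  moreover have "rho_qpoch q t * varpi1 q t = rho0_qpoch q t / t *
      ((qpoch q (1 / t\<^sup>2) * qpoch q (t * q * q)) / (qpoch q (t ^ 3 * q * q) * qpoch q q))"
  proof -
    have "rho_qpoch q t * varpi1 q t =
        qpoch q (1 / t) * qpoch q (t * q) * ((1 - t * q) * qpoch q (t * q * q)) * qpoch q (1 / t\<^sup>2) /
        (qpoch q q * qpoch q q * qpoch q (t\<^sup>2 * q) * ((1 - t ^ 3 * q) * qpoch q (t ^ 3 * q * q))) *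
        ((1 / t) * (1 - t ^ 3 * q) / (1 - t * q))"
      unfolding rho_qpoch_def varpi1_def qpoch_rec[OF q1, of "t ^ 3 * q"] power2_eq_square
      by (subst qpoch_rec[OF q1, of "t * q"]) (simp add: inverse_eq_divide qpoch_rec[OF q1, of "t * q"] mult_ac)
    also have "\<dots> = qpoch q (1 / t) * qpoch q (t * q) * qpoch q (t * q * q) * qpoch q (1 / t\<^sup>2) /
        (qpoch q q * qpoch q q * qpoch q (t\<^sup>2 * q) * qpoch q (t ^ 3 * q * q)) * (1 / t) *
        ((1 - t * q) / (1 - t * q)) * ((1 - t ^ 3 * q) / (1 - t ^ 3 * q))"
      by (simp only: divide_inverse inverse_mult_distrib mult_ac)
    also have "\<dots> = rho0_qpoch q t / t * ((qpoch q (1 / t\<^sup>2) * qpoch q (t * q * q)) / (qpoch q (t ^ 3 * q * q) * qpoch q q))"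
      using assms by (simp add: rho0_qpoch_def mult_ac)
    finally show ?thesis .
  qed
  ultimately show ?thesis by simp
qed

text \<open>On the divisor where one coordinate is 1 / t, the other coordinate Z and the product Z /
  t remain as arguments of mu. Two factors of the first quotient cancel against two of the second,
  and zeta1 is what is left.\<close>

lemma mu_qpoch_mult_zeta1:
  assumes "t \<noteq> 0" "Z \<noteq> 0" "qpoch q Z \<noteq> 0" "qpoch q (t * q / Z) \<noteq> 0"
  shows "mu_qpoch q t Z * mu_qpoch q t (Z / t) = zeta1_qpoch q t Z"
  unfolding mu_qpoch_def zeta1_qpoch_def using assms
  by (simp add: power2_eq_square field_simps)

text \<open>On the divisor X Y = 1 / t the factors of Y = Z and X = 1 / (t Z) remain. They cancel
  only up to the first terms of the products, whose quotients - Z and - 1 / (t Z) multiply to 1 / t.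
  This accounts for the t^(-1) in zeta2 and for its product starting at j = 1.\<close>

lemma mu_qpoch_mult_zeta2:
  assumes "t \<noteq> 0" "Z \<noteq> 0" "Z \<noteq> 1" "t * Z \<noteq> 1" "qpoch q (q / Z) \<noteq> 0" "qpoch q (t * Z * q) \<noteq> 0"
  shows "mu_qpoch q t Z * mu_qpoch q t (1 / (t * Z)) = zeta2_qpoch q t Z / t"
proof -
  have r1: "qpoch q (1 / Z) = (1 - 1 / Z) * qpoch q (q / Z)" using qpoch_rec[OF q1, of "1 / Z"] by simp
  have r2: "qpoch q (1 / (t * Z)) = (1 - 1 / (t * Z)) * qpoch q (q / (t * Z))"
    using qpoch_rec[OF q1, of "1 / (t * Z)"] by simp
  have e: "t * (1 / (t * Z)) = 1 / Z" "q / (1 / (t * Z)) = t * Z * q" "t * q / (1 / (t * Z)) = t\<^sup>2 * Z * q"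
    using assms by (simp_all add: power2_eq_square mult_ac)
  have s1: "(1 - Z) / (1 - 1 / Z) = - Z" and s2: "(1 - 1 / (t * Z)) / (1 - t * Z) = - 1 / (t * Z)"
    using assms by (simp_all add: field_simps)
  have "mu_qpoch q t Z * mu_qpoch q t (1 / (t * Z)) =
      ((1 - Z) * qpoch q (Z * q) * qpoch q (q / Z)) / ((1 - t * Z) * qpoch q (t * Z * q) * qpoch q (t * q / Z)) *
      (((1 - 1 / (t * Z)) * qpoch q (q / (t * Z)) * qpoch q (t * Z * q)) /
       ((1 - 1 / Z) * qpoch q (q / Z) * qpoch q (t\<^sup>2 * Z * q)))"
    unfolding mu_qpoch_def e r1 r2 qpoch_rec[OF q1, of Z] qpoch_rec[OF q1, of "t * Z"] ..
  also have "\<dots> = ((1 - Z) / (1 - 1 / Z)) * ((1 - 1 / (t * Z)) / (1 - t * Z)) * zeta2_qpoch q t Z *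
      (qpoch q (q / Z) / qpoch q (q / Z)) * (qpoch q (t * Z * q) / qpoch q (t * Z * q))"
    unfolding zeta2_qpoch_def by (simp only: divide_inverse inverse_mult_distrib mult_ac)
  also have "\<dots> = zeta2_qpoch q t Z / t" unfolding s1 s2 using assms by simp
  finally show ?thesis .
qed

end

subsection \<open>Functions on the torus\<close>

text \<open>Joint continuity and holomorphy along holomorphic curves are what the contour arguments
  use of analyticity in two variables; both classes of functions in the theorem have these
  properties.\<close>

definition torus_holomorphic :: "(complex \<Rightarrow> complex \<Rightarrow> complex) \<Rightarrow> bool" where
  "torus_holomorphic f \<longleftrightarrow> continuous_on ((- {0}) \<times> (- {0})) (\<lambda>(X, Y). f X Y) \<and>
     (\<forall>g h S. g holomorphic_on S \<longrightarrow> h holomorphic_on S \<longrightarrow> (\<forall>z\<in>S. g z \<noteq> 0 \<and> h z \<noteq> 0) \<longrightarrow>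
        (\<lambda>z. f (g z) (h z)) holomorphic_on S)"

lemma torus_holomorphic_analytic_torus:
  assumes "analytic_torus f"
  shows "torus_holomorphic f"
  unfolding torus_holomorphic_def
proof (intro conjI allI impI)
  show "continuous_on ((- {0}) \<times> (- {0})) (\<lambda>(X, Y). f X Y)"
  proof (rule continuous_at_imp_continuous_on, rule ballI)
    fix p :: "complex \<times> complex" assume "p \<in> (- {0}) \<times> (- {0})"
    then obtain X Y where p: "p = (X, Y)" "X \<noteq> 0" "Y \<noteq> 0" by auto
    then obtain A B where "((\<lambda>(x, y). f x y) has_derivative (\<lambda>(u, v). A * u + B * v)) (at (X, Y))"
      using assms unfolding analytic_torus_def by blast
    thus "isCont (\<lambda>(X, Y). f X Y) p" unfolding p(1) by (rule has_derivative_continuous)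
  qed
next
  fix g h :: "complex \<Rightarrow> complex" and S
  assume g: "g holomorphic_on S" and h: "h holomorphic_on S" and nz: "\<forall>z\<in>S. g z \<noteq> 0 \<and> h z \<noteq> 0"
  show "(\<lambda>z. f (g z) (h z)) holomorphic_on S"
    unfolding holomorphic_on_def
  proof
    fix z assume z: "z \<in> S"
    obtain g' h' where d: "(g has_field_derivative g') (at z within S)" "(h has_field_derivative h') (at z within S)"
      using g h z unfolding holomorphic_on_def field_differentiable_def by blast
    obtain A B where AB: "((\<lambda>(x, y). f x y) has_derivative (\<lambda>(u, v). A * u + B * v)) (at (g z, h z))"
      using assms nz z unfolding analytic_torus_def by blast
    have "((\<lambda>z. (g z, h z)) has_derivative (\<lambda>w. (g' * w, h' * w))) (at z within S)"
      using d by (intro has_derivative_Pair) (auto simp: has_field_derivative_def)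
    from has_derivative_compose[OF this AB]
    have "((\<lambda>z. f (g z) (h z)) has_derivative (\<lambda>w. A * (g' * w) + B * (h' * w))) (at z within S)"
      by simp
    moreover have "(\<lambda>w. A * (g' * w) + B * (h' * w)) = (*) (A * g' + B * h')"
      by (auto simp: algebra_simps)
    ultimately have "((\<lambda>z. f (g z) (h z)) has_field_derivative (A * g' + B * h')) (at z within S)"
      by (simp add: has_field_derivative_def)
    thus "(\<lambda>z. f (g z) (h z)) field_differentiable at z within S"
      unfolding field_differentiable_def by blast
  qed
qed

lemma torus_holomorphic_laurent:
  assumes "laurent_coeffs f c"
  shows "torus_holomorphic f"
  unfolding torus_holomorphic_def
proof (intro conjI allI impI)
  let ?g = "\<lambda>X Y. \<Sum>p | c p \<noteq> 0. c p * X powi fst p * Y powi snd p"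
  have f: "f X Y = ?g X Y" if "X \<noteq> 0" "Y \<noteq> 0" for X Y
    using assms that by (simp add: laurent_coeffs_def)
  have "continuous_on ((- {0}) \<times> (- {0})) (\<lambda>x. ?g (fst x) (snd x))"
    by (intro continuous_intros) auto
  thus "continuous_on ((- {0}) \<times> (- {0})) (\<lambda>(X, Y). f X Y)"
  proof (rule continuous_on_eq)
    fix x :: "complex \<times> complex" assume "x \<in> (- {0}) \<times> (- {0})"
    hence "fst x \<noteq> 0" "snd x \<noteq> 0" by (simp_all add: mem_Times_iff)
    from f[OF this] show "?g (fst x) (snd x) = (\<lambda>(X, Y). f X Y) x"
      by (simp add: case_prod_unfold)
  qed
  fix g h :: "complex \<Rightarrow> complex" and S
  assume g: "g holomorphic_on S" and h: "h holomorphic_on S" and nz: "\<forall>z\<in>S. g z \<noteq> 0 \<and> h z \<noteq> 0"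
  have "(\<lambda>z. ?g (g z) (h z)) holomorphic_on S"
    using g h nz by (intro holomorphic_intros) auto
  thus "(\<lambda>z. f (g z) (h z)) holomorphic_on S"
    by (rule holomorphic_transform) (use nz f in auto)
qed

lemma torus_holomorphic_compose:
  assumes "torus_holomorphic f" "g holomorphic_on S" "h holomorphic_on S"
    and "\<And>z. z \<in> S \<Longrightarrow> g z \<noteq> 0 \<and> h z \<noteq> 0"
  shows "(\<lambda>z. f (g z) (h z)) holomorphic_on S"
  using assms unfolding torus_holomorphic_def by blast

lemma torus_continuous_compose:
  assumes "torus_holomorphic f" "continuous_on S g" "continuous_on S h"
    and "\<And>z. z \<in> S \<Longrightarrow> g z \<noteq> 0 \<and> h z \<noteq> 0"
  shows "continuous_on S (\<lambda>z. f (g z) (h z))"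
proof -
  have "continuous_on S (\<lambda>z. (\<lambda>(X, Y). f X Y) (g z, h z))"
    by (rule continuous_on_compose2[of "(- {0}) \<times> (- {0})"])
       (use assms in \<open>auto simp: torus_holomorphic_def intro!: continuous_intros\<close>)
  thus ?thesis by simp
qed

subsection \<open>Moving the contours\<close>

definition ct_mean :: "complex \<Rightarrow> (complex \<Rightarrow> complex \<Rightarrow> complex) \<Rightarrow> real \<Rightarrow> real \<Rightarrow> complex \<Rightarrow> complex" where
  "ct_mean q f r s t = torus_mean r s (\<lambda>X Y. f X Y * mu q t X Y)"

definition zeta1_mean :: "complex \<Rightarrow> (complex \<Rightarrow> complex \<Rightarrow> complex) \<Rightarrow> real \<Rightarrow> complex \<Rightarrow> complex" where
  "zeta1_mean q f s t = circle_mean s (\<lambda>Y. (f (1 / t) Y + f Y (1 / t)) * zeta1_qpoch q t Y)"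

definition zeta2_mean :: "complex \<Rightarrow> (complex \<Rightarrow> complex \<Rightarrow> complex) \<Rightarrow> real \<Rightarrow> complex \<Rightarrow> complex" where
  "zeta2_mean q f s t = circle_mean s (\<lambda>Y. f (1 / (t * Y)) Y * zeta2_qpoch q t Y)"

context
  fixes q :: complex and f :: "complex \<Rightarrow> complex \<Rightarrow> complex"
  assumes q0: "q \<noteq> 0" and q1: "norm q < 1" and f: "torus_holomorphic f"
begin

lemma continuous_on_f_mu:
  assumes "continuous_on S t" "continuous_on S X" "continuous_on S Y"
    and "\<And>x. x \<in> S \<Longrightarrow> regular q (t x) (X x) \<and> regular q (t x) (Y x) \<and> regular q (t x) (X x * Y x)"
  shows "continuous_on S (\<lambda>x. f (X x) (Y x) * mu q (t x) (X x) (Y x))"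
  by (intro continuous_on_mult torus_continuous_compose[OF f] continuous_on_mu q1 assms)
     (use assms(4) in \<open>auto simp: regular_def\<close>)

lemma holomorphic_on_f_mu:
  assumes "t holomorphic_on S" "X holomorphic_on S" "Y holomorphic_on S"
    and "\<And>x. x \<in> S \<Longrightarrow> regular q (t x) (X x) \<and> regular q (t x) (Y x) \<and> regular q (t x) (X x * Y x)"
  shows "(\<lambda>x. f (X x) (Y x) * mu q (t x) (X x) (Y x)) holomorphic_on S"
  by (intro holomorphic_on_mult torus_holomorphic_compose[OF f] holomorphic_on_mu q1 assms)
     (use assms(4) in \<open>auto simp: regular_def\<close>)

lemma ct_mean_holomorphic:
  assumes rs: "r \<ge> 0" "s \<ge> 0" and U: "open U"
    and reg: "\<And>t X Y. t \<in> U \<Longrightarrow> norm X = r \<Longrightarrow> norm Y = s \<Longrightarrow>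
                regular q t X \<and> regular q t Y \<and> regular q t (X * Y)"
  shows "ct_mean q f r s holomorphic_on U"
proof -
  have "(\<lambda>t. circle_mean r (\<lambda>X. circle_mean s (\<lambda>Y. f X Y * mu q t X Y))) holomorphic_on U"
  proof (rule circle_mean_holomorphic[OF rs(1) U])
    have "continuous_on (U \<times> sphere 0 r) (\<lambda>p. circle_mean s (\<lambda>Y. f (snd p) Y * mu q (fst p) (snd p) Y))"
    proof (rule continuous_on_circle_mean[OF rs(2)])
      have "continuous_on ((U \<times> sphere 0 r) \<times> sphere 0 s)
              (\<lambda>x. f (snd (fst x)) (snd x) * mu q (fst (fst x)) (snd (fst x)) (snd x))"
        by (rule continuous_on_f_mu) (use reg in \<open>auto intro!: continuous_intros\<close>)
      thus "continuous_on ((U \<times> sphere 0 r) \<times> sphere 0 s)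
              (\<lambda>(p, Y). f (snd p) Y * mu q (fst p) (snd p) Y)"
        by (simp add: case_prod_unfold)
    qed
    thus "continuous_on (U \<times> sphere 0 r) (\<lambda>(t, X). circle_mean s (\<lambda>Y. f X Y * mu q t X Y))"
      by (simp add: case_prod_unfold)
  next
    fix X :: complex assume X: "norm X = r"
    show "(\<lambda>t. circle_mean s (\<lambda>Y. f X Y * mu q t X Y)) holomorphic_on U"
    proof (rule circle_mean_holomorphic[OF rs(2) U])
      have "continuous_on (U \<times> sphere 0 s) (\<lambda>x. f X (snd x) * mu q (fst x) X (snd x))"
        by (rule continuous_on_f_mu) (use reg X in \<open>auto intro!: continuous_intros\<close>)
      thus "continuous_on (U \<times> sphere 0 s) (\<lambda>(t, Y). f X Y * mu q t X Y)"
        by (simp add: case_prod_unfold)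
      show "(\<lambda>t. f X Y * mu q t X Y) holomorphic_on U" if "norm Y = s" for Y
        by (rule holomorphic_on_f_mu) (use reg X that in \<open>auto intro!: holomorphic_intros\<close>)
    qed
  qed
  thus ?thesis by (simp add: ct_mean_def[abs_def] torus_mean_def)
qed

text \<open>Y is moved first, then X. The tightest constraint comes from the factor of X Y when |Y|
  = r: its inner pole X = t q / Y has modulus |t q| / r, which is below r because |q| < r^2.\<close>

lemma ct_mean_shift_radius:
  assumes t: "t \<noteq> 0" "norm t < 1" and r: "0 < r" "r < 1" "norm q < r\<^sup>2"
  shows "ct_mean q f 1 1 t = ct_mean q f r r t"
proof -
  let ?T = "norm t" and ?Q = "norm q"
  have r2: "r\<^sup>2 < r" using r by (simp add: power2_eq_square)
  have T: "0 < ?T" "0 < ?Q" using t q0 by auto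
  have TQ: "?T * ?Q < r\<^sup>2"
  proof -
    have "?T * ?Q < 1 * ?Q" using t T by (intro mult_strict_right_mono) auto
    thus ?thesis using r by linarith
  qed
  have TQr: "?T * ?Q / r < r" using TQ r by (simp add: field_simps power2_eq_square)
  have TQ1: "?T * ?Q < r" "?T * ?Q < 1" using TQ r2 r by linarith+
  have TQr': "?T * ?Q \<le> ?T * ?Q / r" using r T by (simp add: field_simps)
  have Tr: "?T * r < 1" using mult_strict_mono[OF t(2) r(2)] r by simp
  have rT: "r < 1 / ?T" using Tr t T by (simp add: field_simps)
  have 1: "circle_mean 1 (\<lambda>Y. f X Y * mu q t X Y) = circle_mean r (\<lambda>Y. f X Y * mu q t X Y)"
    if X: "norm X = 1" for X :: complex
  proof (rule circle_mean_annulus)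
    show "(\<lambda>Y. f X Y * mu q t X Y) holomorphic_on {z. ?T * ?Q < norm z \<and> norm z < 1 / ?T}"
    proof (rule holomorphic_on_f_mu)
      fix Y :: complex assume "Y \<in> {z. ?T * ?Q < norm z \<and> norm z < 1 / ?T}"
      hence Y: "?T * ?Q < norm Y" "?T * norm Y < 1" using T by (auto simp: field_simps)
      show "regular q t X \<and> regular q t Y \<and> regular q t (X * Y)"
        using X Y TQ1 t by (intro conjI regular_inside q1) (auto simp: norm_mult)
    qed (auto intro!: holomorphic_intros)
  qed (use TQ1 t r T rT in auto)
  have 2: "circle_mean 1 (\<lambda>X. circle_mean r (\<lambda>Y. f X Y * mu q t X Y)) =
           circle_mean r (\<lambda>X. circle_mean r (\<lambda>Y. f X Y * mu q t X Y))"
  proof (rule circle_mean_annulus)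
    let ?A = "{z. ?T * ?Q / r < norm z \<and> norm z < 1 / ?T}"
    have reg: "regular q t X \<and> regular q t Y \<and> regular q t (X * Y)" if "X \<in> ?A" "norm Y = r" for X Y :: complex
    proof -
      have X: "?T * ?Q < r * norm X" "?T * norm X < 1" using that T r by (auto simp: field_simps)
      have "r * norm X \<le> norm X" using r by (simp add: mult_left_le_one_le)
      moreover have "?T * (norm X * r) < 1 * 1"
        unfolding mult.assoc[symmetric] using X r by (intro mult_strict_mono) auto
      ultimately show ?thesis
        using X Tr TQ1 that(2) by (intro conjI regular_inside q1) (auto simp: norm_mult mult_ac)
    qed
    show "(\<lambda>X. circle_mean r (\<lambda>Y. f X Y * mu q t X Y)) holomorphic_on ?A"
    proof (rule circle_mean_holomorphic)
      have "continuous_on (?A \<times> sphere 0 r) (\<lambda>x. f (fst x) (snd x) * mu q t (fst x) (snd x))"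
        by (rule continuous_on_f_mu) (use reg in \<open>auto intro!: continuous_intros\<close>)
      thus "continuous_on (?A \<times> sphere 0 r) (\<lambda>(X, Y). f X Y * mu q t X Y)"
        by (simp add: case_prod_unfold)
      show "(\<lambda>X. f X Y * mu q t X Y) holomorphic_on ?A" if "norm Y = r" for Y
        by (rule holomorphic_on_f_mu) (use reg that in \<open>auto intro!: holomorphic_intros\<close>)
      show "open ?A" by (intro open_Collect_conj open_Collect_less continuous_intros)
    qed (use r in auto)
  qed (use TQr TQ1 t r T rT in auto)
  have "ct_mean q f 1 1 t = circle_mean 1 (\<lambda>X. circle_mean r (\<lambda>Y. f X Y * mu q t X Y))"
    unfolding ct_mean_def torus_mean_def by (intro circle_mean_cong 1) auto
  thus ?thesis using 2 by (simp add: ct_mean_def torus_mean_def)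
qed

text \<open>For |X| = r only 1 / t is crossed: the outer pole 1 / (t X) of the factor of X Y has
  modulus 1 / (|t| r) > 1, and the inner poles t q and t q / X have modulus below r.\<close>

lemma inner_pole_Y:
  assumes t: "1 < norm t" "norm t * r < 1" "norm t * norm q < r\<^sup>2" and r: "0 < r" "r < 1"
    and X: "norm X = r"
  shows "circle_mean r (\<lambda>Y. f X Y * mu q t X Y) =
         circle_mean 1 (\<lambda>Y. f X Y * mu q t X Y) + f X (1 / t) * (rho0_qpoch q t * zeta1_qpoch q t X)"
proof -
  let ?T = "norm t" and ?Q = "norm q"
  define G where "G = (\<lambda>Y. f X Y * mu_qpoch q t X * mu_qpoch q t (X * Y) * mu_qpoch_res q t Y)"
  have r2: "r\<^sup>2 < r" using r by (simp add: power2_eq_square)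
  have T: "0 < ?T" "0 < ?Q" "t \<noteq> 0" "X \<noteq> 0" using t q0 X r by auto
  have TQr: "?T * ?Q / r < r" using t r by (simp add: field_simps power2_eq_square)
  have TQ1: "?T * ?Q < r" "?T * ?Q < 1" using t r2 r by linarith+
  have TQr': "?T * ?Q \<le> ?T * ?Q / r" using r T by (simp add: field_simps)
  have regX: "regular q t X" using t X TQ1 by (intro regular_inside q1) auto
  have G_eq: "f X Y * mu q t X Y = G Y / (1 - Y / (1 / t))" for Y
    unfolding G_def mu_def mu_factor_eq[OF q1] mu_qpoch_pole[OF q0 q1, of t Y] by (simp add: mult_ac)
  have holo: "G holomorphic_on {z. ?T * ?Q / r < norm z \<and> norm z < 1 / (?T * r)}"
    unfolding G_def mu_qpoch_res_def
  proof (intro holomorphic_intros torus_holomorphic_compose[OF f] mu_qpoch_holomorphic q1)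
    fix Y :: complex assume "Y \<in> {z. ?T * ?Q / r < norm z \<and> norm z < 1 / (?T * r)}"
    hence Y: "?T * ?Q / r < norm Y" "?T * ?Q < r * norm Y" "?T * (r * norm Y) < 1"
      using T r by (auto simp: field_simps)
    have TQY: "?T * ?Q < norm Y" using Y TQr' by linarith
    have "0 < ?T * ?Q" using T by simp
    hence Y0: "Y \<noteq> 0" using TQY by auto
    show "X \<noteq> 0 \<and> Y \<noteq> 0" using T Y0 by auto
    have "regular q t (X * Y)"
      using Y X by (intro regular_inside q1) (auto simp: norm_mult)
    thus "X * Y \<noteq> 0 \<and> qpoch q (t * (X * Y)) \<noteq> 0 \<and> qpoch q (t * q / (X * Y)) \<noteq> 0"
      by (simp add: regular_def)
    have "norm (t * Y * q) < 1"
    proof -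
      have "norm (t * Y * q) = (?T * ?Q / r) * (r * norm Y)"
        using r by (simp add: norm_mult)
      also have "\<dots> < r * (1 / ?T)"
        using TQr Y T r by (intro mult_strict_mono) (auto simp: field_simps)
      also have "\<dots> < 1" using r t T by (simp add: field_simps)
      finally show ?thesis .
    qed
    moreover have "norm (t * q / Y) < 1" using TQY Y0 by (simp add: norm_mult norm_divide)
    ultimately show "qpoch q (t * Y * q) * qpoch q (t * q / Y) \<noteq> 0"
      by (simp add: qpoch_nonzero_inside[OF q1])
    show "Y \<noteq> 0" by fact
  qed (use r in \<open>auto simp: mult_less_0_iff divide_less_0_iff\<close>)
  have "circle_mean r (\<lambda>Y. G Y / (1 - Y / (1 / t))) =
        circle_mean 1 (\<lambda>Y. G Y / (1 - Y / (1 / t))) + G (1 / t)"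
    by (rule circle_mean_pole[OF holo]) (use t r TQr T in \<open>auto simp: norm_divide field_simps\<close>)
  moreover have "G (1 / t) = f X (1 / t) * (rho0_qpoch q t * zeta1_qpoch q t X)"
  proof -
    have "qpoch q X \<noteq> 0" using X r by (intro qpoch_nonzero_inside[OF q1]) auto
    moreover have "qpoch q (t * q / X) \<noteq> 0" using regX by (simp add: regular_def)
    ultimately have "mu_qpoch q t X * mu_qpoch q t (X / t) = zeta1_qpoch q t X"
      using T by (intro mu_qpoch_mult_zeta1 q0 q1) auto
    thus ?thesis unfolding G_def mu_qpoch_res_pole[OF q0 q1 T(3)] by (simp add: mult_ac)
  qed
  ultimately show ?thesis unfolding G_eq by simp
qed

text \<open>The residue left by Y is itself a mean over |X| = r. On the way to radius 1 it crosses 1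
  / t, while the inner pole t^2 q stays inside as |t^2 q| < r.\<close>

lemma zeta1_pole_X:
  assumes t: "1 < norm t" "norm t * r < 1" "norm t * norm q < 1" "(norm t)\<^sup>2 * norm q < r"
    and r: "0 < r" "r < 1"
  shows "rho0_qpoch q t * circle_mean r (\<lambda>X. f X (1 / t) * zeta1_qpoch q t X) =
         rho0_qpoch q t * circle_mean 1 (\<lambda>X. f X (1 / t) * zeta1_qpoch q t X) + rho_qpoch q t * f (1 / t) (1 / t)"
proof -
  let ?T = "norm t" and ?Q = "norm q"
  define G where "G = (\<lambda>X. f X (1 / t) * zeta1_res q t X)"
  have T: "0 < ?T" "0 < ?Q" "t \<noteq> 0" using t q0 by auto
  have G_eq: "f X (1 / t) * zeta1_qpoch q t X = G X / (1 - X / (1 / t))" for X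
    unfolding G_def zeta1_pole[OF q0 q1] by (simp add: mult_ac)
  have holo: "G holomorphic_on {z. ?T\<^sup>2 * ?Q < norm z \<and> norm z < 1 / (?T * ?Q)}"
    unfolding G_def zeta1_res_def
  proof (intro holomorphic_intros torus_holomorphic_compose[OF f] q1)
    fix X :: complex assume "X \<in> {z. ?T\<^sup>2 * ?Q < norm z \<and> norm z < 1 / (?T * ?Q)}"
    hence X: "?T\<^sup>2 * ?Q < norm X" "?T * norm X * ?Q < 1" using T by (auto simp: field_simps)
    have "0 < ?T\<^sup>2 * ?Q" using T by simp
    hence X0: "X \<noteq> 0" using X by auto
    thus "X \<noteq> 0 \<and> 1 / t \<noteq> 0" "X \<noteq> 0" using T by auto
    have "norm (t * X * q) < 1" "norm (t\<^sup>2 * q / X) < 1"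
      using X X0 by (auto simp: norm_mult norm_divide norm_power)
    thus "qpoch q (t * X * q) * qpoch q (t\<^sup>2 * q / X) \<noteq> 0"
      by (simp add: qpoch_nonzero_inside[OF q1])
  qed (use T in \<open>auto simp: mult_less_0_iff\<close>)
  have "circle_mean r (\<lambda>X. G X / (1 - X / (1 / t))) =
        circle_mean 1 (\<lambda>X. G X / (1 - X / (1 / t))) + G (1 / t)"
    by (rule circle_mean_pole[OF holo]) (use t r T in \<open>auto simp: norm_divide field_simps\<close>)
  moreover have "rho0_qpoch q t * G (1 / t) = rho_qpoch q t * f (1 / t) (1 / t)"
    unfolding G_def using zeta1_res_pole[OF q0 q1 T(3)] by (simp add: mult_ac)
  ultimately show ?thesis unfolding G_eq by (simp add: algebra_simps)
qed

text \<open>The poles \<open>1/t\<close> and \<open>1/(t Y)\<close> have the same modulus and are simple unless \<open>Y = 1\<close>,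
  which is a null set on the circle of \<open>Y\<close>.\<close>

lemma inner_poles_X:
  assumes t: "1 < norm t" "norm t * r < 1" "norm t * norm q < r" and r: "0 < r" "r < 1"
    and Y: "norm Y = 1" "Y \<noteq> 1"
  shows "circle_mean r (\<lambda>X. f X Y * mu q t X Y) =
         circle_mean 1 (\<lambda>X. f X Y * mu q t X Y) +
         rho0_qpoch q t * (f (1 / t) Y * zeta1_qpoch q t Y) +
         rho0_qpoch q t / t * (f (1 / (t * Y)) Y * zeta2_qpoch q t Y)"
proof -
  let ?T = "norm t" and ?Q = "norm q"
  let ?A = "{z. ?T * ?Q < norm z \<and> norm z < 1 / (?T * ?Q)}"
  define G where "G = (\<lambda>X. f X Y * mu_qpoch q t Y * mu_qpoch_res q t X * mu_qpoch_res q t (X * Y))"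
  have T: "0 < ?T" "0 < ?Q" "t \<noteq> 0" "Y \<noteq> 0" using t q0 Y by auto
  have TQ1: "?T * ?Q < 1" using t r by linarith
  have regY: "regular q t Y" using t Y TQ1 by (intro regular_outside q1) auto
  have ne: "1 - t * X \<noteq> 0" "1 - t * X * Y \<noteq> 0" if "norm X = r \<or> norm X = 1" for X :: complex
  proof -
    have "?T * norm X \<noteq> 1" using that t by auto
    hence "norm (t * X) \<noteq> 1" "norm (t * X * Y) \<noteq> 1" using Y by (auto simp: norm_mult)
    thus "1 - t * X \<noteq> 0" "1 - t * X * Y \<noteq> 0" by (metis eq_iff_diff_eq_0 norm_one)+
  qed
  have Y1: "1 - Y \<noteq> 0" "1 - 1 / Y \<noteq> 0" using Y T by auto
  \<comment> \<open>Poles of equal modulus cannot be separated by a circle, so partial fractions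
    split the two linear factors and each pole is crossed on its own. The condition on Y keeps the
    coefficients finite.\<close>
  have pf: "1 / (A * B) = (1 / (1 - Y)) / A + (1 / (1 - 1 / Y)) / B"
    if "A = 1 - t * X" "B = 1 - t * X * Y" "A \<noteq> 0" "B \<noteq> 0" for A B X :: complex
  proof -
    have 1: "1 / (1 - 1 / Y) = - Y / (1 - Y)" using Y1 T by (simp add: field_simps)
    have "(1 / (1 - Y)) / A + (1 / (1 - 1 / Y)) / B = (B - Y * A) / ((1 - Y) * (A * B))"
      unfolding 1 using that(3,4) Y1 by (simp add: divide_simps) (simp add: algebra_simps)?
    also have "B - Y * A = 1 - Y" unfolding that(1,2) by (simp add: algebra_simps)
    finally show ?thesis using Y1 by simp
  qed
  have G_eq: "f X Y * mu q t X Y = (1 / (1 - Y)) * (G X / (1 - X / (1 / t))) +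
                (1 / (1 - 1 / Y)) * (G X / (1 - X / (1 / (t * Y))))"
    if X: "norm X = r \<or> norm X = 1" for X :: complex
  proof -
    have "f X Y * mu q t X Y = G X * (1 / ((1 - t * X) * (1 - t * X * Y)))"
      unfolding G_def mu_def mu_factor_eq[OF q1] mu_qpoch_pole[OF q0 q1, of t X]
        mu_qpoch_pole[OF q0 q1, of t "X * Y"] by (simp add: mult_ac)
    also have "\<dots> = G X * ((1 / (1 - Y)) / (1 - t * X) + (1 / (1 - 1 / Y)) / (1 - t * X * Y))"
      by (subst pf[OF refl refl ne[OF X]]) (rule refl)
    finally show ?thesis by (simp add: distrib_left mult_ac)
  qed
  have holo: "G holomorphic_on ?A"
    unfolding G_def mu_qpoch_res_def
  proof (intro holomorphic_intros torus_holomorphic_compose[OF f] q1)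
    fix X :: complex assume "X \<in> ?A"
    hence X: "?T * ?Q < norm X" "?T * norm X * ?Q < 1" using T by (auto simp: field_simps)
    have "0 < ?T * ?Q" using T by simp
    hence X0: "X \<noteq> 0" using X by auto
    show "X \<noteq> 0 \<and> Y \<noteq> 0" "X \<noteq> 0" "X * Y \<noteq> 0" using T X0 by auto
    show "qpoch q (t * X * q) * qpoch q (t * q / X) \<noteq> 0"
      "qpoch q (t * (X * Y) * q) * qpoch q (t * q / (X * Y)) \<noteq> 0"
      using X X0 Y by (auto simp: norm_mult norm_divide intro!: qpoch_nonzero_inside[OF q1])
  qed (use T in \<open>auto simp: mult_less_0_iff\<close>)
  have rT: "r < 1 / ?T" and T1: "1 / ?T < 1" using t(1,2) T(1) by (simp_all add: field_simps)
  have T2: "1 < 1 / (?T * ?Q)" using TQ1 T(1,2) by (simp add: field_simps)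
  have p: "circle_mean r (\<lambda>X. G X / (1 - X / p)) = circle_mean 1 (\<lambda>X. G X / (1 - X / p)) + G p"
    if "norm p = 1 / ?T" for p :: complex
  proof (rule circle_mean_pole[OF holo])
    show "r < norm p" "norm p < 1" "(1::real) < 1 / (?T * ?Q)"
      unfolding that using rT T1 T2 by auto
  qed (use t r in auto)
  have split: "circle_mean s (\<lambda>X. f X Y * mu q t X Y) =
      (1 / (1 - Y)) * circle_mean s (\<lambda>X. G X / (1 - X / (1 / t))) +
      (1 / (1 - 1 / Y)) * circle_mean s (\<lambda>X. G X / (1 - X / (1 / (t * Y))))"
    if s: "s = r \<or> s = 1" for s
  proof -
    have s0: "s \<ge> 0" using s r by auto
    have "?T * ?Q < s" "s \<le> 1" using s t(3) r TQ1 by auto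
    hence "?T * ?Q < s" "s < 1 / (?T * ?Q)" using T2 by linarith+
    hence cG: "continuous_on (sphere 0 s) G"
      by (intro holomorphic_on_imp_continuous_on holomorphic_on_subset[OF holo]) auto
    have ne': "1 - X / (1 / t) \<noteq> 0" "1 - X / (1 / (t * Y)) \<noteq> 0" if "norm X = s" for X :: complex
      using ne[of X] that s by (auto simp: mult_ac)
    have "circle_mean s (\<lambda>X. f X Y * mu q t X Y) =
          circle_mean s (\<lambda>X. (1 / (1 - Y)) * (G X / (1 - X / (1 / t))) +
                (1 / (1 - 1 / Y)) * (G X / (1 - X / (1 / (t * Y)))))"
      by (intro circle_mean_cong G_eq s0) (use s in auto)
    also have "\<dots> = circle_mean s (\<lambda>X. (1 / (1 - Y)) * (G X / (1 - X / (1 / t)))) +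
                circle_mean s (\<lambda>X. (1 / (1 - 1 / Y)) * (G X / (1 - X / (1 / (t * Y)))))"
    proof (rule circle_mean_add[OF s0])
      have cont: "continuous_on (sphere 0 s) (\<lambda>X. c * (G X / (1 - X / p)))"
        if "\<And>X. norm X = s \<Longrightarrow> 1 - X / p \<noteq> 0" "p \<noteq> 0" for c p
        using that by (intro continuous_on_mult continuous_on_const continuous_on_divide cG
          continuous_on_diff continuous_on_id) auto
      show "continuous_on (sphere 0 s) (\<lambda>X. (1 / (1 - Y)) * (G X / (1 - X / (1 / t))))"
        by (rule cont) (use ne' T in auto)
      show "continuous_on (sphere 0 s) (\<lambda>X. (1 / (1 - 1 / Y)) * (G X / (1 - X / (1 / (t * Y)))))"
        by (rule cont) (use ne' T in auto)
    qed
    finally show ?thesis by (simp only: circle_mean_mult_right)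
  qed
  \<comment> \<open>The coefficient 1 / (1 - Y) is precisely the pole factor of
    \<open>mu_qpoch\<close> at X Y = Y / t, so it completes the reduced factor again. The other
    coefficient does the same for the factor of X = 1 / (t Y).\<close>
  have v1: "(1 / (1 - Y)) * G (1 / t) = rho0_qpoch q t * (f (1 / t) Y * zeta1_qpoch q t Y)"
  proof -
    have "norm (Y * q) < 1" using q1 Y by (simp add: norm_mult)
    hence "qpoch q Y \<noteq> 0" by (rule qpoch_nonzero_outside[OF q1 Y(2)])
    hence "mu_qpoch q t Y * mu_qpoch q t (Y / t) = zeta1_qpoch q t Y"
      using T regY by (intro mu_qpoch_mult_zeta1 q0 q1) (auto simp: regular_def)
    moreover have "mu_qpoch q t (Y / t) = mu_qpoch_res q t (1 / t * Y) / (1 - Y)"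
      using mu_qpoch_pole[OF q0 q1, of t "Y / t"] T by simp
    moreover have "(1 / (1 - Y)) * G (1 / t) =
        rho0_qpoch q t * (f (1 / t) Y * (mu_qpoch q t Y * (mu_qpoch_res q t (1 / t * Y) / (1 - Y))))"
      unfolding G_def mu_qpoch_res_pole[OF q0 q1 T(3)] by (simp add: mult_ac)
    ultimately show ?thesis by simp
  qed
  have v2: "(1 / (1 - 1 / Y)) * G (1 / (t * Y)) = rho0_qpoch q t / t * (f (1 / (t * Y)) Y * zeta2_qpoch q t Y)"
  proof -
    have tY: "t * Y \<noteq> 1" using Y t by (metis mult.right_neutral norm_mult norm_one less_irrefl)
    have "norm (q / Y) < 1" "norm (t * Y * q) < 1" using q1 Y TQ1 by (auto simp: norm_mult norm_divide)
    hence "qpoch q (q / Y) \<noteq> 0" "qpoch q (t * Y * q) \<noteq> 0" by (auto intro!: qpoch_nonzero_inside[OF q1])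
    hence "mu_qpoch q t Y * mu_qpoch q t (1 / (t * Y)) = zeta2_qpoch q t Y / t"
      using T Y tY by (intro mu_qpoch_mult_zeta2 q0 q1) auto
    moreover have "mu_qpoch q t (1 / (t * Y)) = mu_qpoch_res q t (1 / (t * Y)) / (1 - 1 / Y)"
      using mu_qpoch_pole[OF q0 q1, of t "1 / (t * Y)"] T by simp
    ultimately have "mu_qpoch q t Y * (mu_qpoch_res q t (1 / (t * Y)) / (1 - 1 / Y)) = zeta2_qpoch q t Y / t"
      by simp
    moreover have "(1 / (1 - 1 / Y)) * G (1 / (t * Y)) = rho0_qpoch q t *
        (f (1 / (t * Y)) Y * (mu_qpoch q t Y * (mu_qpoch_res q t (1 / (t * Y)) / (1 - 1 / Y))))"
    proof -
      have "1 / (t * Y) * Y = 1 / t" using T by simp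
      thus ?thesis unfolding G_def using mu_qpoch_res_pole[OF q0 q1 T(3)]
        by (simp only: divide_inverse mult_1_left mult_ac)
    qed
    ultimately show ?thesis by simp
  qed
  have "norm (1 / t) = 1 / ?T" "norm (1 / (t * Y)) = 1 / ?T" using Y by (auto simp: norm_divide norm_mult)
  from p[OF this(1)] p[OF this(2)] show ?thesis
    unfolding split[of r, OF disjI1[OF refl]] split[of 1, OF disjI2[OF refl]] v1[symmetric] v2[symmetric]
    by (simp only: distrib_left add_ac)
qed

text \<open>The two halves of \<open>zeta1_mean\<close> arise at different moments: the one with f X
  (1 / t) when Y crosses 1 / t, the one with f (1 / t) Y when X does. The former is still a mean
  over radius r, and bringing it to radius 1 produces the point term.\<close>

lemma ct_mean_expand:
  assumes t: "1 < norm t" "norm t * r < 1" "norm t * norm q < r\<^sup>2" "(norm t)\<^sup>2 * norm q < r"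
    and r: "0 < r" "r < 1"
  shows "ct_mean q f r r t = ct_mean q f 1 1 t + rho0_qpoch q t * zeta1_mean q f 1 t +
           rho0_qpoch q t / t * zeta2_mean q f 1 t + rho_qpoch q t * f (1 / t) (1 / t)"
proof -
  let ?T = "norm t" and ?Q = "norm q"
  let ?m = "\<lambda>X Y. f X Y * mu q t X Y"
  have r2: "r\<^sup>2 < r" using r by (simp add: power2_eq_square)
  have T: "0 < ?T" "0 < ?Q" "t \<noteq> 0" using t q0 by auto
  have TQ1: "?T * ?Q < r" "?T * ?Q < 1" using t r2 r by linarith+
  have reg_r: "regular q t X" if "norm X = r" for X :: complex
    using that t TQ1 by (intro regular_inside q1) auto
  have reg_1: "regular q t X" if "norm X = 1" for X :: complex
    using that t TQ1 by (intro regular_outside q1) auto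
  have cont_m: "continuous_on (sphere 0 s \<times> sphere 0 1) (\<lambda>(X, Y). ?m X Y)" if "s = r \<or> s = 1" for s
  proof -
    have "continuous_on (sphere 0 s \<times> sphere 0 1) (\<lambda>x. ?m (fst x) (snd x))"
      by (rule continuous_on_f_mu)
         (use that reg_r reg_1 in \<open>auto intro!: continuous_intros simp: norm_mult\<close>)
    thus ?thesis by (simp add: case_prod_unfold)
  qed
  have cont_z1: "continuous_on (sphere 0 s) (zeta1_qpoch q t)" if "s = r \<or> s = 1" for s
    unfolding zeta1_qpoch_def
  proof (intro continuous_intros q1 ballI)
    fix X :: complex assume "X \<in> sphere 0 s"
    hence X: "norm X = s" "X \<noteq> 0" using that r by auto
    have "(norm t)\<^sup>2 * norm q < s" using that t r by auto
    hence "norm (t\<^sup>2 * q / X) < 1"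
      using X that r by (auto simp: norm_mult norm_divide norm_power)
    moreover have "regular q t X" using X that reg_r reg_1 by auto
    ultimately show "qpoch q (t * X) * qpoch q (t\<^sup>2 * q / X) \<noteq> 0"
      by (simp add: regular_def qpoch_nonzero_inside[OF q1])
  qed (use that r T in auto)
  have cont_z2: "continuous_on (sphere 0 1) (zeta2_qpoch q t)"
    unfolding zeta2_qpoch_def
  proof (intro continuous_intros q1 ballI)
    fix X :: complex assume "X \<in> sphere 0 1"
    hence X: "norm X = 1" "X \<noteq> 0" by auto
    have "(norm t)\<^sup>2 * norm q < 1" using t r by auto
    hence "norm (t\<^sup>2 * X * q) < 1" using X by (simp add: norm_mult norm_power)
    moreover have "norm (t * q / X) < 1" using X TQ1 by (simp add: norm_mult norm_divide)
    ultimately show "qpoch q (t * q / X) * qpoch q (t\<^sup>2 * X * q) \<noteq> 0"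
      by (simp add: qpoch_nonzero_inside[OF q1])
  qed (use T in auto)
  have cont_f: "continuous_on (sphere 0 s) (\<lambda>X. f X (1 / t))" "continuous_on (sphere 0 s) (\<lambda>X. f (1 / t) X)"
      "continuous_on (sphere 0 s) (\<lambda>X. f (1 / (t * X)) X)" if "s > 0" for s
    using that T by (auto intro!: torus_continuous_compose[OF f] continuous_intros)
  have f1: "continuous_on (sphere 0 1) (\<lambda>Y. f (1 / t) Y * zeta1_qpoch q t Y)"
    "continuous_on (sphere 0 1) (\<lambda>Y. f Y (1 / t) * zeta1_qpoch q t Y)"
    "continuous_on (sphere 0 r) (\<lambda>Y. f Y (1 / t) * zeta1_qpoch q t Y)"
    "continuous_on (sphere 0 1) (\<lambda>Y. f (1 / (t * Y)) Y * zeta2_qpoch q t Y)"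
    by (intro continuous_on_mult cont_f cont_z1 cont_z2; use r in simp)+
  have "ct_mean q f r r t =
        circle_mean r (\<lambda>X. circle_mean 1 (?m X) + rho0_qpoch q t * (f X (1 / t) * zeta1_qpoch q t X))"
    unfolding ct_mean_def torus_mean_def
  proof (rule circle_mean_cong)
    fix X :: complex assume "norm X = r"
    from inner_pole_Y[OF t(1-3) r this] show "circle_mean r (?m X) =
        circle_mean 1 (?m X) + rho0_qpoch q t * (f X (1 / t) * zeta1_qpoch q t X)" by (simp add: mult_ac)
  qed (use r in auto)
  also have "\<dots> = circle_mean r (\<lambda>X. circle_mean 1 (?m X)) +
                  circle_mean r (\<lambda>X. rho0_qpoch q t * (f X (1 / t) * zeta1_qpoch q t X))"
    using r by (intro circle_mean_add continuous_on_circle_mean cont_m continuous_on_mult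
        continuous_on_const f1) auto
  also have "circle_mean r (\<lambda>X. rho0_qpoch q t * (f X (1 / t) * zeta1_qpoch q t X)) =
               rho0_qpoch q t * circle_mean r (\<lambda>X. f X (1 / t) * zeta1_qpoch q t X)"
    by (rule circle_mean_mult_right)
  also have "\<dots> = rho0_qpoch q t * circle_mean 1 (\<lambda>X. f X (1 / t) * zeta1_qpoch q t X) +
                    rho_qpoch q t * f (1 / t) (1 / t)"
    by (rule zeta1_pole_X[OF t(1,2) TQ1(2) t(4) r])
  \<comment> \<open>With Y already on the unit circle, the order is exchanged so that X can be moved
    for fixed Y.\<close>
  also have "circle_mean r (\<lambda>X. circle_mean 1 (?m X)) = circle_mean 1 (\<lambda>Y. circle_mean r (\<lambda>X. ?m X Y))"
    by (rule circle_mean_swap) (use r cont_m in auto)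
  also have "\<dots> = circle_mean 1 (\<lambda>Y. circle_mean 1 (\<lambda>X. ?m X Y) +
         rho0_qpoch q t * (f (1 / t) Y * zeta1_qpoch q t Y) +
         rho0_qpoch q t / t * (f (1 / (t * Y)) Y * zeta2_qpoch q t Y))"
    by (rule circle_mean_cong_except_1, rule inner_poles_X[OF t(1,2) TQ1(1) r])
  also have "\<dots> = circle_mean 1 (\<lambda>Y. circle_mean 1 (\<lambda>X. ?m X Y)) +
         circle_mean 1 (\<lambda>Y. rho0_qpoch q t * (f (1 / t) Y * zeta1_qpoch q t Y)) +
         circle_mean 1 (\<lambda>Y. rho0_qpoch q t / t * (f (1 / (t * Y)) Y * zeta2_qpoch q t Y))"
  proof -
    have "continuous_on (sphere 0 1 \<times> sphere 0 1) (\<lambda>x. ?m (snd x) (fst x))"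
      by (rule continuous_on_f_mu) (use reg_1 in \<open>auto intro!: continuous_intros simp: norm_mult\<close>)
    hence m: "continuous_on (sphere 0 1) (\<lambda>Y. circle_mean 1 (\<lambda>X. ?m X Y))"
      by (intro continuous_on_circle_mean) (auto simp: case_prod_unfold)
    note c1 = continuous_on_mult_left[OF f1(1), of "rho0_qpoch q t"]
    note c2 = continuous_on_mult_left[OF f1(4), of "rho0_qpoch q t / t"]
    show ?thesis
      by (simp only: circle_mean_add[OF zero_le_one continuous_on_add[OF m c1] c2]
            circle_mean_add[OF zero_le_one m c1])
  qed
  also have "circle_mean 1 (\<lambda>Y. circle_mean 1 (\<lambda>X. ?m X Y)) = ct_mean q f 1 1 t"
    unfolding ct_mean_def torus_mean_def by (rule circle_mean_swap[symmetric]) (use cont_m in auto)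
  also have "circle_mean 1 (\<lambda>Y. rho0_qpoch q t * (f (1 / t) Y * zeta1_qpoch q t Y)) =
               rho0_qpoch q t * circle_mean 1 (\<lambda>Y. f (1 / t) Y * zeta1_qpoch q t Y)"
    by (rule circle_mean_mult_right)
  also have "circle_mean 1 (\<lambda>Y. rho0_qpoch q t / t * (f (1 / (t * Y)) Y * zeta2_qpoch q t Y)) =
               rho0_qpoch q t / t * zeta2_mean q f 1 t"
    unfolding zeta2_mean_def by (rule circle_mean_mult_right)
  finally have "ct_mean q f r r t = ct_mean q f 1 1 t +
      rho0_qpoch q t * (circle_mean 1 (\<lambda>Y. f (1 / t) Y * zeta1_qpoch q t Y) +
                     circle_mean 1 (\<lambda>X. f X (1 / t) * zeta1_qpoch q t X)) +
      rho0_qpoch q t / t * zeta2_mean q f 1 t + rho_qpoch q t * f (1 / t) (1 / t)"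
    by (simp only: distrib_left add_ac)
  also have "circle_mean 1 (\<lambda>Y. f (1 / t) Y * zeta1_qpoch q t Y) +
             circle_mean 1 (\<lambda>X. f X (1 / t) * zeta1_qpoch q t X) = zeta1_mean q f 1 t"
    unfolding zeta1_mean_def distrib_right using f1 by (intro circle_mean_add[symmetric]) auto
  finally show ?thesis .
qed

text \<open>Only t^2 q lies between the radii s and 1: the poles 1 / t and t^2 q^2 are inside s, and
  1 / (t q) is outside the unit circle.\<close>

lemma zeta1_mean_cross:
  assumes t: "1 < norm t * s" "(norm t)\<^sup>2 * norm q < 1" "s < (norm t)\<^sup>2 * norm q"
      "norm t * norm q < 1" "(norm t)\<^sup>2 * (norm q)\<^sup>2 < s" and s: "0 < s" "s < 1"
  shows "rho0_qpoch q t * zeta1_mean q f 1 t = rho0_qpoch q t * zeta1_mean q f s t +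
           rho_qpoch q t * (f (t\<^sup>2 * q) (1 / t) + f (1 / t) (t\<^sup>2 * q))"
proof -
  let ?T = "norm t" and ?Q = "norm q"
  let ?A = "{z. max (1 / ?T) (?T\<^sup>2 * ?Q\<^sup>2) < norm z \<and> norm z < 1 / (?T * ?Q)}"
  define G where "G = (\<lambda>Y. (f (1 / t) Y + f Y (1 / t)) * zeta1_res' q t Y)"
  have "0 < ?T * s" using t by linarith
  hence T: "0 < ?T" "0 < ?Q" "t \<noteq> 0" using s q0 by (auto simp: zero_less_mult_iff)
  have G_eq: "(f (1 / t) Y + f Y (1 / t)) * zeta1_qpoch q t Y = G Y / (1 - (t\<^sup>2 * q) / Y)" for Y
    unfolding G_def zeta1_pole'[OF q0 q1] by simp
  have holo: "G holomorphic_on ?A"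
    unfolding G_def zeta1_res'_def
  proof (intro holomorphic_intros torus_holomorphic_compose[OF f] q1)
    fix Y :: complex assume "Y \<in> ?A"
    hence Y: "1 < ?T * norm Y" "?T\<^sup>2 * ?Q\<^sup>2 < norm Y" "?T * norm Y * ?Q < 1" "1 / ?T < norm Y"
      using T by (auto simp: field_simps)
    have "0 < 1 / ?T" using T by simp
    hence Y0: "Y \<noteq> 0" using Y by auto
    thus "1 / t \<noteq> 0 \<and> Y \<noteq> 0" "Y \<noteq> 0 \<and> 1 / t \<noteq> 0" "Y \<noteq> 0" using T by auto
    have "t * Y \<noteq> 1" using Y by (metis norm_mult norm_one less_irrefl)
    hence "qpoch q (t * Y) \<noteq> 0"
      by (rule qpoch_nonzero_outside[OF q1]) (use Y in \<open>simp add: norm_mult\<close>)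
    moreover have "norm (t\<^sup>2 * q\<^sup>2 / Y) < 1"
      using Y Y0 by (simp add: norm_mult norm_divide norm_power)
    ultimately show "qpoch q (t * Y) * qpoch q (t\<^sup>2 * q\<^sup>2 / Y) \<noteq> 0"
      by (simp add: qpoch_nonzero_inside[OF q1])
  qed (use T in \<open>auto simp: mult_less_0_iff\<close>)
  have "circle_mean 1 (\<lambda>Y. G Y / (1 - (t\<^sup>2 * q) / Y)) =
        circle_mean s (\<lambda>Y. G Y / (1 - (t\<^sup>2 * q) / Y)) + G (t\<^sup>2 * q)"
  proof (rule circle_mean_pole'[OF holo])
    show "max (1 / ?T) (?T\<^sup>2 * ?Q\<^sup>2) < s" "1 < 1 / (?T * ?Q)"
      using t s T by (auto simp: field_simps)
    show "s < norm (t\<^sup>2 * q)" "norm (t\<^sup>2 * q) < 1" using t by (auto simp: norm_mult norm_power)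
  qed (use s in auto)
  moreover have "rho0_qpoch q t * G (t\<^sup>2 * q) = rho_qpoch q t * (f (t\<^sup>2 * q) (1 / t) + f (1 / t) (t\<^sup>2 * q))"
    unfolding G_def zeta1_res'_pole[OF q0 q1 T(3), symmetric] by (simp add: algebra_simps)
  ultimately show ?thesis
    unfolding zeta1_mean_def G_eq by (simp add: distrib_left)
qed

text \<open>As long as |t^2 q| < 1 the pole 1 / (t^2 q) is outside the unit circle, so nothing is
  crossed.\<close>

lemma zeta2_mean_shift:
  assumes t: "(norm t)\<^sup>2 * norm q < 1" "norm t * norm q < s" "t \<noteq> 0" and s: "0 < s" "s < 1"
  shows "zeta2_mean q f 1 t = zeta2_mean q f s t"
proof -
  let ?T = "norm t" and ?Q = "norm q"
  let ?A = "{z. ?T * ?Q < norm z \<and> norm z < 1 / (?T\<^sup>2 * ?Q)}"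
  have T: "0 < ?T" "0 < ?Q" using t q0 by auto
  have "(\<lambda>Y. f (1 / (t * Y)) Y * zeta2_qpoch q t Y) holomorphic_on ?A"
    unfolding zeta2_qpoch_def
  proof (intro holomorphic_intros torus_holomorphic_compose[OF f] q1)
    fix Y :: complex assume "Y \<in> ?A"
    hence Y: "?T * ?Q < norm Y" "?T\<^sup>2 * norm Y * ?Q < 1" using T by (auto simp: field_simps)
    have "0 < ?T * ?Q" using T by simp
    hence Y0: "Y \<noteq> 0" using Y by auto
    thus "1 / (t * Y) \<noteq> 0 \<and> Y \<noteq> 0" "Y \<noteq> 0" "t * Y \<noteq> 0" using t by auto
    have "norm (t * q / Y) < 1" "norm (t\<^sup>2 * Y * q) < 1"
      using Y Y0 by (auto simp: norm_mult norm_divide norm_power)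
    thus "qpoch q (t * q / Y) * qpoch q (t\<^sup>2 * Y * q) \<noteq> 0"
      by (simp add: qpoch_nonzero_inside[OF q1])
  qed (use T in \<open>auto simp: mult_less_0_iff\<close>)
  thus ?thesis unfolding zeta2_mean_def
  proof (rule circle_mean_annulus)
    show "1 < 1 / (?T\<^sup>2 * ?Q)" using t T by (simp add: field_simps)
    thus "s < 1 / (?T\<^sup>2 * ?Q)" using s by linarith
  qed (use t s in auto)
qed

text \<open>Now t^2 q has left the unit disc while t^2 q^2 is still inside s, so the return to
  radius 1 crosses nothing.\<close>

lemma zeta1_mean_shift:
  assumes t: "1 < norm t * s" "1 < (norm t)\<^sup>2 * norm q"
      "norm t * norm q < 1" "(norm t)\<^sup>2 * (norm q)\<^sup>2 < s" and s: "0 < s" "s < 1"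
  shows "zeta1_mean q f s t = zeta1_mean q f 1 t"
proof -
  let ?T = "norm t" and ?Q = "norm q"
  let ?A = "{z. max (1 / ?T) (?T\<^sup>2 * ?Q\<^sup>2) < norm z \<and> norm z < min (1 / (?T * ?Q)) (?T\<^sup>2 * ?Q)}"
  have "0 < ?T * s" using t by linarith
  hence T: "0 < ?T" "0 < ?Q" "t \<noteq> 0" using s q0 by (auto simp: zero_less_mult_iff)
  have "(\<lambda>Y. (f (1 / t) Y + f Y (1 / t)) * zeta1_qpoch q t Y) holomorphic_on ?A"
    unfolding zeta1_qpoch_def
  proof (intro holomorphic_intros torus_holomorphic_compose[OF f] q1)
    fix Y :: complex assume "Y \<in> ?A"
    hence Y: "1 < ?T * norm Y" "?T\<^sup>2 * ?Q\<^sup>2 < norm Y" "?T * norm Y * ?Q < 1" "1 / ?T < norm Y"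
      "norm Y < ?T\<^sup>2 * ?Q"
      using T by (auto simp: field_simps)
    have "0 < 1 / ?T" using T by simp
    hence Y0: "Y \<noteq> 0" using Y by auto
    thus "1 / t \<noteq> 0 \<and> Y \<noteq> 0" "Y \<noteq> 0 \<and> 1 / t \<noteq> 0" "Y \<noteq> 0" using T by auto
    have "t * Y \<noteq> 1" using Y by (metis norm_mult norm_one less_irrefl)
    hence "qpoch q (t * Y) \<noteq> 0"
      by (rule qpoch_nonzero_outside[OF q1]) (use Y in \<open>simp add: norm_mult\<close>)
    moreover have "qpoch q (t\<^sup>2 * q / Y) \<noteq> 0"
    proof (rule qpoch_nonzero_outside[OF q1])
      have "norm (t\<^sup>2 * q / Y) > 1" using Y Y0 by (simp add: norm_mult norm_divide norm_power)
      thus "t\<^sup>2 * q / Y \<noteq> 1" by auto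
      show "norm (t\<^sup>2 * q / Y * q) < 1"
        using Y Y0 by (simp add: norm_mult norm_divide norm_power power2_eq_square mult_ac)
    qed
    ultimately show "qpoch q (t * Y) * qpoch q (t\<^sup>2 * q / Y) \<noteq> 0" by simp
  qed (use T in \<open>auto simp: mult_less_0_iff\<close>)
  thus ?thesis unfolding zeta1_mean_def
  proof (rule circle_mean_annulus)
    show "max (1 / ?T) (?T\<^sup>2 * ?Q\<^sup>2) < s" using t s T by (auto simp: field_simps)
    thus "max (1 / ?T) (?T\<^sup>2 * ?Q\<^sup>2) < 1" using s by linarith
    show "1 < min (1 / (?T * ?Q)) (?T\<^sup>2 * ?Q)" using t T by (auto simp: field_simps)
    thus "s < min (1 / (?T * ?Q)) (?T\<^sup>2 * ?Q)" using s by linarith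
  qed (use s in auto)
qed

text \<open>Now p = 1 / (t^2 q) has entered the unit disc but not yet the disc of radius s. At Y = p
  the first argument 1 / (t Y) of f is t q, which gives the evaluation point of the varpi1
  term.\<close>

lemma zeta2_mean_cross:
  assumes t: "1 < (norm t)\<^sup>2 * norm q" "(norm t)\<^sup>2 * norm q * s < 1" "norm t * norm q < s"
      "(norm t)\<^sup>2 * (norm q)\<^sup>2 < 1" "1 < norm t" and s: "0 < s" "s < 1"
  shows "rho0_qpoch q t / t * zeta2_mean q f s t = rho0_qpoch q t / t * zeta2_mean q f 1 t +
           rho_qpoch q t * (varpi1 q t * f (t * q) (1 / (t\<^sup>2 * q)))"
proof -
  let ?T = "norm t" and ?Q = "norm q"
  let ?A = "{z. ?T * ?Q < norm z \<and> norm z < 1 / (?T\<^sup>2 * ?Q\<^sup>2)}"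
  define p where "p = 1 / (t\<^sup>2 * q)"
  define G where "G = (\<lambda>Y. f (1 / (t * Y)) Y * zeta2_res q t Y)"
  have T: "0 < ?T" "0 < ?Q" "t \<noteq> 0" using t q0 by auto
  have G_eq: "f (1 / (t * Y)) Y * zeta2_qpoch q t Y = G Y / (1 - Y / p)" for Y
    unfolding G_def zeta2_pole[OF q0 q1] p_def by (simp add: mult_ac)
  have holo: "G holomorphic_on ?A"
    unfolding G_def zeta2_res_def
  proof (intro holomorphic_intros torus_holomorphic_compose[OF f] q1)
    fix Y :: complex assume "Y \<in> ?A"
    hence Y: "?T * ?Q < norm Y" "?T\<^sup>2 * norm Y * ?Q\<^sup>2 < 1" using T by (auto simp: field_simps)
    have "0 < ?T * ?Q" using T by simp
    hence Y0: "Y \<noteq> 0" using Y by auto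
    thus "1 / (t * Y) \<noteq> 0 \<and> Y \<noteq> 0" "Y \<noteq> 0" "t * Y \<noteq> 0" using T by auto
    have "norm (t * q / Y) < 1" "norm (t\<^sup>2 * Y * q\<^sup>2) < 1"
      using Y Y0 by (auto simp: norm_mult norm_divide norm_power)
    thus "qpoch q (t * q / Y) * qpoch q (t\<^sup>2 * Y * q\<^sup>2) \<noteq> 0"
      by (simp add: qpoch_nonzero_inside[OF q1])
  qed (use T in \<open>auto simp: mult_less_0_iff\<close>)
  have np: "norm p = 1 / (?T\<^sup>2 * ?Q)" by (simp add: p_def norm_divide norm_mult norm_power)
  have "circle_mean s (\<lambda>Y. G Y / (1 - Y / p)) = circle_mean 1 (\<lambda>Y. G Y / (1 - Y / p)) + G p"
  proof (rule circle_mean_pole[OF holo])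
    show "s < norm p" "norm p < 1" unfolding np using t s T by (auto simp: field_simps)
    show "1 < 1 / (?T\<^sup>2 * ?Q\<^sup>2)" using t T by (simp add: field_simps)
  qed (use t s in auto)
  moreover have "rho0_qpoch q t / t * G p = rho_qpoch q t * (varpi1 q t * f (t * q) (1 / (t\<^sup>2 * q)))"
  proof -
    have "norm (t * q) < 1" using t s by (simp add: norm_mult)
    hence "t * q \<noteq> 1" by auto
    moreover have "t ^ 3 * q \<noteq> 1"
    proof -
      have "1 * 1 < ?T * (?T\<^sup>2 * ?Q)" using t by (intro mult_strict_mono) auto
      hence "norm (t ^ 3 * q) > 1"
        by (simp add: norm_mult norm_power power2_eq_square power3_eq_cube mult.assoc)
      thus ?thesis by auto
    qed
    ultimately have "rho0_qpoch q t / t * zeta2_res q t p = rho_qpoch q t * varpi1 q t"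
      unfolding p_def by (intro zeta2_res_pole q0 q1 T)
    moreover have "1 / (t * p) = t * q" unfolding p_def using T q0 by (simp add: power2_eq_square)
    hence "rho0_qpoch q t / t * G p = (rho0_qpoch q t / t * zeta2_res q t p) * f (t * q) p"
      by (simp add: G_def)
    ultimately show ?thesis unfolding p_def[symmetric] by (simp only: mult.assoc)
  qed
  ultimately show ?thesis
    unfolding zeta2_mean_def G_eq by (simp only: distrib_left)
qed

section \<open>Holomorphic dependence of the line means on t\<close>

lemma zeta1_mean_holomorphic:
  assumes s: "s > 0" and U: "open U"
    and nz: "\<And>t Y. t \<in> U \<Longrightarrow> norm Y = s \<Longrightarrow> t \<noteq> 0 \<and> qpoch q (t * Y) \<noteq> 0 \<and> qpoch q (t\<^sup>2 * q / Y) \<noteq> 0"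
  shows "zeta1_mean q f s holomorphic_on U"
proof -
  have "(\<lambda>t. circle_mean s (\<lambda>Y. (f (1 / t) Y + f Y (1 / t)) * zeta1_qpoch q t Y)) holomorphic_on U"
  proof (rule circle_mean_holomorphic[OF _ U])
    have "continuous_on (U \<times> sphere 0 s) (\<lambda>x. (f (1 / fst x) (snd x) + f (snd x) (1 / fst x)) *
            ((qpoch q (q / snd x) * qpoch q (snd x / fst x)) / (qpoch q (fst x * snd x) * qpoch q ((fst x)\<^sup>2 * q / snd x))))"
      using nz s by (intro continuous_intros torus_continuous_compose[OF f] q1) auto
    thus "continuous_on (U \<times> sphere 0 s) (\<lambda>(t, Y). (f (1 / t) Y + f Y (1 / t)) * zeta1_qpoch q t Y)"
      by (simp add: case_prod_unfold zeta1_qpoch_def)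
    show "(\<lambda>t. (f (1 / t) Y + f Y (1 / t)) * zeta1_qpoch q t Y) holomorphic_on U" if "norm Y = s" for Y
      unfolding zeta1_qpoch_def using nz s that
      by (intro holomorphic_intros torus_holomorphic_compose[OF f] q1) auto
  qed (use s in auto)
  thus ?thesis by (simp add: zeta1_mean_def[abs_def])
qed

lemma zeta2_mean_holomorphic:
  assumes s: "s > 0" and U: "open U"
    and nz: "\<And>t Y. t \<in> U \<Longrightarrow> norm Y = s \<Longrightarrow> t \<noteq> 0 \<and> qpoch q (t * q / Y) \<noteq> 0 \<and> qpoch q (t\<^sup>2 * Y * q) \<noteq> 0"
  shows "zeta2_mean q f s holomorphic_on U"
proof -
  have "(\<lambda>t. circle_mean s (\<lambda>Y. f (1 / (t * Y)) Y * zeta2_qpoch q t Y)) holomorphic_on U"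
  proof (rule circle_mean_holomorphic[OF _ U])
    have "continuous_on (U \<times> sphere 0 s) (\<lambda>x. f (1 / (fst x * snd x)) (snd x) *
            ((qpoch q (snd x * q) * qpoch q (q / (fst x * snd x))) /
             (qpoch q (fst x * q / snd x) * qpoch q ((fst x)\<^sup>2 * snd x * q))))"
      using nz s by (intro continuous_intros torus_continuous_compose[OF f] q1) auto
    thus "continuous_on (U \<times> sphere 0 s) (\<lambda>(t, Y). f (1 / (t * Y)) Y * zeta2_qpoch q t Y)"
      by (simp add: case_prod_unfold zeta2_qpoch_def)
    show "(\<lambda>t. f (1 / (t * Y)) Y * zeta2_qpoch q t Y) holomorphic_on U" if "norm Y = s" for Y
      unfolding zeta2_qpoch_def using nz s that
      by (intro holomorphic_intros torus_holomorphic_compose[OF f] q1) auto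
  qed (use s in auto)
  thus ?thesis by (simp add: zeta2_mean_def[abs_def])
qed

end

subsection \<open>Meromorphic continuation\<close>

text \<open>At a pole both sides are 0, by convention; elsewhere the value is the limit.\<close>

lemma nicely_meromorphic_on_remove_sings:
  assumes "F nicely_meromorphic_on A" "z \<in> A"
  shows "remove_sings F z = F z"
proof -
  have "(is_pole F z \<and> F z = 0) \<or> F \<midarrow>z\<rightarrow> F z"
    using assms by (auto simp: nicely_meromorphic_on_def)
  thus ?thesis by (auto intro: remove_sings_eqI)
qed

text \<open>The difference is zero either nearly everywhere or nearly nowhere, and it is zero on an
  open set. Agreement near k gives agreement at k, since a nicely meromorphic function is determined
  at a point by its values nearby.\<close>

lemma nicely_meromorphic_on_unique:
  assumes F: "F nicely_meromorphic_on A" and G: "G nicely_meromorphic_on A"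
    and A: "open A" "connected A" and B: "open B" "B \<subseteq> A" "B \<noteq> {}"
    and eq: "\<And>z. z \<in> B \<Longrightarrow> F z = G z" and k: "k \<in> A"
  shows "F k = G k"
proof -
  obtain b where b: "b \<in> B" using B by blast
  have "(\<lambda>z. F z - G z) meromorphic_on A"
    using F G by (auto simp: nicely_meromorphic_on_def intro: meromorphic_on_diff)
  from meromorphic_imp_constant_or_avoid[OF this A, of 0]
  have "eventually (\<lambda>z. F z - G z = 0) (cosparse A)"
  proof
    assume "eventually (\<lambda>z. F z - G z \<noteq> 0) (cosparse A)"
    hence "eventually (\<lambda>z. F z - G z \<noteq> 0) (at b)"
      by (rule eventually_cosparse_imp_eventually_at) (use b B in auto)
    moreover have "eventually (\<lambda>z. z \<in> B) (at b)"
      using B(1) b by (rule eventually_at_in_open')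
    ultimately have "eventually (\<lambda>z. False) (at b)"
      by eventually_elim (use eq in auto)
    thus ?thesis by simp
  qed
  hence "eventually (\<lambda>z. F z - G z = 0) (at k)"
    by (rule eventually_cosparse_imp_eventually_at) (use k in auto)
  hence "eventually (\<lambda>z. F z = G z) (at k)" by simp
  hence "remove_sings F k = remove_sings G k" by (rule remove_sings_cong) simp
  thus ?thesis using nicely_meromorphic_on_remove_sings[OF F k] nicely_meromorphic_on_remove_sings[OF G k]
    by simp
qed

lemma continuation_eqI:
  assumes F: "F nicely_meromorphic_on {z. r < Re z}" "r \<le> 0" "r < Re k"
    and eq: "\<And>z. 0 < Re z \<Longrightarrow> F z = g z"
  shows "continuation g k = F k"
  unfolding continuation_def
proof (rule the_equality)
  show "\<exists>r' F'. r' \<le> 0 \<and> r' < Re k \<and> F' nicely_meromorphic_on {z. r' < Re z} \<and>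
          (\<forall>z. 0 < Re z \<longrightarrow> F' z = g z) \<and> F' k = F k"
    using assms by blast
next
  fix w assume "\<exists>r' F'. r' \<le> 0 \<and> r' < Re k \<and> F' nicely_meromorphic_on {z. r' < Re z} \<and>
          (\<forall>z. 0 < Re z \<longrightarrow> F' z = g z) \<and> F' k = w"
  then obtain r' F' where F': "r' \<le> 0" "r' < Re k" "F' nicely_meromorphic_on {z. r' < Re z}"
      "\<And>z. 0 < Re z \<Longrightarrow> F' z = g z" "F' k = w" by blast
  let ?A = "{z. max r r' < Re z}"
  have "F' k = F k"
  proof (rule nicely_meromorphic_on_unique[where F = F' and G = F and A = ?A and B = "{z. 0 < Re z}"])
    show "F' nicely_meromorphic_on ?A" "F nicely_meromorphic_on ?A"
      using F(1) F'(3) by (auto elim!: nicely_meromorphic_on_subset)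
    show "open ?A" by (rule open_halfspace_Re_gt)
    show "connected ?A" by (intro convex_connected convex_halfspace_Re_gt)
    show "open {z. 0 < Re z}" by (rule open_halfspace_Re_gt)
    have "(1 :: complex) \<in> {z. 0 < Re z}" by simp
    thus "{z. 0 < Re z} \<noteq> {}" by blast
  qed (use F F' eq in auto)
  thus "w = F k" using F' by simp
qed

text \<open>This is \<open>q^x\<close> for real \<open>x\<close>, as \<open>q = exp (-1/a)\<close>.\<close>

definition rpow :: "real \<Rightarrow> real \<Rightarrow> real" where
  "rpow a x = exp (- x / a)"

lemma rpow_pos [simp]: "rpow a x > 0"
  by (simp add: rpow_def)

lemma rpow_mult: "rpow a x * rpow a y = rpow a (x + y)"
  by (simp add: rpow_def exp_add[symmetric] diff_divide_distrib)

lemma rpow_power2: "(rpow a x)\<^sup>2 = rpow a (2 * x)"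
  by (simp add: power2_eq_square rpow_mult)

lemma rpow_less_iff: "a > 0 \<Longrightarrow> rpow a x < rpow a y \<longleftrightarrow> y < x"
  by (simp add: rpow_def divide_less_cancel)

lemma rpow_less_1_iff: "a > 0 \<Longrightarrow> rpow a x < 1 \<longleftrightarrow> 0 < x"
  by (simp add: rpow_def zero_less_divide_iff)

lemma one_less_rpow_iff: "a > 0 \<Longrightarrow> 1 < rpow a x \<longleftrightarrow> x < 0"
  by (simp add: rpow_def divide_less_0_iff)

lemma norm_t_of_rpow: "norm (t_of a k) = rpow a (Re k)"
  by (simp add: norm_t_of rpow_def)

lemma norm_q_of_rpow: "norm (q_of a) = rpow a 1"
  by (simp add: norm_q_of rpow_def)

text \<open>All moduli that occur are products of powers of |t|, |q| and |q|^\<epsilon>, so these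
  rules turn the conditions on poles and radii into linear inequalities in Re k and
  \<epsilon>.\<close>

lemmas rpow_simps = norm_t_of_rpow norm_q_of_rpow rpow_mult rpow_power2 rpow_less_iff
  rpow_less_1_iff one_less_rpow_iff

section \<open>Dependence of the terms on k\<close>

lemma t_of_holomorphic [holomorphic_intros]: "t_of a holomorphic_on S"
proof -
  have "t_of a = (\<lambda>k. exp (of_real (- 1 / a) * k))" by (simp add: t_of_eq_exp fun_eq_iff)
  thus ?thesis by (auto intro!: holomorphic_intros)
qed

lemma t_of_nonzero [simp]: "t_of a k \<noteq> 0"
  by (simp add: t_of_eq_exp)

text \<open>For these t no pole lies on |Y| = s. The pole 1 / t is inside and 1 / (t q) outside; the
  two alternatives are t^2 q inside, or t^2 q outside with t^2 q^2 inside. A mean is holomorphic on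
  each side of the crossing, but its values on the two sides are not continuations of each
  other.\<close>

definition zeta1_domain :: "complex \<Rightarrow> real \<Rightarrow> complex set" where
  "zeta1_domain q s = {t. 1 < norm t * s \<and> norm t * s * norm q < 1 \<and>
     ((norm t)\<^sup>2 * norm q < s \<or> s < (norm t)\<^sup>2 * norm q \<and> (norm t)\<^sup>2 * (norm q)\<^sup>2 < s)}"

text \<open>Likewise t q is inside, and either 1 / (t^2 q) is outside or it is inside with 1 / (t^2
  q^2) outside.\<close>

definition zeta2_domain :: "complex \<Rightarrow> real \<Rightarrow> complex set" where
  "zeta2_domain q s = {t. t \<noteq> 0 \<and> norm t * norm q < s \<and>
     ((norm t)\<^sup>2 * norm q * s < 1 \<or> 1 < (norm t)\<^sup>2 * norm q * s \<and> (norm t)\<^sup>2 * (norm q)\<^sup>2 * s < 1)}"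

lemma open_zeta_domains: "open (zeta1_domain q s)" "open (zeta2_domain q s)"
  unfolding zeta1_domain_def zeta2_domain_def
  by (intro open_Collect_conj open_Collect_disj open_Collect_less open_Collect_neq continuous_intros)+

context
  fixes a :: real and f :: "complex \<Rightarrow> complex \<Rightarrow> complex"
  assumes a: "a > 0" and f: "torus_holomorphic f"
begin

lemma q_of_nonzero: "q_of a \<noteq> 0"
  by (simp add: q_of_def)

lemma norm_q_of_less_1: "norm (q_of a) < 1"
  using a by (simp add: norm_q_of)

lemma zeta1_mean_holomorphic_domain:
  assumes s: "s > 0"
  shows "zeta1_mean (q_of a) f s holomorphic_on zeta1_domain (q_of a) s"
proof (rule zeta1_mean_holomorphic[OF q_of_nonzero norm_q_of_less_1 f s open_zeta_domains(1)])
  fix t Y :: complex assume "t \<in> zeta1_domain (q_of a) s" and Y: "norm Y = s"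
  hence t: "1 < norm t * s" "norm t * s * norm (q_of a) < 1"
     "(norm t)\<^sup>2 * norm (q_of a) < s \<or> s < (norm t)\<^sup>2 * norm (q_of a) \<and> (norm t)\<^sup>2 * (norm (q_of a))\<^sup>2 < s"
    by (auto simp: zeta1_domain_def)
  have Y0: "Y \<noteq> 0" using Y s by auto
  have "t * Y \<noteq> 1" using t(1) Y by (metis norm_mult norm_one less_irrefl)
  hence "qpoch (q_of a) (t * Y) \<noteq> 0"
    by (rule qpoch_nonzero_outside[OF norm_q_of_less_1]) (use t Y in \<open>simp add: norm_mult\<close>)
  moreover have "qpoch (q_of a) (t\<^sup>2 * q_of a / Y) \<noteq> 0"
    using t(3)
  proof
    assume "(norm t)\<^sup>2 * norm (q_of a) < s"
    thus ?thesis using Y s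
      by (intro qpoch_nonzero_inside[OF norm_q_of_less_1]) (auto simp: norm_mult norm_divide norm_power)
  next
    assume *: "s < (norm t)\<^sup>2 * norm (q_of a) \<and> (norm t)\<^sup>2 * (norm (q_of a))\<^sup>2 < s"
    hence "norm (t\<^sup>2 * q_of a / Y) > 1" "norm (t\<^sup>2 * q_of a / Y * q_of a) < 1"
      using Y s by (auto simp: norm_mult norm_divide norm_power power2_eq_square mult_ac)
    thus ?thesis by (intro qpoch_nonzero_outside[OF norm_q_of_less_1]) auto
  qed
  moreover have "t \<noteq> 0" using t(1) by auto
  ultimately show "t \<noteq> 0 \<and> qpoch (q_of a) (t * Y) \<noteq> 0 \<and> qpoch (q_of a) (t\<^sup>2 * q_of a / Y) \<noteq> 0" by simp
qed

lemma zeta2_mean_holomorphic_domain: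
  assumes s: "s > 0"
  shows "zeta2_mean (q_of a) f s holomorphic_on zeta2_domain (q_of a) s"
proof (rule zeta2_mean_holomorphic[OF q_of_nonzero norm_q_of_less_1 f s open_zeta_domains(2)])
  fix t Y :: complex assume "t \<in> zeta2_domain (q_of a) s" and Y: "norm Y = s"
  hence t: "t \<noteq> 0" "norm t * norm (q_of a) < s"
     "(norm t)\<^sup>2 * norm (q_of a) * s < 1 \<or> 1 < (norm t)\<^sup>2 * norm (q_of a) * s \<and> (norm t)\<^sup>2 * (norm (q_of a))\<^sup>2 * s < 1"
    by (auto simp: zeta2_domain_def)
  have "qpoch (q_of a) (t * q_of a / Y) \<noteq> 0"
    using t Y s by (intro qpoch_nonzero_inside[OF norm_q_of_less_1]) (auto simp: norm_mult norm_divide)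
  moreover have "qpoch (q_of a) (t\<^sup>2 * Y * q_of a) \<noteq> 0"
    using t(3)
  proof
    assume "(norm t)\<^sup>2 * norm (q_of a) * s < 1"
    thus ?thesis using Y
      by (intro qpoch_nonzero_inside[OF norm_q_of_less_1]) (simp add: norm_mult norm_power mult_ac)
  next
    assume *: "1 < (norm t)\<^sup>2 * norm (q_of a) * s \<and> (norm t)\<^sup>2 * (norm (q_of a))\<^sup>2 * s < 1"
    hence "norm (t\<^sup>2 * Y * q_of a) > 1" "norm (t\<^sup>2 * Y * q_of a * q_of a) < 1"
      using Y by (simp_all add: norm_mult norm_power power2_eq_square mult_ac)
    thus ?thesis by (intro qpoch_nonzero_outside[OF norm_q_of_less_1]) auto
  qed
  ultimately show "t \<noteq> 0 \<and> qpoch (q_of a) (t * q_of a / Y) \<noteq> 0 \<and> qpoch (q_of a) (t\<^sup>2 * Y * q_of a) \<noteq> 0" using t by simp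
qed

lemma zeta_means_t_of_holomorphic:
  assumes "s > 0" "\<And>z. z \<in> U \<Longrightarrow> t_of a z \<in> zeta1_domain (q_of a) s \<inter> zeta2_domain (q_of a) s"
  shows "(\<lambda>z. zeta1_mean (q_of a) f s (t_of a z)) holomorphic_on U"
        "(\<lambda>z. zeta2_mean (q_of a) f s (t_of a z)) holomorphic_on U"
  using holomorphic_on_compose_gen[OF t_of_holomorphic zeta1_mean_holomorphic_domain[OF assms(1)], of a U]
    holomorphic_on_compose_gen[OF t_of_holomorphic zeta2_mean_holomorphic_domain[OF assms(1)], of a U] assms(2)
  by (auto simp: o_def image_subset_iff)

lemma ct_mean_outer_holomorphic:
  "(\<lambda>z. ct_mean (q_of a) f 1 1 (t_of a z)) holomorphic_on {z. -1 < Re z \<and> Re z < 0}"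
proof -
  let ?V = "{t. 1 < norm t \<and> norm t * norm (q_of a) < 1}"
  have "ct_mean (q_of a) f 1 1 holomorphic_on ?V"
  proof (rule ct_mean_holomorphic[OF q_of_nonzero norm_q_of_less_1 f])
    show "open ?V" by (intro open_Collect_conj open_Collect_less continuous_intros)
    show "regular (q_of a) t X \<and> regular (q_of a) t Y \<and> regular (q_of a) t (X * Y)"
      if "t \<in> ?V" "norm X = 1" "norm Y = 1" for t X Y
      using that by (intro conjI regular_outside norm_q_of_less_1) (auto simp: norm_mult)
  qed auto
  moreover have "t_of a ` {z. -1 < Re z \<and> Re z < 0} \<subseteq> ?V" using a by (auto simp: rpow_simps)
  ultimately show ?thesis
    using holomorphic_on_compose_gen[OF t_of_holomorphic] by (fastforce simp: o_def)
qed

lemma ct_mean_inner_holomorphic: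
  "(\<lambda>z. ct_mean (q_of a) f (rpow a (1 / 3)) (rpow a (1 / 3)) (t_of a z)) holomorphic_on {z. -1 / 3 < Re z}"
proof -
  define r where "r = rpow a (1 / 3)"
  have r: "0 < r" "r < 1" using a by (auto simp: r_def rpow_simps)
  have r2: "r\<^sup>2 < r" using r by (simp add: power2_eq_square)
  let ?V = "{t. norm t * r < 1 \<and> norm t * norm (q_of a) < r\<^sup>2}"
  have "ct_mean (q_of a) f r r holomorphic_on ?V"
  proof (rule ct_mean_holomorphic[OF q_of_nonzero norm_q_of_less_1 f])
    show "open ?V" by (intro open_Collect_conj open_Collect_less continuous_intros)
    fix t X Y :: complex assume t: "t \<in> ?V" and XY: "norm X = r" "norm Y = r"
    have "norm t * r\<^sup>2 \<le> norm t * r" using r2 by (intro mult_left_mono) auto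
    hence "norm t * (r * r) < 1" using t unfolding power2_eq_square by auto
    thus "regular (q_of a) t X \<and> regular (q_of a) t Y \<and> regular (q_of a) t (X * Y)"
      using t XY r2 by (intro conjI regular_inside norm_q_of_less_1) (auto simp: norm_mult power2_eq_square)
  qed (use r in auto)
  moreover have "t_of a ` {z. -1 / 3 < Re z} \<subseteq> ?V" using a by (auto simp: rpow_simps r_def)
  ultimately show ?thesis unfolding r_def
    using holomorphic_on_compose_gen[OF t_of_holomorphic] by (fastforce simp: o_def)
qed

lemma f_points_holomorphic:
  "(\<lambda>z. f (1 / t_of a z) (1 / t_of a z)) holomorphic_on S"
  "(\<lambda>z. f ((t_of a z)\<^sup>2 * q_of a) (1 / t_of a z)) holomorphic_on S"
  "(\<lambda>z. f (1 / t_of a z) ((t_of a z)\<^sup>2 * q_of a)) holomorphic_on S"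
  "(\<lambda>z. f (t_of a z * q_of a) (1 / ((t_of a z)\<^sup>2 * q_of a))) holomorphic_on S"
  using q_of_nonzero by (auto intro!: torus_holomorphic_compose[OF f] holomorphic_intros)

lemma qpoch_t_of_holomorphic:
  "(\<lambda>z. qpoch (q_of a) (1 / t_of a z)) holomorphic_on S"
  "(\<lambda>z. qpoch (q_of a) (t_of a z * q_of a)) holomorphic_on S"
  "(\<lambda>z. qpoch (q_of a) ((t_of a z)\<^sup>2 * q_of a)) holomorphic_on S"
  "(\<lambda>z. qpoch (q_of a) (1 / (t_of a z)\<^sup>2)) holomorphic_on S"
  "(\<lambda>z. qpoch (q_of a) ((t_of a z) ^ 3 * q_of a)) holomorphic_on S"
  by (auto intro!: holomorphic_intros norm_q_of_less_1)

lemma residue_factors_meromorphic: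
  assumes "open S"
  shows "(\<lambda>z. rho0_qpoch (q_of a) (t_of a z)) meromorphic_on S"
    "(\<lambda>z. rho_qpoch (q_of a) (t_of a z)) meromorphic_on S"
    "(\<lambda>z. varpi1 (q_of a) (t_of a z)) meromorphic_on S"
proof -
  have h: "g meromorphic_on S" if "g holomorphic_on S" for g
    using that assms by (intro analytic_on_imp_meromorphic_on) (simp add: analytic_on_open)
  have t: "t_of a meromorphic_on S" by (intro h holomorphic_intros)
  note m = qpoch_t_of_holomorphic[THEN h] t
  show "(\<lambda>z. rho0_qpoch (q_of a) (t_of a z)) meromorphic_on S"
    "(\<lambda>z. rho_qpoch (q_of a) (t_of a z)) meromorphic_on S"
    "(\<lambda>z. varpi1 (q_of a) (t_of a z)) meromorphic_on S"
    unfolding rho0_qpoch_def rho_qpoch_def varpi1_def by (intro meromorphic_intros m)+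
qed

text \<open>The assumption excludes the zeros of the denominators
  \<open>qpoch q (t\<^sup>2 * q)\<close> and \<open>qpoch q (t ^ 3 * q)\<close>. The denominator 1 -
  t q of varpi1 is harmless for Re k > -1, where |t q| < 1.\<close>

lemma residue_factors_isCont:
  assumes "\<forall>i::nat. (t_of a k)\<^sup>2 * q_of a ^ (i + 1) \<noteq> 1 \<and> (t_of a k) ^ 3 * q_of a ^ (i + 1) \<noteq> 1"
  shows "isCont (\<lambda>z. rho0_qpoch (q_of a) (t_of a z)) k" "isCont (\<lambda>z. rho_qpoch (q_of a) (t_of a z)) k"
    "-1 < Re k \<Longrightarrow> isCont (\<lambda>z. varpi1 (q_of a) (t_of a z)) k"
proof -
  have h: "isCont g k" if "g holomorphic_on UNIV" for g
    using holomorphic_on_imp_continuous_on[OF that] by (simp add: continuous_on_eq_continuous_at)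
  have t: "isCont (t_of a) k" by (intro h holomorphic_intros)
  note c = qpoch_t_of_holomorphic[THEN h] t
  have nz: "qpoch (q_of a) (q_of a) \<noteq> 0" "qpoch (q_of a) ((t_of a k)\<^sup>2 * q_of a) \<noteq> 0" "qpoch (q_of a) ((t_of a k) ^ 3 * q_of a) \<noteq> 0"
    using assms norm_q_of_less_1
    by (intro qpoch_nonzero_inside qpoch_nonzero; simp add: mult.assoc)+
  show "isCont (\<lambda>z. rho0_qpoch (q_of a) (t_of a z)) k" "isCont (\<lambda>z. rho_qpoch (q_of a) (t_of a z)) k"
    unfolding rho0_qpoch_def rho_qpoch_def using nz by (intro continuous_intros c; simp)+
  assume "-1 < Re k"
  hence "norm (t_of a k * q_of a) < 1" using a by (simp add: norm_mult rpow_simps)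
  hence "t_of a k * q_of a \<noteq> 1" by auto
  thus "isCont (\<lambda>z. varpi1 (q_of a) (t_of a z)) k"
    unfolding varpi1_def by (intro continuous_intros c) auto
qed

end

section \<open>The formulas on overlapping strips and their gluing\<close>

context
  fixes a :: real and f :: "complex \<Rightarrow> complex \<Rightarrow> complex"
  assumes a: "a > 0" and f: "torus_holomorphic f"
begin

text \<open>The four pieces express the continuation on the strips -1/3 < Re k, then -1/2 < Re k <
  0, then |Re k + 1/2| < \<epsilon>/2, and -1 < Re k < -1/2.\<close>

definition ct_piece0 :: "complex \<Rightarrow> complex" where
  "ct_piece0 t = ct_mean (q_of a) f (rpow a (1 / 3)) (rpow a (1 / 3)) t"

definition ct_base :: "real \<Rightarrow> complex \<Rightarrow> complex" where
  "ct_base s t = ct_mean (q_of a) f 1 1 t + rho0_qpoch (q_of a) t * zeta1_mean (q_of a) f s t +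
     rho0_qpoch (q_of a) t / t * zeta2_mean (q_of a) f s t"

definition ct_piece1 :: "complex \<Rightarrow> complex" where
  "ct_piece1 t = ct_base 1 t + rho_qpoch (q_of a) t * f (1 / t) (1 / t)"

definition ct_piece2 :: "real \<Rightarrow> complex \<Rightarrow> complex" where
  "ct_piece2 \<epsilon> t = ct_base (rpow a \<epsilon>) t + rho_qpoch (q_of a) t *
     (f (1 / t) (1 / t) + (f (t\<^sup>2 * q_of a) (1 / t) + f (1 / t) (t\<^sup>2 * q_of a)))"

definition ct_piece3 :: "complex \<Rightarrow> complex" where
  "ct_piece3 t = ct_base 1 t + rho_qpoch (q_of a) t *
     (f (1 / t) (1 / t) + varpi1 (q_of a) t * f (t * q_of a) (1 / (t\<^sup>2 * q_of a)) +
      (f (t\<^sup>2 * q_of a) (1 / t) + f (1 / t) (t\<^sup>2 * q_of a)))"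

lemma ct_piece0_eq_1:
  assumes "-1 / 3 < Re z" "Re z < 0"
  shows "ct_piece0 (t_of a z) = ct_piece1 (t_of a z)"
  unfolding ct_piece0_def ct_piece1_def ct_base_def
  by (rule ct_mean_expand[OF q_of_nonzero norm_q_of_less_1 f]) (use a f assms in \<open>simp_all add: rpow_simps\<close>)

text \<open>The upper bound on Re z says that |t^2 q| exceeds the radius |q|^\<epsilon>. The bound
  1/3 on \<epsilon> keeps 1 / t inside the smaller circle: Re z + \<epsilon> < (3 \<epsilon> - 1) /
  2 < 0.\<close>

lemma ct_piece1_eq_2:
  assumes "-1 / 2 < Re z" "Re z < (\<epsilon> - 1) / 2" "0 < \<epsilon>" "\<epsilon> < 1 / 3"
  shows "ct_piece1 (t_of a z) = ct_piece2 \<epsilon> (t_of a z)"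
proof -
  let ?t = "t_of a z" and ?q = "q_of a"
  have "rho0_qpoch ?q ?t * zeta1_mean ?q f 1 ?t = rho0_qpoch ?q ?t * zeta1_mean ?q f (rpow a \<epsilon>) ?t +
          rho_qpoch ?q ?t * (f (?t\<^sup>2 * ?q) (1 / ?t) + f (1 / ?t) (?t\<^sup>2 * ?q))"
    by (rule zeta1_mean_cross[OF q_of_nonzero norm_q_of_less_1 f])
       (use a f assms in \<open>simp_all add: rpow_simps\<close>)
  moreover have "zeta2_mean ?q f 1 ?t = zeta2_mean ?q f (rpow a \<epsilon>) ?t"
    by (rule zeta2_mean_shift[OF q_of_nonzero norm_q_of_less_1 f])
       (use a f assms in \<open>simp_all add: rpow_simps\<close>)
  ultimately show ?thesis
    unfolding ct_piece1_def ct_piece2_def ct_base_def by (simp add: distrib_left)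
qed

text \<open>The lower bound on Re z says that 1 / (t^2 q) has not reached the smaller circle. Here
  \<epsilon> < 1/3 keeps t q inside it: Re z + 1 > (1 - \<epsilon>) / 2 > \<epsilon>.\<close>

lemma ct_piece2_eq_3:
  assumes "-(1 + \<epsilon>) / 2 < Re z" "Re z < -1 / 2" "0 < \<epsilon>" "\<epsilon> < 1 / 3"
  shows "ct_piece2 \<epsilon> (t_of a z) = ct_piece3 (t_of a z)"
proof -
  let ?t = "t_of a z" and ?q = "q_of a"
  have "zeta1_mean ?q f (rpow a \<epsilon>) ?t = zeta1_mean ?q f 1 ?t"
    by (rule zeta1_mean_shift[OF q_of_nonzero norm_q_of_less_1 f])
       (use a f assms in \<open>simp_all add: rpow_simps\<close>)
  moreover have "rho0_qpoch ?q ?t / ?t * zeta2_mean ?q f (rpow a \<epsilon>) ?t =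
      rho0_qpoch ?q ?t / ?t * zeta2_mean ?q f 1 ?t +
      rho_qpoch ?q ?t * (varpi1 ?q ?t * f (?t * ?q) (1 / (?t\<^sup>2 * ?q)))"
    by (rule zeta2_mean_cross[OF q_of_nonzero norm_q_of_less_1 f])
       (use a f assms in \<open>simp_all add: rpow_simps\<close>)
  ultimately show ?thesis
    unfolding ct_piece2_def ct_piece3_def ct_base_def by (simp only: distrib_left add_ac)
qed

definition ct_extension :: "real \<Rightarrow> complex \<Rightarrow> complex" where
  "ct_extension \<epsilon> z = (if -1 / 3 < Re z then ct_piece0 (t_of a z)
     else if -1 / 2 < Re z then ct_piece1 (t_of a z)
     else if -(1 + \<epsilon>) / 2 < Re z then ct_piece2 \<epsilon> (t_of a z) else ct_piece3 (t_of a z))"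

text \<open>As the pieces agree on the overlaps, a single formula is valid on each open strip, also
  across the dividing lines of the case distinction. These strips cover Re z > -1.\<close>

lemma ct_extension_eq:
  assumes \<epsilon>: "0 < \<epsilon>" "\<epsilon> < 1 / 3"
  shows "-1 / 3 < Re z \<Longrightarrow> ct_extension \<epsilon> z = ct_piece0 (t_of a z)"
    "-1 / 2 < Re z \<Longrightarrow> Re z < 0 \<Longrightarrow> ct_extension \<epsilon> z = ct_piece1 (t_of a z)"
    "-(1 + \<epsilon>) / 2 < Re z \<Longrightarrow> Re z < (\<epsilon> - 1) / 2 \<Longrightarrow> ct_extension \<epsilon> z = ct_piece2 \<epsilon> (t_of a z)"
    "-1 < Re z \<Longrightarrow> Re z < -1 / 2 \<Longrightarrow> ct_extension \<epsilon> z = ct_piece3 (t_of a z)"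
  unfolding ct_extension_def
  using ct_piece0_eq_1[of z] ct_piece1_eq_2[of z \<epsilon>] ct_piece2_eq_3[of \<epsilon> z] \<epsilon> by auto

lemma ct_base_meromorphic_isCont:
  assumes U: "open U" "U \<subseteq> {z. -1 < Re z \<and> Re z < 0}" and s: "s > 0"
    and dom: "\<And>z. z \<in> U \<Longrightarrow> t_of a z \<in> zeta1_domain (q_of a) s \<inter> zeta2_domain (q_of a) s"
  shows "(\<lambda>z. ct_base s (t_of a z)) meromorphic_on U"
    and "k \<in> U \<Longrightarrow> isCont (\<lambda>z. rho0_qpoch (q_of a) (t_of a z)) k \<Longrightarrow> isCont (\<lambda>z. ct_base s (t_of a z)) k"
proof -
  have h: "g meromorphic_on U" if "g holomorphic_on U" for g
    using that U by (intro analytic_on_imp_meromorphic_on) (simp add: analytic_on_open)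
  have c: "isCont g k" if "g holomorphic_on U" "k \<in> U" for g :: "complex \<Rightarrow> complex"
    using holomorphic_on_imp_continuous_on[OF that(1)] that(2) U(1)
    by (simp add: continuous_on_eq_continuous_at)
  have t: "t_of a holomorphic_on U" by (intro holomorphic_intros)
  have J: "(\<lambda>z. ct_mean (q_of a) f 1 1 (t_of a z)) holomorphic_on U"
    by (rule holomorphic_on_subset[OF ct_mean_outer_holomorphic[OF a f] U(2)])
  note z = zeta_means_t_of_holomorphic[OF a f s dom]
  show "(\<lambda>z. ct_base s (t_of a z)) meromorphic_on U"
    unfolding ct_base_def
    by (intro meromorphic_intros residue_factors_meromorphic[OF a f U(1)] h t J z)
  assume "k \<in> U" "isCont (\<lambda>z. rho0_qpoch (q_of a) (t_of a z)) k"
  thus "isCont (\<lambda>z. ct_base s (t_of a z)) k"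
    unfolding ct_base_def using c[OF J] c[OF z(1)] c[OF z(2)] c[OF t]
    by (intro continuous_intros) auto
qed

lemma ct_piece0_t_of_holomorphic: "(\<lambda>z. ct_piece0 (t_of a z)) holomorphic_on {z. -1 / 3 < Re z}"
  unfolding ct_piece0_def by (rule ct_mean_inner_holomorphic[OF a f])

definition nonresonant :: "complex \<Rightarrow> bool" where
  "nonresonant k \<longleftrightarrow> (\<forall>i::nat. (t_of a k)\<^sup>2 * (q_of a) ^ (i + 1) \<noteq> 1 \<and> (t_of a k) ^ 3 * (q_of a) ^ (i + 1) \<noteq> 1)"

lemma f_points_meromorphic_isCont:
  "(\<lambda>z. f (1 / t_of a z) (1 / t_of a z)) meromorphic_on UNIV"
  "(\<lambda>z. f ((t_of a z)\<^sup>2 * q_of a) (1 / t_of a z)) meromorphic_on UNIV"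
  "(\<lambda>z. f (1 / t_of a z) ((t_of a z)\<^sup>2 * q_of a)) meromorphic_on UNIV"
  "(\<lambda>z. f (t_of a z * q_of a) (1 / ((t_of a z)\<^sup>2 * q_of a))) meromorphic_on UNIV"
  "isCont (\<lambda>z. f (1 / t_of a z) (1 / t_of a z)) k"
  "isCont (\<lambda>z. f ((t_of a z)\<^sup>2 * q_of a) (1 / t_of a z)) k"
  "isCont (\<lambda>z. f (1 / t_of a z) ((t_of a z)\<^sup>2 * q_of a)) k"
  "isCont (\<lambda>z. f (t_of a z * q_of a) (1 / ((t_of a z)\<^sup>2 * q_of a))) k"
proof -
  have h: "g meromorphic_on UNIV" if "g holomorphic_on UNIV" for g
    using that by (intro analytic_on_imp_meromorphic_on) (simp add: analytic_on_open)
  have c: "isCont g k" if "g holomorphic_on UNIV" for g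
    using holomorphic_on_imp_continuous_on[OF that] by (simp add: continuous_on_eq_continuous_at)
  note p = f_points_holomorphic[OF a f, of UNIV]
  show "(\<lambda>z. f (1 / t_of a z) (1 / t_of a z)) meromorphic_on UNIV"
    "(\<lambda>z. f ((t_of a z)\<^sup>2 * q_of a) (1 / t_of a z)) meromorphic_on UNIV"
    "(\<lambda>z. f (1 / t_of a z) ((t_of a z)\<^sup>2 * q_of a)) meromorphic_on UNIV"
    "(\<lambda>z. f (t_of a z * q_of a) (1 / ((t_of a z)\<^sup>2 * q_of a))) meromorphic_on UNIV"
    "isCont (\<lambda>z. f (1 / t_of a z) (1 / t_of a z)) k"
    "isCont (\<lambda>z. f ((t_of a z)\<^sup>2 * q_of a) (1 / t_of a z)) k"
    "isCont (\<lambda>z. f (1 / t_of a z) ((t_of a z)\<^sup>2 * q_of a)) k"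
    "isCont (\<lambda>z. f (t_of a z * q_of a) (1 / ((t_of a z)\<^sup>2 * q_of a))) k"
    by (rule h[OF p(1)] h[OF p(2)] h[OF p(3)] h[OF p(4)] c[OF p(1)] c[OF p(2)] c[OF p(3)] c[OF p(4)])+
qed

lemma open_Re_strip: "open {z. x < Re z \<and> Re z < y}"
  by (intro open_Collect_conj open_halfspace_Re_gt open_halfspace_Re_lt)

lemma ct_piece1_meromorphic_isCont:
  "(\<lambda>z. ct_piece1 (t_of a z)) meromorphic_on {z. -1 / 2 < Re z \<and> Re z < 0}" (is "_ meromorphic_on ?U")
  "-1 / 2 < Re k \<Longrightarrow> Re k < 0 \<Longrightarrow> nonresonant k \<Longrightarrow> isCont (\<lambda>z. ct_piece1 (t_of a z)) k"
proof -
  have dom: "t_of a z \<in> zeta1_domain (q_of a) 1 \<inter> zeta2_domain (q_of a) 1" if "z \<in> ?U" for z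
    using that a unfolding zeta1_domain_def zeta2_domain_def by (simp add: rpow_simps)
  have sub: "?U \<subseteq> {z. -1 < Re z \<and> Re z < 0}" by auto
  note base = ct_base_meromorphic_isCont[OF open_Re_strip sub zero_less_one dom]
  show "(\<lambda>z. ct_piece1 (t_of a z)) meromorphic_on ?U"
    unfolding ct_piece1_def
    by (intro meromorphic_intros base residue_factors_meromorphic[OF a f open_Re_strip]
          f_points_meromorphic_isCont(1-4)[THEN meromorphic_on_subset] subset_UNIV)
  assume "-1 / 2 < Re k" "Re k < 0" "nonresonant k"
  thus "isCont (\<lambda>z. ct_piece1 (t_of a z)) k"
    unfolding ct_piece1_def nonresonant_def
    by (intro continuous_intros base residue_factors_isCont[OF a f] f_points_meromorphic_isCont) auto
qed

lemma ct_piece2_meromorphic_isCont: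
  assumes \<epsilon>: "0 < \<epsilon>" "\<epsilon> < 1 / 3"
  shows "(\<lambda>z. ct_piece2 \<epsilon> (t_of a z)) meromorphic_on {z. -(1 + \<epsilon>) / 2 < Re z \<and> Re z < (\<epsilon> - 1) / 2}"
      (is "_ meromorphic_on ?U")
    "-(1 + \<epsilon>) / 2 < Re k \<Longrightarrow> Re k < (\<epsilon> - 1) / 2 \<Longrightarrow> nonresonant k \<Longrightarrow>
       isCont (\<lambda>z. ct_piece2 \<epsilon> (t_of a z)) k"
proof -
  have dom: "t_of a z \<in> zeta1_domain (q_of a) (rpow a \<epsilon>) \<inter> zeta2_domain (q_of a) (rpow a \<epsilon>)" if "z \<in> ?U" for z
    using that a \<epsilon> unfolding zeta1_domain_def zeta2_domain_def by (simp add: rpow_simps)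
  have sub: "?U \<subseteq> {z. -1 < Re z \<and> Re z < 0}" using \<epsilon> by auto
  note base = ct_base_meromorphic_isCont[OF open_Re_strip sub rpow_pos dom]
  show "(\<lambda>z. ct_piece2 \<epsilon> (t_of a z)) meromorphic_on ?U"
    unfolding ct_piece2_def
    by (intro meromorphic_intros base residue_factors_meromorphic[OF a f open_Re_strip]
          f_points_meromorphic_isCont(1-4)[THEN meromorphic_on_subset] subset_UNIV)
  assume "-(1 + \<epsilon>) / 2 < Re k" "Re k < (\<epsilon> - 1) / 2" "nonresonant k"
  thus "isCont (\<lambda>z. ct_piece2 \<epsilon> (t_of a z)) k"
    unfolding ct_piece2_def nonresonant_def
    by (intro continuous_intros base residue_factors_isCont[OF a f] f_points_meromorphic_isCont) auto
qed

lemma ct_piece3_meromorphic_isCont: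
  "(\<lambda>z. ct_piece3 (t_of a z)) meromorphic_on {z. -1 < Re z \<and> Re z < -1 / 2}" (is "_ meromorphic_on ?U")
  "-1 < Re k \<Longrightarrow> Re k < -1 / 2 \<Longrightarrow> nonresonant k \<Longrightarrow> isCont (\<lambda>z. ct_piece3 (t_of a z)) k"
proof -
  have dom: "t_of a z \<in> zeta1_domain (q_of a) 1 \<inter> zeta2_domain (q_of a) 1" if "z \<in> ?U" for z
    using that a unfolding zeta1_domain_def zeta2_domain_def by (simp add: rpow_simps)
  have sub: "?U \<subseteq> {z. -1 < Re z \<and> Re z < 0}" by auto
  note base = ct_base_meromorphic_isCont[OF open_Re_strip sub zero_less_one dom]
  show "(\<lambda>z. ct_piece3 (t_of a z)) meromorphic_on ?U"
    unfolding ct_piece3_def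
    by (intro meromorphic_intros base residue_factors_meromorphic[OF a f open_Re_strip]
          f_points_meromorphic_isCont(1-4)[THEN meromorphic_on_subset] subset_UNIV)
  assume "-1 < Re k" "Re k < -1 / 2" "nonresonant k"
  thus "isCont (\<lambda>z. ct_piece3 (t_of a z)) k"
    unfolding ct_piece3_def nonresonant_def
    by (intro continuous_intros base residue_factors_isCont[OF a f] f_points_meromorphic_isCont) auto
qed

lemma ct_extension_meromorphic:
  assumes \<epsilon>: "0 < \<epsilon>" "\<epsilon> < 1 / 3"
  shows "ct_extension \<epsilon> meromorphic_on {z. -1 < Re z}"
proof -
  have transfer: "ct_extension \<epsilon> meromorphic_on U"
    if g: "g meromorphic_on U" "open U" and eq: "\<And>z. z \<in> U \<Longrightarrow> ct_extension \<epsilon> z = g z" for g U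
  proof -
    have "\<forall>\<^sub>F w in at z. ct_extension \<epsilon> w = g w" if "z \<in> U" for z
      using eventually_at_in_open'[OF g(2) that] by eventually_elim (rule eq)
    from meromorphic_on_cong[OF this refl] show ?thesis using g by blast
  qed
  have "(\<lambda>z. ct_piece0 (t_of a z)) meromorphic_on {z. -1 / 3 < Re z}"
    using ct_piece0_t_of_holomorphic
    by (intro analytic_on_imp_meromorphic_on) (simp add: analytic_on_open open_halfspace_Re_gt)
  hence 0: "ct_extension \<epsilon> meromorphic_on {z. -1 / 3 < Re z}"
    by (rule transfer[OF _ open_halfspace_Re_gt]) (simp add: ct_extension_eq(1)[OF \<epsilon>])
  have 1: "ct_extension \<epsilon> meromorphic_on {z. -1 / 2 < Re z \<and> Re z < 0}"
    by (rule transfer[OF ct_piece1_meromorphic_isCont(1) open_Re_strip])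
       (simp add: ct_extension_eq(2)[OF \<epsilon>])
  have 2: "ct_extension \<epsilon> meromorphic_on {z. -(1 + \<epsilon>) / 2 < Re z \<and> Re z < (\<epsilon> - 1) / 2}"
    by (rule transfer[OF ct_piece2_meromorphic_isCont(1)[OF \<epsilon>] open_Re_strip])
       (simp add: ct_extension_eq(3)[OF \<epsilon>])
  have 3: "ct_extension \<epsilon> meromorphic_on {z. -1 < Re z \<and> Re z < -1 / 2}"
    by (rule transfer[OF ct_piece3_meromorphic_isCont(1) open_Re_strip])
       (simp add: ct_extension_eq(4)[OF \<epsilon>])
  show ?thesis
    by (rule meromorphic_on_subset[OF meromorphic_on_Un[OF meromorphic_on_Un[OF 0 1] meromorphic_on_Un[OF 2 3]]])
       (use \<epsilon> in auto)
qed

section \<open>The value of the continuation\<close>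

lemma ct_piece0_eq_ct_right:
  assumes "Re z > 0"
  shows "ct_piece0 (t_of a z) = ct_right a f z"
proof -
  have "ct_mean (q_of a) f 1 1 (t_of a z) = ct_piece0 (t_of a z)"
    unfolding ct_piece0_def
    by (rule ct_mean_shift_radius[OF q_of_nonzero norm_q_of_less_1 f])
       (use a f assms in \<open>simp_all add: rpow_simps\<close>)
  thus ?thesis by (simp add: ct_right_eq_torus_mean[OF a assms] ct_mean_def)
qed

text \<open>The glued function can have arbitrary values at singular points, so the continuation
  proper is obtained from it by \<open>remove_sings\<close>. Its value at k is a limit, and
  continuity of g identifies this limit with g k.\<close>

lemma ct_eqI:
  assumes \<epsilon>: "0 < \<epsilon>" "\<epsilon> < 1 / 3" and U: "open U" "k \<in> U"
    and eq: "\<And>z. z \<in> U \<Longrightarrow> ct_extension \<epsilon> z = g z" and g: "isCont g k" and k: "-1 < Re k"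
  shows "ct a f k = g k"
proof -
  let ?F = "remove_sings (ct_extension \<epsilon>)"
  have F_eq: "?F z = g z" if "open U" "z \<in> U" "\<And>w. w \<in> U \<Longrightarrow> ct_extension \<epsilon> w = g w" "isCont g z" for g U z
  proof (rule remove_sings_eqI)
    have "\<forall>\<^sub>F w in at z. g w = ct_extension \<epsilon> w"
      using eventually_at_in_open'[OF that(1,2)] by eventually_elim (use that(3) in simp)
    thus "ct_extension \<epsilon> \<midarrow>z\<rightarrow> g z"
      using that(4) unfolding isCont_def by (rule Lim_transform_eventually[rotated])
  qed
  have "ct a f k = ?F k"
    unfolding ct_def
  proof (rule continuation_eqI)
    show "?F nicely_meromorphic_on {z. -1 < Re z}"
      by (rule remove_sings_nicely_meromorphic[OF ct_extension_meromorphic[OF \<epsilon>]])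
    fix z assume z: "0 < Re z"
    have "?F z = ct_piece0 (t_of a z)"
    proof (rule F_eq[OF open_halfspace_Re_gt])
      show "z \<in> {z. -1 / 3 < Re z}" using z by simp
      thus "isCont (\<lambda>z. ct_piece0 (t_of a z)) z"
        using holomorphic_on_imp_continuous_on[OF ct_piece0_t_of_holomorphic]
        by (simp add: continuous_on_eq_continuous_at open_halfspace_Re_gt)
    qed (simp add: ct_extension_eq(1)[OF \<epsilon>])
    thus "?F z = ct_right a f z" by (simp add: ct_piece0_eq_ct_right[OF z])
  qed (use k in auto)
  also have "\<dots> = g k" by (rule F_eq[OF U eq g])
  finally show ?thesis .
qed

lemma ct_eq_pieces:
  assumes k: "nonresonant k"
  shows "-1 / 2 < Re k \<Longrightarrow> Re k < 0 \<Longrightarrow> ct a f k = ct_piece1 (t_of a k)"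
    "-1 < Re k \<Longrightarrow> Re k < -1 / 2 \<Longrightarrow> ct a f k = ct_piece3 (t_of a k)"
    "Re k = -1 / 2 \<Longrightarrow> 0 < \<epsilon> \<Longrightarrow> \<epsilon> < 1 / 3 \<Longrightarrow> ct a f k = ct_piece2 \<epsilon> (t_of a k)"
proof -
  \<comment> \<open>Any number between 0 and 1/3 would do: the first two formulas do not depend on
    the auxiliary radius.\<close>
  have \<delta>: "0 < (1 / 6 :: real)" "1 / 6 < (1 / 3 :: real)" by auto
  {
    assume "-1 / 2 < Re k" "Re k < 0"
    thus "ct a f k = ct_piece1 (t_of a k)"
      by (intro ct_eqI[OF \<delta> open_Re_strip[of "-1 / 2" 0], of k "\<lambda>z. ct_piece1 (t_of a z)"]
            ct_piece1_meromorphic_isCont k) (auto simp: ct_extension_eq(2)[OF \<delta>])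
  next
    assume "-1 < Re k" "Re k < -1 / 2"
    thus "ct a f k = ct_piece3 (t_of a k)"
      by (intro ct_eqI[OF \<delta> open_Re_strip[of "-1" "-1 / 2"], of k "\<lambda>z. ct_piece3 (t_of a z)"]
            ct_piece3_meromorphic_isCont k) (auto simp: ct_extension_eq(4)[OF \<delta>])
  next
    assume *: "Re k = -1 / 2" "0 < \<epsilon>" "\<epsilon> < 1 / 3"
    thus "ct a f k = ct_piece2 \<epsilon> (t_of a k)"
      by (intro ct_eqI[OF *(2,3) open_Re_strip[of "-(1 + \<epsilon>) / 2" "(\<epsilon> - 1) / 2"], of k "\<lambda>z. ct_piece2 \<epsilon> (t_of a z)"]
            ct_piece2_meromorphic_isCont k) (auto simp: ct_extension_eq(3)[OF *(2,3)])
  }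
qed

section \<open>Return to the integrals of the statement\<close>

lemma line_integrals_eq:
  "line_integrals a k \<epsilon> f = rho0_qpoch (q_of a) (t_of a k) * zeta1_mean (q_of a) f (rpow a \<epsilon>) (t_of a k) +
     rho0_qpoch (q_of a) (t_of a k) / t_of a k * zeta2_mean (q_of a) f (rpow a \<epsilon>) (t_of a k)"
proof -
  let ?q = "q_of a" and ?t = "t_of a k"
  note q1 = norm_q_of_less_1[OF a f]
  have c: "1 / (2 * pi * \<i> * a) * period_integral a \<epsilon> (\<lambda>y. h (q_of a powr y)) = circle_mean (rpow a \<epsilon>) h" for h
    using a by (simp add: period_integral_circle_mean rpow_def)
  have "1 / (2 * pi * \<i> * a) * period_integral a \<epsilon>
          (\<lambda>y. (f (inverse ?t) (?q powr y) + f (?q powr y) (inverse ?t)) * zeta1 ?q ?t (?q powr y)) =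
        circle_mean (rpow a \<epsilon>) (\<lambda>Y. (f (inverse ?t) Y + f Y (inverse ?t)) * zeta1 ?q ?t Y)"
    by (rule c)
  also have "\<dots> = circle_mean (rpow a \<epsilon>)
      (\<lambda>Y. rho0_qpoch ?q ?t * ((f (1 / ?t) Y + f Y (1 / ?t)) * zeta1_qpoch ?q ?t Y))"
    by (simp add: zeta1_eq[OF q1] inverse_eq_divide mult_ac)
  also have "\<dots> = rho0_qpoch ?q ?t * zeta1_mean ?q f (rpow a \<epsilon>) ?t"
    unfolding zeta1_mean_def by (rule circle_mean_mult_right)
  finally have 1: "1 / (2 * pi * \<i> * a) * period_integral a \<epsilon>
          (\<lambda>y. (f (inverse ?t) (?q powr y) + f (?q powr y) (inverse ?t)) * zeta1 ?q ?t (?q powr y)) =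
        rho0_qpoch ?q ?t * zeta1_mean ?q f (rpow a \<epsilon>) ?t" .
  have "1 / (2 * pi * \<i> * a) * period_integral a \<epsilon>
          (\<lambda>y. f (inverse ?t * ?q powr (- y)) (?q powr y) * zeta2 ?q ?t (?q powr y)) =
        circle_mean (rpow a \<epsilon>) (\<lambda>Y. f (inverse ?t * inverse Y) Y * zeta2 ?q ?t Y)"
    unfolding powr_minus by (rule c)
  also have "\<dots> = circle_mean (rpow a \<epsilon>)
      (\<lambda>Y. rho0_qpoch ?q ?t / ?t * (f (1 / (?t * Y)) Y * zeta2_qpoch ?q ?t Y))"
    by (simp add: zeta2_eq[OF q1] inverse_eq_divide mult_ac)
  also have "\<dots> = rho0_qpoch ?q ?t / ?t * zeta2_mean ?q f (rpow a \<epsilon>) ?t"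
    unfolding zeta2_mean_def by (rule circle_mean_mult_right)
  finally show ?thesis unfolding line_integrals_def Let_def by (simp only: 1)
qed

lemma ct_base_eq:
  "ct_base (rpow a \<epsilon>) (t_of a k) = I0 a k f / (2 * pi * \<i> * a)\<^sup>2 + line_integrals a k \<epsilon> f"
  unfolding ct_base_def line_integrals_eq I0_eq_torus_mean[OF a] ct_mean_def by simp

end

theorem proposition11p2:
  fixes a :: real and k q t :: complex and f :: "complex \<Rightarrow> complex \<Rightarrow> complex"
  assumes "a > 0"
    and "q = q_of a" and "t = t_of a k"
    and "(\<exists>c. laurent_coeffs f c) \<or> analytic_torus f"
    and "\<forall>i::nat. t\<^sup>2 * q ^ (i + 1) \<noteq> 1 \<and> t ^ 3 * q ^ (i + 1) \<noteq> 1"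
  shows "(- 1 / 2 < Re k \<and> Re k < 0 \<longrightarrow>
            ct a f k = I0 a k f / (2 * pi * \<i> * a)\<^sup>2 + line_integrals a k 0 f +
              rho q t * f (inverse t) (inverse t)) \<and>
         (- 1 < Re k \<and> Re k < - 1 / 2 \<longrightarrow>
            ct a f k = I0 a k f / (2 * pi * \<i> * a)\<^sup>2 + line_integrals a k 0 f +
              rho q t * (f (inverse t) (inverse t) +
                varpi1 q t * f (t * q) (inverse (t\<^sup>2) * inverse q) +
                varpi2 q t * (f (t\<^sup>2 * q) (inverse t) + f (inverse t) (t\<^sup>2 * q)))) \<and>
         (Re k = - 1 / 2 \<longrightarrow>
            (\<forall>\<^sub>F \<epsilon> in at_right 0.
              ct a f k = I0 a k f / (2 * pi * \<i> * a)\<^sup>2 + line_integrals a k \<epsilon> f +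
                rho q t * (f (inverse t) (inverse t) +
                  varpi2 q t * (f (t\<^sup>2 * q) (inverse t) + f (inverse t) (t\<^sup>2 * q)))))"
proof -
  note a = assms(1) and q = assms(2) and t = assms(3)
  have f: "torus_holomorphic f"
    using assms(4) torus_holomorphic_laurent torus_holomorphic_analytic_torus by blast
  have q1: "norm q < 1" unfolding q by (rule norm_q_of_less_1[OF a f])
  have k: "nonresonant a k" unfolding nonresonant_def[OF a f] using assms(5) q t by simp
  have inv: "inverse t = 1 / t" "inverse (t\<^sup>2) * inverse q = 1 / (t\<^sup>2 * q)"
    by (simp_all add: divide_inverse)
  have base: "I0 a k f / (2 * pi * \<i> * a)\<^sup>2 + line_integrals a k \<epsilon> f = ct_base a f (rpow a \<epsilon>) t" for \<epsilon>
    unfolding t by (rule ct_base_eq[OF a f, symmetric])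
  \<comment> \<open>Without a shift of the path the line integrals are means over the unit
    circle.\<close>
  have r0: "rpow a 0 = 1" by (simp add: rpow_def)
  note eqs = ct_eq_pieces[OF a f k, folded t]
  have "ct a f k = ct_base a f 1 t + rho q t * f (1 / t) (1 / t)" if "-1 / 2 < Re k" "Re k < 0"
    using eqs(1)[OF that] unfolding ct_piece1_def[OF a f] by (simp add: rho_eq[OF q1] q[symmetric])
  moreover have "ct a f k = ct_base a f 1 t + rho q t * (f (1 / t) (1 / t) +
        varpi1 q t * f (t * q) (1 / (t\<^sup>2 * q)) + (f (t\<^sup>2 * q) (1 / t) + f (1 / t) (t\<^sup>2 * q)))"
    if "-1 < Re k" "Re k < -1 / 2"
    using eqs(2)[OF that] unfolding ct_piece3_def[OF a f] by (simp add: rho_eq[OF q1] q[symmetric])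
  moreover have "\<forall>\<^sub>F \<epsilon> in at_right 0. ct a f k = ct_base a f (rpow a \<epsilon>) t +
        rho q t * (f (1 / t) (1 / t) + (f (t\<^sup>2 * q) (1 / t) + f (1 / t) (t\<^sup>2 * q)))"
    if "Re k = -1 / 2"
  proof -
    \<comment> \<open>The formula on the line Re k = -1/2 holds for every shift in this
      interval.\<close>
    have "\<forall>\<^sub>F \<epsilon> in at_right (0::real). \<epsilon> \<in> {0<..<1 / 3}"
      by (rule eventually_at_right_real) simp
    thus ?thesis
    proof eventually_elim
      case (elim \<epsilon>)
      hence \<epsilon>: "0 < \<epsilon>" "\<epsilon> < 1 / 3" by auto
      show ?case
        using eqs(3)[OF that \<epsilon>] unfolding ct_piece2_def[OF a f]
        by (simp add: rho_eq[OF q1] q[symmetric])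
    qed
  qed
  ultimately show ?thesis
    unfolding base r0 inv varpi2_def mult_1_left by blast
qed

end
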